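(* Let $S=\{\alpha_1,\alpha_2,\alpha_3\}$ be the set of Arnoux-Rauzy substitutions over the three letters $\mathcal{A}=\{1,2,3\}$, where $\alpha_i:i\mapsto i,\ j\mapsto ji$ for $j\in\mathcal{A}\setminus\{i\}$. Let $\boldsymbol{\sigma}=(\sigma_n)_{n\in\mathbb{N}}\in S^{\mathbb{N}}$ be given and assume that it contains each of the substitutions $\alpha_1,\alpha_2,\alpha_3$ at least once. If $\boldsymbol{\sigma}$ is recurrent and has bounded weak partial quotients, then the collection $\mathcal{C}_{\mathbf{1}}$ forms a tiling of $\mathbf{1}^\bot$, the $S$-adic shift $(X_{\boldsymbol{\sigma}},\Sigma)$ is measurably conjugate to a translation on the torus $\mathbb{T}^2$, and the words in $X_{\boldsymbol{\sigma}}$ form natural codings of this translation.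
   Context: $\mathbb{N}=\{0,1,2,\ldots\}$. The sequence $\boldsymbol{\sigma}$ is recurrent if each finite block of consecutive terms of $\boldsymbol{\sigma}$ occurs infinitely often in $\boldsymbol{\sigma}$. A sequence $\boldsymbol{\sigma}$ containing each $\alpha_i$ infinitely often has bounded weak partial quotients if there is $h\in\mathbb{N}$ such that $\sigma_n=\sigma_{n+1}=\cdots=\sigma_{n+h}$ does not hold for any $n\in\mathbb{N}$. The incidence matrix of a substitution $\sigma$ is $M_\sigma=(|\sigma(j)|_i)_{i,j\in\mathcal{A}}$, where $|w|_i$ counts occurrences of $i$ in $w$; $\mathbf{l}(w)={}^t(|w|_1,|w|_2,|w|_3)$. Put $M_n=M_{\sigma_n}$, $\sigma_{[k,\ell)}=\sigma_k\cdots\sigma_{\ell-1}$, $M_{[k,\ell)}=M_k\cdots M_{\ell-1}$. $X_{\boldsymbol{\sigma}}$ is the set of infinite words in $\mathcal{A}^{\mathbb{N}}$ each of whose factors is a factor of $\sigma_{[0,n)}(i)$ for some $i\in\mathcal{A}$, $n\in\mathbb{N}$; $\Sigma$ is the shift, and $(X_{\boldsymbol{\sigma}},\Sigma)$ (which is uniquely ergodic here) carries its unique shift invariant probability measure. A limit word of $\boldsymbol{\sigma}$ is an infinite word $\omega=\omega^{(0)}$ for which there are infinite words $\omega^{(n)}$ with $\omega^{(n)}=\sigma_n(\omega^{(n+1)})$ for all $n$. $\mathbf{u}$ is a positive vector with $\bigcap_nM_{[0,n)}\mathbb{R}_+^3=\mathbb{R}_+\mathbf{u}$ (it exists here). $\mathbf{1}={}^t(1,1,1)$,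 $\mathbf{1}^\bot$ is the plane orthogonal to $\mathbf{1}$, and $\pi_{\mathbf{u},\mathbf{1}}$ is the projection along $\mathbf{u}$ onto $\mathbf{1}^\bot$. $\mathcal{R}(i)$ is the closure of $\{\pi_{\mathbf{u},\mathbf{1}}\mathbf{l}(p):p\in\mathcal{A}^*,\ p\,i\text{ is a prefix of a limit word of }\boldsymbol{\sigma}\}$, and $\mathcal{C}_{\mathbf{1}}=\{\mathbf{x}+\mathcal{R}(i):\mathbf{x}\in\mathbb{Z}^3\cap\mathbf{1}^\bot,\ i\in\mathcal{A}\}$. A collection of compact sets is a tiling of $\mathbf{1}^\bot$ if each set is the closure of its interior and almost every point of $\mathbf{1}^\bot$ lies in exactly one of the sets. Natural coding: for a full-rank lattice $\Lambda$ in a Euclidean space, a translation $T_{\mathbf{t}}$ on the quotient torus, a fundamental domain $R$ of $\Lambda$ with induced map $\tilde T_{\mathbf{t}}:R\to R$, and a partition (up to measure zero) $R=R_1\cup\cdots\cup R_k$ such that each restriction $\tilde T_{\mathbf{t}}|_{R_i}$ is a translation $\mathbf{x}\mapsto\mathbf{x}+\mathbf{t}_i$, a coding of (the orbit of) a point of $R$ with respect to this partition is called a natural coding of $T_{\mathbf{t}}$; here one fixed partition serves for all words of $X_{\boldsymbol{\sigma}}$. *)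

theory Defs
  imports "HOL-Probability.Probability" "HOL-Library.Sublist"
begin

text \<open>
  Letters are the elements of the type \<open>3\<close>, which also indexes the coordinates of
  \<open>real^3\<close>. Finite words are lists and infinite words are functions on \<open>nat\<close>.
\<close>

type_synonym letter = 3
type_synonym word = "letter list"
type_synonym inf_word = "nat \<Rightarrow> letter"
type_synonym substitution = "letter \<Rightarrow> word"

section \<open>Substitutions and directive sequences\<close>

definition AR :: "letter \<Rightarrow> substitution" where
  "AR i = (\<lambda>j. if j = i then [i] else [j, i])"

definition subst_word :: "substitution \<Rightarrow> word \<Rightarrow> word" where
  "subst_word s w = concat (map s w)"

text \<open>
  The action on infinite words. For a non-erasing substitution the image of the first
  \<open>k + 1\<close> letters has length at least \<open>k + 1\<close>, so it determines the letter at
  position \<open>k\<close>.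
\<close>

definition subst_inf :: "substitution \<Rightarrow> inf_word \<Rightarrow> inf_word" where
  "subst_inf s w = (\<lambda>k. subst_word s (map w [0..<Suc k]) ! k)"

primrec subst_prod :: "(nat \<Rightarrow> substitution) \<Rightarrow> nat \<Rightarrow> word \<Rightarrow> word" where
  "subst_prod \<sigma> 0 w = w"
| "subst_prod \<sigma> (Suc n) w = subst_prod \<sigma> n (subst_word (\<sigma> n) w)"

definition incidence_matrix :: "substitution \<Rightarrow> real^3^3" where
  "incidence_matrix s = (\<chi> i j. real (count_list (s j) i))"

primrec matrix_prod :: "(nat \<Rightarrow> substitution) \<Rightarrow> nat \<Rightarrow> real^3^3" where
  "matrix_prod \<sigma> 0 = mat 1"
| "matrix_prod \<sigma> (Suc n) = matrix_prod \<sigma> n ** incidence_matrix (\<sigma> n)"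

definition abelianization :: "word \<Rightarrow> real^3" where
  "abelianization w = (\<chi> i. real (count_list w i))"

definition recurrent :: "(nat \<Rightarrow> 'a) \<Rightarrow> bool" where
  "recurrent \<sigma> \<longleftrightarrow> (\<forall>k l. infinite {m. \<forall>j<l. \<sigma> (m + j) = \<sigma> (k + j)})"

definition bounded_weak_partial_quotients :: "(nat \<Rightarrow> 'a) \<Rightarrow> bool" where
  "bounded_weak_partial_quotients \<sigma> \<longleftrightarrow>
     (\<exists>h. \<forall>n. \<not> (\<forall>j\<le>h. \<sigma> (n + j) = \<sigma> n))"

section \<open>The shift and its invariant measure\<close>

definition sadic_shift :: "(nat \<Rightarrow> substitution) \<Rightarrow> inf_word set" where
  "sadic_shift \<sigma> =
     {w. \<forall>k l. \<exists>i n. sublist (map w [k..<l]) (subst_prod \<sigma> n [i])}"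

definition shift :: "inf_word \<Rightarrow> inf_word" where
  "shift w = (\<lambda>n. w (Suc n))"

text \<open>
  The Borel sets of the product topology on infinite words are those of the product
  sigma-algebra, the alphabet being finite and discrete.
\<close>

definition shift_invariant_prob :: "inf_word set \<Rightarrow> inf_word measure \<Rightarrow> bool" where
  "shift_invariant_prob X \<mu> \<longleftrightarrow>
     prob_space \<mu> \<and>
     sets \<mu> = sets (restrict_space (PiM UNIV (\<lambda>_. count_space UNIV)) X) \<and>
     shift \<in> measurable \<mu> \<mu> \<and> distr \<mu> \<mu> shift = \<mu>"

text \<open>Specified only when there is exactly one invariant measure.\<close>

definition invariant_measure :: "inf_word set \<Rightarrow> inf_word measure" where
  "invariant_measure X = (THE \<mu>. shift_invariant_prob X \<mu>)"

section \<open>Rauzy fractals\<close>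

definition limit_word :: "(nat \<Rightarrow> substitution) \<Rightarrow> inf_word \<Rightarrow> bool" where
  "limit_word \<sigma> \<omega> \<longleftrightarrow>
     (\<exists>W. W 0 = \<omega> \<and> (\<forall>n. W n = subst_inf (\<sigma> n) (W (Suc n))))"

definition prefix_inf :: "word \<Rightarrow> inf_word \<Rightarrow> bool" where
  "prefix_inf p \<omega> \<longleftrightarrow> p = map \<omega> [0..<length p]"

definition nonneg_cone :: "(real^3) set" where
  "nonneg_cone = {x. \<forall>i. 0 \<le> x $ i}"

definition right_eigenvector :: "(nat \<Rightarrow> substitution) \<Rightarrow> real^3 \<Rightarrow> bool" where
  "right_eigenvector \<sigma> u \<longleftrightarrow>
     (\<forall>i. 0 < u $ i) \<and>
     (\<Inter>n. (\<lambda>x. matrix_prod \<sigma> n *v x) ` nonneg_cone) = {c *\<^sub>R u |c. 0 \<le> c}"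

text \<open>
  The vector is determined up to a positive factor, on which the projection below does
  not depend; nothing is known about the chosen vector unless one exists.
\<close>

definition limit_direction :: "(nat \<Rightarrow> substitution) \<Rightarrow> real^3" where
  "limit_direction \<sigma> = (SOME u. right_eigenvector \<sigma> u)"

text \<open>Here \<open>1 :: real^3\<close> is the vector whose entries are all \<open>1\<close>.\<close>

definition perp_one :: "(real^3) set" where
  "perp_one = {x. x \<bullet> 1 = 0}"

definition proj_along :: "real^3 \<Rightarrow> real^3 \<Rightarrow> real^3" where
  "proj_along u x = x - ((x \<bullet> 1) / (u \<bullet> 1)) *\<^sub>R u"

definition rauzy_fractal :: "(nat \<Rightarrow> substitution) \<Rightarrow> letter \<Rightarrow> (real^3) set" where
  "rauzy_fractal \<sigma> i =
     closure {proj_along (limit_direction \<sigma>) (abelianization p) |p.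
       \<exists>\<omega>. limit_word \<sigma> \<omega> \<and> prefix_inf (p @ [i]) \<omega>}"

definition int_vectors :: "(real^'n) set" where
  "int_vectors = {x. \<forall>i. x $ i \<in> \<int>}"

definition rauzy_collection :: "(nat \<Rightarrow> substitution) \<Rightarrow> (real^3) set set" where
  "rauzy_collection \<sigma> =
     {(\<lambda>y. x + y) ` rauzy_fractal \<sigma> i |x i. x \<in> int_vectors \<inter> perp_one}"

section \<open>Tilings of the plane\<close>

text \<open>
  Lebesgue measure on the plane \<open>perp_one\<close>, regarded as a measure on \<open>real^3\<close>
  that is concentrated on the plane. It is transported from \<open>real^2\<close> by a linear
  isomorphism that maps the integer vectors onto those in the plane, so it equals the
  Euclidean area up to a constant factor and has the same null sets.
\<close>

definition plane_measure :: "(real^3) measure" where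
  "plane_measure =
     distr lborel borel
       (\<lambda>y :: real^2. y $ 1 *\<^sub>R (axis 1 1 - axis 3 1) + y $ 2 *\<^sub>R (axis 2 1 - axis 3 1))"

text \<open>The interior of a tile is taken in the plane, not in \<open>real^3\<close>.\<close>

definition tiling_of_plane :: "(real^3) set set \<Rightarrow> bool" where
  "tiling_of_plane C \<longleftrightarrow>
     (\<forall>S\<in>C. S \<subseteq> perp_one \<and> compact S \<and>
        S = closure ((top_of_set perp_one) interior_of S)) \<and>
     (AE x in plane_measure. \<exists>!S. S \<in> C \<and> x \<in> S)"

section \<open>Measurable conjugacy and toral translations\<close>

text \<open>
  An isomorphism of measure preserving systems: after removing null sets it is an
  invertible measure preserving map that intertwines the two transformations.
\<close>

definition measurably_conjugate ::
  "'a measure \<Rightarrow> ('a \<Rightarrow> 'a) \<Rightarrow> 'b measure \<Rightarrow> ('b \<Rightarrow> 'b) \<Rightarrow> bool" where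
  "measurably_conjugate M S N T \<longleftrightarrow>
     (\<exists>X Y \<phi> \<psi>.
        X \<in> sets M \<and> (AE x in M. x \<in> X) \<and> S ` X \<subseteq> X \<and>
        Y \<in> sets N \<and> (AE y in N. y \<in> Y) \<and> T ` Y \<subseteq> Y \<and>
        \<phi> \<in> measurable (restrict_space M X) (restrict_space N Y) \<and>
        \<psi> \<in> measurable (restrict_space N Y) (restrict_space M X) \<and>
        (\<forall>x\<in>X. \<psi> (\<phi> x) = x) \<and> (\<forall>y\<in>Y. \<phi> (\<psi> y) = y) \<and>
        distr (restrict_space M X) (restrict_space N Y) \<phi> = restrict_space N Y \<and>
        (\<forall>x\<in>X. \<phi> (S x) = T (\<phi> x)))"

text \<open>
  The torus \<open>real^'n\<close> modulo integer vectors, with its Haar measure, is represented by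
  the half-open unit cube with Lebesgue measure.
\<close>

definition torus :: "(real^'n) measure" where
  "torus = restrict_space lborel {x. \<forall>i. 0 \<le> x $ i \<and> x $ i < 1}"

definition torus_translation :: "real^'n \<Rightarrow> real^'n \<Rightarrow> real^'n" where
  "torus_translation t x = (\<chi> i. frac (x $ i + t $ i))"

section \<open>Natural codings\<close>

definition full_rank_lattice :: "'a::euclidean_space set \<Rightarrow> bool" where
  "full_rank_lattice \<Lambda> \<longleftrightarrow>
     (\<exists>B. independent B \<and> span B = UNIV \<and>
        \<Lambda> = {(\<Sum>b\<in>B. of_int (c b) *\<^sub>R b) |c :: 'a \<Rightarrow> int. True})"

text \<open>Fundamental domains and partitions are understood up to measure zero.\<close>

definition fundamental_domain :: "'a::euclidean_space set \<Rightarrow> 'a set \<Rightarrow> bool" where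
  "fundamental_domain \<Lambda> R \<longleftrightarrow>
     R \<in> sets lebesgue \<and> (AE x in lborel. \<exists>!z. z \<in> \<Lambda> \<and> x - z \<in> R)"

text \<open>
  In a partition up to measure zero the pieces may be altered on null sets, and a
  countable set can already contain an orbit, which would then be coded by every word.
  Hence the pieces are compact and equal to the closure of their interior, so that they
  overlap only along boundaries.
\<close>

definition partition_ae :: "'a::euclidean_space set \<Rightarrow> ('k::finite \<Rightarrow> 'a set) \<Rightarrow> bool" where
  "partition_ae R P \<longleftrightarrow>
     R = (\<Union>i. P i) \<and>
     (\<forall>i. compact (P i) \<and> P i = closure (interior (P i))) \<and>
     (\<forall>i j. i \<noteq> j \<longrightarrow> negligible (P i \<inter> P j))"

text \<open>
  The map induced on \<open>R\<close> by the translation by \<open>t\<close> modulo \<open>\<Lambda>\<close>, as a relation: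
  it is single-valued almost everywhere, but a point of \<open>R\<close> whose image lies on the
  boundary of \<open>R\<close> can have several values.
\<close>

definition induced_map ::
  "'a::euclidean_space set \<Rightarrow> 'a \<Rightarrow> 'a set \<Rightarrow> 'a \<Rightarrow> 'a \<Rightarrow> bool" where
  "induced_map \<Lambda> t R x y \<longleftrightarrow> x \<in> R \<and> y \<in> R \<and> y - (x + t) \<in> \<Lambda>"

definition natural_codings ::
  "'a::euclidean_space set \<Rightarrow> 'a \<Rightarrow> (nat \<Rightarrow> 'k::finite) set \<Rightarrow> bool" where
  "natural_codings \<Lambda> t W \<longleftrightarrow>
     full_rank_lattice \<Lambda> \<and>
     (\<exists>R P \<tau>. fundamental_domain \<Lambda> R \<and> partition_ae R P \<and>
        (\<forall>i. \<forall>x\<in>P i. induced_map \<Lambda> t R x (x + \<tau> i)) \<and>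
        (\<forall>w\<in>W. \<exists>x\<in>R. \<forall>n. x + (\<Sum>k<n. \<tau> (w k)) \<in> P (w n)))"

end

theory Submission
  imports Defs
begin

text \<open>
  Writing \<open>tau j\<close> for the image of the \<open>j\<close>-th unit vector in the plane along the limit direction
  \<open>u\<close>, the tiles are the sets \<open>Q 0 i\<close>. The functionals vanishing on \<open>u\<close> are mixed in sign at every level;
  bounded runs make the weights of the successive letters along such an orbit summable, which bounds
  the tiles, forces the desubstituted functionals to tend to \<open>0\<close> and makes \<open>u\<close> unique. Density of the
  projected words gives the covering of the plane by integer translates of the tiles, and Baire's
  theorem together with the self-similar subdivision gives that the tiles are closures of their interiors.

  The heart is that overlaps are null. Cut the tiles at a level \<open>m\<close> into pieces, one for each proper prefix of
  \<open>\<sigma>\<^bsub>[0,m)\<^esub>(j)\<close>. Two pieces that meet modulo the lattice differ at level \<open>m\<close> by an integer vector of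
  bounded size. An integer descent shows that after a bounded number of blocks containing all three
  letters such a difference is realised by an actual prefix, so the pieces ending in the common last
  letter cannot overlap any other piece. Hence the proportion of overlapping pieces drops by a fixed factor
  each time a given block of the directive sequence recurs, and the measure of the overlap is \<open>0\<close>.

  Outside the null set of overlaps, coding orbits by tiles inverts the map from words to points of the
  torus. Unique ergodicity of the rotation then carries over to the shift.
\<close>

section \<open>Mixed functionals\<close>

text \<open>The obstacle is that tiles are closures, so two pieces can meet without their words
  having anything visible in common. Meeting only says that the integer vector between their
  prefixes is small transversally to the limit direction. Comparing word lengths bounds the
  remaining coordinate, but only at levels where all words have comparable length. This dictates the
  order of the constants: one block containing all letters fixes the ratio \<rho> of lengths, \<rho>
  bounds the integer gaps, that bound fixes the number of further blocks which the descent uses, and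
  only then is a longer recurring stretch chosen that contains all of this. The descent ends because
  its bound is an integer. Proportions of overlapping pieces control area because, at a level with
  comparable lengths, a point of the torus lies in a bounded number of pieces; so the total area of
  all pieces stays bounded while the bad proportion decays.\<close>

definition act :: "letter \<Rightarrow> (letter \<Rightarrow> 'a::ab_group_add) \<Rightarrow> letter \<Rightarrow> 'a" where
  "act a x = x(a := x 1 + x 2 + x 3)"

text \<open>\<open>act s\<close> is the incidence matrix of \<open>AR s\<close> on columns and
  \<open>coact s\<close> its transpose, on functionals. Both are polymorphic because they serve for
  integer vectors, real functionals and \<open>real^2\<close>-valued functionals alike.\<close>

definition coact :: "letter \<Rightarrow> (letter \<Rightarrow> 'a::ab_group_add) \<Rightarrow> letter \<Rightarrow> 'a" where
  "coact a c = (\<lambda>j. if j = a then c a else c j + c a)"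

definition spread :: "(letter \<Rightarrow> real) \<Rightarrow> real" where
  "spread c = Max (range c) - Min (range c)"

text \<open>Conditions of this shape recur throughout: one letter \<open>s\<close> is singled out
  and the other two are interchangeable, so case analyses use an arbitrary enumeration instead of 1,
  2, 3.\<close>

lemma letters_of_distinct:
  fixes a b s :: letter
  assumes "a \<noteq> b" "a \<noteq> s" "b \<noteq> s"
  shows "UNIV = {s, a, b}"
proof -
  have "card {s, a, b} = CARD(3)" using assms by simp
  then show ?thesis by (metis card_subset_eq finite_class.finite_UNIV subset_UNIV)
qed

lemma letter_cases:
  fixes a b s i :: letter
  assumes "a \<noteq> b" "a \<noteq> s" "b \<noteq> s"
  shows "i = s \<or> i = a \<or> i = b"
  using letters_of_distinct[OF assms] by blast

lemma other_letters:
  fixes s :: letter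
  obtains a b where "a \<noteq> b" "a \<noteq> s" "b \<noteq> s"
proof -
  have "(1::letter) \<noteq> 2" "(1::letter) \<noteq> 3" "(2::letter) \<noteq> 3" by simp_all
  then show ?thesis using that exhaust_3[of s] by metis
qed

lemma other_letter:
  fixes s a :: letter
  assumes "a \<noteq> s"
  obtains b where "a \<noteq> b" "b \<noteq> s"
  using other_letters[of s] assms by metis

lemma sum_letters:
  fixes a b s :: letter
  assumes "a \<noteq> b" "a \<noteq> s" "b \<noteq> s"
  shows "x 1 + x 2 + x 3 = (x s + x a + x b :: 'a::ab_group_add)"
proof -
  have "(\<Sum>i\<in>UNIV. x i) = (\<Sum>i\<in>{s,a,b}. x i)" using letters_of_distinct[OF assms] by simp
  also have "\<dots> = x s + x a + x b" using assms by (auto simp: add.assoc)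
  finally show ?thesis by (simp add: sum_3)
qed

lemma spread_eq:
  assumes "a \<noteq> b" "a \<noteq> s" "b \<noteq> s"
  shows "spread c = max (c s) (max (c a) (c b)) - min (c s) (min (c a) (c b))"
proof -
  have "range c = {c s, c a, c b}" using letters_of_distinct[OF assms] by auto
  then show ?thesis by (simp add: spread_def)
qed

lemma spread_uminus: "spread (\<lambda>i. - c i) = spread c"
proof -
  obtain a b where "a \<noteq> b" "a \<noteq> (1::letter)" "b \<noteq> 1" using other_letters by blast
  then show ?thesis by (auto simp: spread_eq)
qed

lemma abs_le_spread:
  assumes "\<exists>i. 0 \<le> c i" "\<exists>i. c i \<le> 0"
  shows "\<bar>c j\<bar> \<le> spread c"
proof -
  obtain a b where ab: "a \<noteq> b" "a \<noteq> j" "b \<noteq> j" using other_letters by blast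
  then show ?thesis using assms letter_cases[OF ab] unfolding spread_eq[OF ab]
    by (smt (verit, best))
qed

text \<open>Up to a common shift by \<open>c s\<close>, the new values are 0 and the two old values
  at the other letters, and 0 lies between the old minimum and maximum.\<close>

lemma spread_coact_le:
  assumes "\<exists>i. 0 \<le> c i" "\<exists>i. c i \<le> 0"
  shows "spread (coact s c) \<le> spread c"
proof -
  obtain a b where ab: "a \<noteq> b" "a \<noteq> s" "b \<noteq> s" using other_letters by blast
  have "c s \<ge> 0 \<or> c a \<ge> 0 \<or> c b \<ge> 0" "c s \<le> 0 \<or> c a \<le> 0 \<or> c b \<le> 0"
    using assms letter_cases[OF ab] by metis+
  then show ?thesis using ab unfolding spread_eq[OF ab] coact_def by auto
qed

text \<open>In the same picture the solo value, an end of the old interval, is replaced by 0, so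
  exactly its modulus is cut off.\<close>

lemma spread_coact_solo:
  assumes "c s \<le> 0" "\<And>i. i \<noteq> s \<Longrightarrow> 0 \<le> c i"
  shows "spread (coact s c) = spread c - \<bar>c s\<bar>"
proof -
  obtain a b where ab: "a \<noteq> b" "a \<noteq> s" "b \<noteq> s" using other_letters by blast
  then have "0 \<le> c a" "0 \<le> c b" using assms by auto
  then show ?thesis using ab assms(1) unfolding spread_eq[OF ab] coact_def by auto
qed

text \<open>
  Call a letter solo if its value has the opposite sign to the other two. Until the solo letter is used it
  stays solo, and the weights spent in that phase are dominated by the drop of the spread when it is used,
  since by then one of the other two values is at most \<open>h + 1\<close> times the solo value.
\<close>

locale mixed_dual_orbit =
  fixes a :: "nat \<Rightarrow> letter" and c :: "nat \<Rightarrow> letter \<Rightarrow> real" and h :: nat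
  assumes dual_step: "\<And>n. c (Suc n) = coact (a n) (c n)"
    and pos: "\<And>n. \<exists>i. 0 < c n i"
    and neg: "\<And>n. \<exists>i. c n i < 0"
    and rec: "\<And>n i. \<exists>m\<ge>n. a m = i"
    and runs: "\<And>n. \<exists>j\<le>h. a (n + j) \<noteq> a n"
begin

lemma uminus: "mixed_dual_orbit a (\<lambda>n i. - c n i) h"
proof
  show "(\<lambda>i. - c (Suc n) i) = coact (a n) (\<lambda>i. - c n i)" for n
    by (auto simp: dual_step coact_def)
qed (use pos neg rec runs in auto)

lemma weakly_mixed: "\<exists>i. 0 \<le> c n i" "\<exists>i. c n i \<le> 0"
  using pos[of n] neg[of n] less_imp_le by blast+

lemma spread_antimono: "m \<le> n \<Longrightarrow> spread (c n) \<le> spread (c m)"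
proof (induction n rule: dec_induct)
  case (step n)
  then show ?case using spread_coact_le[OF weakly_mixed[of n]] dual_step[of n] order_trans by metis
qed simp

lemma run_of_solo_letter:
  assumes "\<forall>i<j. a (k + i) = s"
  shows "c (k + j) s = c k s \<and> (\<forall>i. i \<noteq> s \<longrightarrow> c (k + j) i = c k i + j * c k s)"
  using assms by (induction j) (auto simp: dual_step coact_def algebra_simps)

text \<open>Otherwise both other values survive the at most \<open>h\<close> uses of
  \<open>s\<close> with more than \<open>|c k s|\<close> left. The next letter is one of these two,
  and adding its value makes all three entries positive, against \<open>neg\<close>.\<close>

lemma solo_letter_bound:
  assumes "a k = s" "c k s < 0" "p \<noteq> q" "p \<noteq> s" "q \<noteq> s"
  shows "c k p \<le> (h + 1) * \<bar>c k s\<bar> \<or> c k q \<le> (h + 1) * \<bar>c k s\<bar>"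
proof (rule ccontr)
  assume big: "\<not> ?thesis"
  define J where "J = (LEAST j. a (k + j) \<noteq> s)"
  obtain j where j: "j \<le> h" "a (k + j) \<noteq> s" using runs[of k] assms(1) by auto
  have J: "a (k + J) \<noteq> s" "J \<le> h"
    using j LeastI[of "\<lambda>j. a (k + j) \<noteq> s" j] Least_le[of "\<lambda>j. a (k + j) \<noteq> s" j]
    unfolding J_def by auto
  have run: "\<forall>i<J. a (k + i) = s" using not_less_Least unfolding J_def by blast
  note cJ = run_of_solo_letter[OF run]
  have hJ: "real h * c k s \<le> real J * c k s" using J assms(2) by (intro mult_right_mono_neg) auto
  have abs: "real (h + 1) * \<bar>c k s\<bar> = - (real h * c k s) - c k s"
    using assms(2) by (simp add: algebra_simps)
  have gt: "c (k + J) p > \<bar>c k s\<bar>" "c (k + J) q > \<bar>c k s\<bar>"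
    using cJ[THEN conjunct2, rule_format, of p] cJ[THEN conjunct2, rule_format, of q]
      big abs hJ assms by linarith+
  define l where "l = a (k + J)"
  have l: "l \<noteq> s" using J(1) by (simp add: l_def)
  have gl: "c (k + J) l > \<bar>c k s\<bar>"
    using letter_cases[OF assms(3-5), of l] l gt by metis
  have "c (Suc (k + J)) i > 0" for i
  proof (cases "i = s")
    case True
    then show ?thesis using gl l cJ[THEN conjunct1] by (simp add: dual_step coact_def flip: l_def)
  next
    case False
    then have "c (k + J) i > \<bar>c k s\<bar>"
      using letter_cases[OF assms(3-5), of i] gt by metis
    then show ?thesis using gl by (auto simp: dual_step coact_def simp flip: l_def)
  qed
  then show False using neg[of "Suc (k + J)"] by (metis less_asym)
qed

lemma phase_neg:
  assumes solo: "c k0 s < 0" "\<And>i. i \<noteq> s \<Longrightarrow> 0 \<le> c k0 i"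
  shows "\<exists>k1\<ge>k0. (\<Sum>k=k0..k1. \<bar>c k (a k)\<bar>)
            \<le> ((h + 1) * (h + 2) + 1) * (spread (c k0) - spread (c (Suc k1)))"
proof -
  define k1 where "k1 = (LEAST k. k0 \<le> k \<and> a k = s)"
  have k1: "k0 \<le> k1" "a k1 = s"
    using LeastI_ex[of "\<lambda>k. k0 \<le> k \<and> a k = s"] rec[of k0 s] unfolding k1_def by auto
  have not_s: "a k \<noteq> s" if "k0 \<le> k" "k < k1" for k
    using not_less_Least[of k "\<lambda>k. k0 \<le> k \<and> a k = s"] that unfolding k1_def by auto
  \<comment> \<open>Before \<open>k1\<close> only nonnegative values are added, so the other letters
    keep their sign, and mixedness keeps \<open>s\<close> negative.\<close>
  have inv: "c k s < 0 \<and> (\<forall>i. i \<noteq> s \<longrightarrow> 0 \<le> c k i)" if "k0 \<le> k" "k \<le> k1" for k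
    using that
  proof (induction k rule: dec_induct)
    case base
    then show ?case using solo by auto
  next
    case (step k)
    then have IH: "c k s < 0" "\<And>i. i \<noteq> s \<Longrightarrow> 0 \<le> c k i" and ns: "a k \<noteq> s"
      using not_s by auto
    have ge: "0 \<le> c (Suc k) i" if "i \<noteq> s" for i
      using IH ns that by (auto simp: dual_step coact_def)
    then have "c (Suc k) s < 0" using neg[of "Suc k"] by (metis not_le)
    then show ?case using ge by auto
  qed
  \<comment> \<open>\<open>G\<close> collects the weights of the phase. In \<open>I\<close>,
    \<open>b\<close> is the letter used last, \<open>d\<close> the remaining non-solo letter, and
    the last \<open>r\<close> uses were all of \<open>b\<close>. A use of \<open>b\<close> adds
    \<open>c b\<close> both to \<open>G\<close> and to \<open>c d\<close>; when the two letters
    exchange roles, \<open>G\<close> is at most three times the new smaller value, whence the factor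
    \<open>2 + r\<close>.\<close>
  define G where "G k = (\<Sum>i=k0..<k. \<bar>c i (a i)\<bar>)" for k
  define I where "I k \<longleftrightarrow> (\<exists>b d (r::nat). b \<noteq> d \<and> b \<noteq> s \<and> d \<noteq> s \<and> a (k - 1) = b \<and> r \<le> k
      \<and> (\<forall>i. k - r \<le> i \<and> i < k \<longrightarrow> a i = b) \<and> 1 \<le> r
      \<and> G k \<le> c k b + c k d \<and> c k b \<le> c k d \<and> G k \<le> (2 + real r) * c k b)" for k
  have I_I: "I k" if "b \<noteq> d" "b \<noteq> s" "d \<noteq> s" "a (k - 1) = b" "r \<le> k"
      "\<forall>i. k - r \<le> i \<and> i < k \<longrightarrow> a i = b" "1 \<le> r"
      "G k \<le> c k b + c k d" "c k b \<le> c k d" "G k \<le> (2 + real r) * c k b" for k b d and r :: nat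
    unfolding I_def by (rule exI[of _ b], rule exI[of _ d], rule exI[of _ r], intro conjI that)
  have inv2: "k = k0 \<or> I k"
    if "k0 \<le> k" "k \<le> k1" for k
    using that
  proof (induction k rule: dec_induct)
    case base
    then show ?case by simp
  next
    case (step k)
    then have ns: "a k \<noteq> s" and I: "0 \<le> c k (a k)" using not_s inv[of k] by auto
    have Gs: "G (Suc k) = G k + c k (a k)" using step I by (simp add: G_def)
    obtain d where d: "a k \<noteq> d" "d \<noteq> s" using other_letter[OF ns] by blast
    have Id: "0 \<le> c k d" using inv[of k] step d by auto
    have cs: "c (Suc k) (a k) = c k (a k)" "c (Suc k) d = c k d + c k (a k)"
      using d by (auto simp: dual_step coact_def)
    have "k = k0 \<or> I k" using step.IH step.prems by simp
    then consider "k = k0" | "I k" by blast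
    then show ?case
    proof cases
      case 1
      then have "G k = 0" by (simp add: G_def)
      then have f: "G (Suc k) \<le> c (Suc k) (a k) + c (Suc k) d" "c (Suc k) (a k) \<le> c (Suc k) d"
         "G (Suc k) \<le> (2 + real 1) * c (Suc k) (a k)"
        using Gs cs I Id by simp_all
      have g: "\<forall>i. Suc k - 1 \<le> i \<and> i < Suc k \<longrightarrow> a i = a k" by (auto simp: less_Suc_eq)
      show ?thesis
          by (intro disjI2 I_I[OF d(1) ns d(2) _ _ g _ f]) simp_all
    next
      case 2
      from 2[unfolded I_def] show ?thesis
      proof (elim exE conjE)
      fix b d' and r :: nat assume 2: "b \<noteq> d'" "b \<noteq> s" "d' \<noteq> s" "a (k - 1) = b" "r \<le> k"
       "\<forall>i. k - r \<le> i \<and> i < k \<longrightarrow> a i = b" "1 \<le> r"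
       "G k \<le> c k b + c k d'" "c k b \<le> c k d'" "G k \<le> (2 + real r) * c k b"
      show ?thesis
      proof (cases "a k = b")
        case True
        then have dd: "d = d'" using letter_cases[OF 2(1-3), of d] d by metis
        have f: "G (Suc k) \<le> c (Suc k) (a k) + c (Suc k) d" "c (Suc k) (a k) \<le> c (Suc k) d"
         "G (Suc k) \<le> (2 + real (Suc r)) * c (Suc k) (a k)"
          using Gs cs I Id 2(7-10) dd True by (simp_all add: algebra_simps)
        have g: "\<forall>i. Suc k - Suc r \<le> i \<and> i < Suc k \<longrightarrow> a i = a k"
          using 2(6) True by (auto simp: less_Suc_eq)
        show ?thesis using 2(5)
          by (intro disjI2 I_I[OF d(1) ns d(2) _ _ g _ f]) simp_all
      next
        case False
        then have e: "a k = d'" using letter_cases[OF 2(1-3), of "a k"] ns by metis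
        then have dd: "d = b" using letter_cases[OF 2(1-3), of d] d by metis
        have f: "G (Suc k) \<le> c (Suc k) (a k) + c (Suc k) d" "c (Suc k) (a k) \<le> c (Suc k) d"
         "G (Suc k) \<le> (2 + real 1) * c (Suc k) (a k)"
          using Gs cs I Id 2(7-10) dd e by (simp_all add: algebra_simps)
        have g: "\<forall>i. Suc k - 1 \<le> i \<and> i < Suc k \<longrightarrow> a i = a k" by (auto simp: less_Suc_eq)
        show ?thesis
          by (intro disjI2 I_I[OF d(1) ns d(2) _ _ g _ f]) simp_all
      qed
      qed
    qed
  qed
  define S where "S = \<bar>c k1 s\<bar>"
  have neg1: "c k1 s < 0" and nonneg1: "\<And>i. i \<noteq> s \<Longrightarrow> 0 \<le> c k1 i" using inv[of k1] k1 by auto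
  have "G k1 \<le> real ((h + 1) * (h + 2)) * S"
    using inv2[of k1, OF k1(1) order_refl] unfolding I_def
  proof (elim disjE exE conjE)
    assume "k1 = k0"
    then show ?thesis by (simp add: G_def S_def)
  next
    fix b d and r :: nat
    assume A: "b \<noteq> d" "b \<noteq> s" "d \<noteq> s" "a (k1 - 1) = b" "r \<le> k1"
       "\<forall>i. k1 - r \<le> i \<and> i < k1 \<longrightarrow> a i = b" "1 \<le> r"
       "G k1 \<le> c k1 b + c k1 d" "c k1 b \<le> c k1 d" "G k1 \<le> (2 + real r) * c k1 b"
    have "r \<le> h"
    proof -
      obtain j where j: "j \<le> h" "a (k1 - r + j) \<noteq> a (k1 - r)" using runs by blast
      have "\<not> j < r"
      proof
        assume "j < r"
        then have "k1 - r \<le> k1 - r + j \<and> k1 - r + j < k1" "k1 - r \<le> k1 - r \<and> k1 - r < k1"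
          using A(5,7) by linarith+
        then have "a (k1 - r + j) = b" "a (k1 - r) = b" using A(6) by blast+
        then show False using j by simp
      qed
      then show ?thesis using j by simp
    qed
    have b0: "0 \<le> c k1 b" using nonneg1 A by auto
    \<comment> \<open>\<open>b\<close> carries the smaller of the two values, so either alternative
      of \<open>solo_letter_bound\<close> bounds it.\<close>
    have "c k1 b \<le> (h + 1) * S"
      using solo_letter_bound[OF k1(2) neg1 A(1-3)] A(9) by (auto simp: S_def)
    moreover have "G k1 \<le> (h + 2) * c k1 b"
    proof -
      have "(2 + real r) * c k1 b \<le> (h + 2) * c k1 b"
        using b0 \<open>r \<le> h\<close> by (intro mult_right_mono) auto
      then show ?thesis using A(10) by linarith
    qed
    moreover have "(h + 2) * c k1 b \<le> (h + 2) * ((h + 1) * S)"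
      using calculation(1) by (intro mult_left_mono) auto
    ultimately show ?thesis by (simp add: algebra_simps)
  qed
  moreover have "(\<Sum>k=k0..k1. \<bar>c k (a k)\<bar>) = G k1 + S"
    using k1 by (simp add: G_def S_def sum.last_plus add.commute)
  moreover have "S \<le> spread (c k0) - spread (c (Suc k1))"
    using spread_coact_solo[of "c k1" s] neg1 nonneg1 spread_antimono[OF k1(1)] k1(2)
    by (auto simp: dual_step S_def)
  ultimately have "(\<Sum>k=k0..k1. \<bar>c k (a k)\<bar>) \<le> real ((h + 1) * (h + 2) + 1) * S"
    by (simp add: algebra_simps)
  also have "\<dots> \<le> real ((h + 1) * (h + 2) + 1) * (spread (c k0) - spread (c (Suc k1)))"
    using \<open>S \<le> _\<close> by (intro mult_left_mono) auto
  finally show ?thesis using k1(1) by auto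
qed

text \<open>Two of the three values share a weak sign, so the third letter is solo; if its value is
  positive, the orbit is negated.\<close>

lemma phase:
  "\<exists>k1\<ge>k0. (\<Sum>k=k0..k1. \<bar>c k (a k)\<bar>)
            \<le> ((h + 1) * (h + 2) + 1) * (spread (c k0) - spread (c (Suc k1)))"
proof -
  obtain i j where ij: "0 < c k0 i" "c k0 j < 0" using pos neg by blast
  then have ne: "i \<noteq> j" by auto
  then obtain l where l: "i \<noteq> l" "l \<noteq> j" using other_letter by blast
  show ?thesis
  proof (cases "0 \<le> c k0 l")
    case True
    then have "0 \<le> c k0 m" if "m \<noteq> j" for m
      using letter_cases[OF l(1) ne l(2), of m] ij that by auto
    then show ?thesis using phase_neg[of k0 j] ij by blast
  next
    case False
    interpret m: mixed_dual_orbit a "\<lambda>n i. - c n i" h by (rule uminus)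
    have "0 \<le> - c k0 m" if "m \<noteq> i" for m
      using letter_cases[OF l(1) ne l(2), of m] ij that False by auto
    then show ?thesis using m.phase_neg[of k0 i] ij by (simp add: spread_uminus)
  qed
qed

text \<open>Consecutive phases telescope in the spread. The last phase may reach beyond
  \<open>n\<close>, which only adds nonnegative terms.\<close>

lemma sum_letter_weights_le:
  "(\<Sum>k=k0..<n. \<bar>c k (a k)\<bar>) \<le> ((h + 1) * (h + 2) + 1) * spread (c k0)"
proof (induction "n - k0" arbitrary: k0 rule: less_induct)
  case less
  define K where "K = real ((h + 1) * (h + 2) + 1)"
  have nn: "0 \<le> spread (c k)" for k
    using abs_le_spread[OF weakly_mixed[of k], of 1] by linarith
  obtain k1 where k1: "k0 \<le> k1"
    "(\<Sum>k=k0..k1. \<bar>c k (a k)\<bar>) \<le> K * (spread (c k0) - spread (c (Suc k1)))"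
    using phase[of k0] K_def by auto
  have K: "0 \<le> K" by (simp add: K_def)
  show ?case
  proof (cases "n \<le> Suc k1")
    case True
    have "(\<Sum>k=k0..<n. \<bar>c k (a k)\<bar>) \<le> (\<Sum>k=k0..k1. \<bar>c k (a k)\<bar>)"
      using True by (intro sum_mono2) auto
    also have "\<dots> \<le> K * spread (c k0)"
      using k1(2) mult_left_mono[OF nn[of "Suc k1"] K] by (simp add: algebra_simps)
    finally show ?thesis by (simp add: K_def)
  next
    case False
    then have "n - Suc k1 < n - k0" using k1 by auto
    from less[OF this] have "(\<Sum>k=Suc k1..<n. \<bar>c k (a k)\<bar>) \<le> K * spread (c (Suc k1))"
      by (simp add: K_def)
    moreover have "(\<Sum>k=k0..<n. \<bar>c k (a k)\<bar>)
       = (\<Sum>k=k0..<Suc k1. \<bar>c k (a k)\<bar>) + (\<Sum>k=Suc k1..<n. \<bar>c k (a k)\<bar>)"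
      using k1 False by (intro sum.atLeastLessThan_concat[symmetric]) auto
    moreover have "{k0..<Suc k1} = {k0..k1}" by auto
    ultimately have "(\<Sum>k=k0..<n. \<bar>c k (a k)\<bar>) \<le> K * spread (c k0)"
      using k1(2) by (simp add: algebra_simps)
    then show ?thesis by (simp add: K_def)
  qed
qed

text \<open>Each entry moves by at most the weight of the step, so summability gives a limit; at the
  times when \<open>j\<close> is used the entry is itself the weight, so the limit is 0.\<close>

lemma tendsto_zero: "(\<lambda>n. c n j) \<longlonglongrightarrow> 0"
proof -
  have "(\<Sum>k\<le>n. \<bar>c k (a k)\<bar>) \<le> ((h + 1) * (h + 2) + 1) * spread (c 0)" for n
    using sum_letter_weights_le[of 0 "Suc n"]
    by (simp only: atLeast0LessThan lessThan_Suc_atMost)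
  then have summ: "summable (\<lambda>k. \<bar>c k (a k)\<bar>)"
    by (intro bounded_imp_summable) auto
  have "summable (\<lambda>k. c (Suc k) j - c k j)"
    by (rule summable_comparison_test'[OF summ, of 0]) (auto simp: dual_step coact_def)
  then have "convergent (\<lambda>n. \<Sum>k<n. c (Suc k) j - c k j)"
    by (simp only: summable_iff_convergent)
  then have "convergent (\<lambda>n. c n j - c 0 j)"
    by (simp only: sum_lessThan_telescope[of "\<lambda>n. c n j"])
  then have "convergent (\<lambda>n. (c n j - c 0 j) + c 0 j)"
    by (rule convergent_add[OF _ convergent_const])
  then have "convergent (\<lambda>n. c n j)" by simp
  then obtain l where l: "(\<lambda>n. c n j) \<longlonglongrightarrow> l" by (auto simp: convergent_def)
  have z: "(\<lambda>k. c k (a k)) \<longlonglongrightarrow> 0"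
    using summable_LIMSEQ_zero[OF summ] tendsto_rabs_zero_iff by blast
  have inf: "infinite {n. a n = j}" unfolding infinite_nat_iff_unbounded_le using rec by auto
  define r where "r = enumerate {n. a n = j}"
  have sm: "strict_mono r" "\<And>k. a (r k) = j"
    using strict_mono_enumerate[OF inf] enumerate_in_set[OF inf] by (auto simp: r_def)
  have "(\<lambda>k. c (r k) j) \<longlonglongrightarrow> 0"
    using LIMSEQ_subseq_LIMSEQ[OF z sm(1)] by (simp add: o_def sm(2))
  moreover have "(\<lambda>k. c (r k) j) \<longlonglongrightarrow> l"
    using LIMSEQ_subseq_LIMSEQ[OF l sm(1)] by (simp add: o_def)
  ultimately show ?thesis using l LIMSEQ_unique by blast
qed

end

section \<open>Integer vectors between prefixes\<close>

text \<open>The product of the first \<open>n\<close> incidence matrices applied to a column, the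
  factor of the last letter acting first. \<open>Coact\<close> multiplies the same product by a row
  from the left.\<close>

primrec Act :: "(nat \<Rightarrow> letter) \<Rightarrow> nat \<Rightarrow> (letter \<Rightarrow> 'a::ab_group_add) \<Rightarrow> letter \<Rightarrow> 'a" where
  "Act a 0 x = x"
| "Act a (Suc n) x = Act a n (act (a n) x)"

primrec Coact :: "(nat \<Rightarrow> letter) \<Rightarrow> nat \<Rightarrow> (letter \<Rightarrow> 'a::ab_group_add) \<Rightarrow> letter \<Rightarrow> 'a" where
  "Coact a 0 c = c"
| "Coact a (Suc n) c = coact (a n) (Coact a n c)"

definition sh :: "nat \<Rightarrow> (nat \<Rightarrow> letter) \<Rightarrow> nat \<Rightarrow> letter" where
  "sh m a = (\<lambda>i. a (m + i))"

abbreviation wd :: "(nat \<Rightarrow> letter) \<Rightarrow> nat \<Rightarrow> word \<Rightarrow> word" where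
  "wd a \<equiv> subst_prod (\<lambda>i. AR (a i))"

definition cnt :: "word \<Rightarrow> letter \<Rightarrow> int" where
  "cnt w j = int (count_list w j)"

definition dot :: "(letter \<Rightarrow> 'a::comm_ring) \<Rightarrow> (letter \<Rightarrow> 'a) \<Rightarrow> 'a" where
  "dot c x = c 1 * x 1 + c 2 * x 2 + c 3 * x 3"

definition unitv :: "letter \<Rightarrow> letter \<Rightarrow> int" where
  "unitv j = (\<lambda>i. if i = j then 1 else 0)"

lemma dot_eq:
  assumes "a \<noteq> b" "a \<noteq> s" "b \<noteq> s"
  shows "dot c x = c s * x s + c a * x a + c b * x b"
  unfolding dot_def using sum_letters[OF assms, of "\<lambda>i. c i * x i"] .

lemma act_eq:
  assumes "a \<noteq> b" "a \<noteq> s" "b \<noteq> s"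
  shows "act s x s = x s + x a + x b" "act s x a = x a" "act s x b = x b"
  unfolding act_def using sum_letters[OF assms, of x] assms by auto

lemma coact_simps [simp]: "coact s c s = c s" "i \<noteq> s \<Longrightarrow> coact s c i = c i + c s"
  by (auto simp: coact_def)

lemma dot_act: "dot c (act s x) = dot (coact s c) x"
proof -
  obtain p q where "p \<noteq> q" "p \<noteq> s" "q \<noteq> s" using other_letters by blast
  then show ?thesis by (simp add: dot_eq act_eq algebra_simps)
qed

lemma dot_Act: "dot c (Act a n x) = dot (Coact a n c) x"
  by (induction n arbitrary: x) (simp_all add: dot_act)

lemma act_diff: "act s (\<lambda>i. x i - y i) = (\<lambda>i. act s x i - act s y i)"
  by (auto simp: act_def)

lemma act_add: "act s (\<lambda>i. x i + y i) = (\<lambda>i. act s x i + act s y i)"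
  by (auto simp: act_def)

lemma Act_diff: "Act a n (\<lambda>i. x i - y i) = (\<lambda>i. Act a n x i - Act a n y i)"
  by (induction n arbitrary: x y) (simp_all add: act_diff)

lemma Act_sum: "Act a n (\<lambda>i. x i + y i) = (\<lambda>i. Act a n x i + Act a n y i)"
  by (induction n arbitrary: x y) (simp_all add: act_add)

lemma act_zero [simp]: "act s (\<lambda>i. 0) = (\<lambda>i. 0)"
  by (auto simp: act_def)

lemma Act_zero [simp]: "Act a n (\<lambda>i. 0) = (\<lambda>i. 0)"
  by (induction n) simp_all

lemma act_surj: "\<exists>x. act s x = y"
proof -
  obtain p q where pq: "p \<noteq> q" "p \<noteq> s" "q \<noteq> s" using other_letters by blast
  have "act s (y(s := y s - y p - y q)) i = y i" for i
    using letter_cases[OF pq, of i] act_eq[OF pq, of "y(s := y s - y p - y q)"] pq by auto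
  then show ?thesis by blast
qed

lemma Act_surj: "\<exists>x. Act a n x = y"
  by (induction n arbitrary: y) (simp, metis Act.simps(2) act_surj)

lemma coact_surj: "\<exists>x. coact s x = c"
  by (rule exI[of _ "\<lambda>j. if j = s then c s else c j - c s"]) (auto simp: coact_def)

lemma Coact_surj: "\<exists>x. Coact a n x = c"
  by (induction n arbitrary: c) (simp, metis Coact.simps(2) coact_surj)

lemma sh_0 [simp]: "sh 0 a = a" by (simp add: sh_def)

lemma sh_sh: "sh m (sh n a) = sh (n + m) a" by (simp add: sh_def add.assoc)

lemma sh_apply: "sh m a i = a (m + i)" by (simp add: sh_def)

lemma Act_add: "Act a (m + n) x = Act a m (Act (sh m a) n x)"
  by (induction n arbitrary: x) (simp_all add: sh_apply)

lemma Coact_add: "Coact a (m + n) x = Coact (sh m a) n (Coact a m x)"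
  by (induction n arbitrary: x) (simp_all add: sh_apply)

lemma wd_append [simp]: "wd a n (v @ w) = wd a n v @ wd a n w"
  by (induction n arbitrary: v w) (simp_all add: subst_word_def)

lemma wd_Nil [simp]: "wd a n [] = []"
  by (induction n) (simp_all add: subst_word_def)

lemma wd_add: "wd a (m + n) w = wd a m (wd (sh m a) n w)"
  by (induction n arbitrary: w) (simp_all add: sh_apply)

lemma wd_Cons: "wd a n (j # w) = wd a n [j] @ wd a n w"
  by (metis append_Cons append_Nil wd_append)

text \<open>The recursion on which everything rests: one level up, the word over \<open>j\<close> is
  extended on the right by the word over \<open>a n\<close>. Hence the words over one letter are
  nested prefixes, and every word of level \<open>n + 1\<close> ends in the word of level
  \<open>n\<close> over \<open>a n\<close>.\<close>

lemma wd_Suc_letter: "wd a (Suc n) [j] = wd a n [j] @ (if j = a n then [] else wd a n [a n])"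
  using wd_append[of a n "[j]" "[a n]"] by (auto simp: subst_word_def AR_def)

lemma wd_Suc_last: "\<exists>p. wd a (Suc n) [j] = p @ wd a n [a n]"
  by (cases "j = a n") (auto simp: wd_Suc_letter simp del: subst_prod.simps(2))

lemma wd_cong: "(\<And>i. i < n \<Longrightarrow> a i = b i) \<Longrightarrow> wd a n w = wd b n w"
  by (induction n arbitrary: w) simp_all

lemma wd_letter_hd: "\<exists>t. wd a n [j] = j # t"
proof (induction n)
  case (Suc n)
  then show ?case unfolding wd_Suc_letter by auto
qed simp

lemma wd_nonempty: "w \<noteq> [] \<Longrightarrow> wd a n w \<noteq> []"
proof -
  assume "w \<noteq> []"
  then obtain j v where "w = [j] @ v" by (metis append_Cons append_Nil neq_Nil_conv)
  then have "wd a n w = wd a n [j] @ wd a n v" by (metis wd_append)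
  then show ?thesis using wd_letter_hd[of a n j] by auto
qed

lemma cnt_Nil [simp]: "cnt [] = (\<lambda>i. 0)" by (auto simp: cnt_def)

lemma cnt_append [simp]: "cnt (v @ w) = (\<lambda>i. cnt v i + cnt w i)"
  by (auto simp: cnt_def)

lemma cnt_letter [simp]: "cnt [j] = unitv j" by (auto simp: cnt_def unitv_def)

lemma act_unitv: "act s (unitv j) = (if j = s then unitv s else (\<lambda>i. unitv j i + unitv s i))"
proof -
  obtain p q where pq: "p \<noteq> q" "p \<noteq> s" "q \<noteq> s" using other_letters by blast
  have "act s (unitv j) i = (if j = s then unitv s else (\<lambda>i. unitv j i + unitv s i)) i" for i
    using letter_cases[OF pq, of i] letter_cases[OF pq, of j] act_eq[OF pq, of "unitv j"] pq
    by (auto simp: unitv_def)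
  then show ?thesis by blast
qed

lemma cnt_wd_letter: "cnt (wd a n [j]) = Act a n (unitv j)"
  by (induction n arbitrary: j) (auto simp: wd_Suc_letter act_unitv Act_sum simp del: subst_prod.simps(2))

lemma cnt_Cons: "cnt (j # w) = (\<lambda>i. unitv j i + cnt w i)"
  using cnt_append[of "[j]" w] by simp

lemma cnt_wd: "cnt (wd a n w) = Act a n (cnt w)"
proof (induction w)
  case (Cons j w)
  have "wd a n (j # w) = wd a n [j] @ wd a n w" by (metis append_Cons append_Nil wd_append)
  then show ?case using Cons by (simp add: cnt_wd_letter cnt_Cons Act_sum)
qed simp

lemma length_cnt: "int (length w) = dot (\<lambda>i. 1) (cnt w)"
proof (induction w)
  case (Cons j w)
  obtain p q where pq: "p \<noteq> q" "p \<noteq> j" "q \<noteq> j" using other_letters by blast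
  then show ?case using Cons by (simp add: cnt_Cons dot_eq[OF pq] unitv_def)
qed (simp add: dot_def)

lemma dot_unitv [simp]: "dot c (unitv j) = c j"
proof -
  obtain p q where pq: "p \<noteq> q" "p \<noteq> j" "q \<noteq> j" using other_letters by blast
  then show ?thesis by (simp add: dot_eq[OF pq] unitv_def)
qed

lemma dot_diff: "dot c (\<lambda>i. x i - y i) = dot c x - dot c y"
  by (simp add: dot_def algebra_simps)

lemma dot_add: "dot c (\<lambda>i. x i + y i) = dot c x + dot c y"
  by (simp add: dot_def algebra_simps)

lemma Coact_pos: "(\<And>i. 0 < c i) \<Longrightarrow> 0 < Coact a n (c :: letter \<Rightarrow> int) j"
  by (induction n arbitrary: j) (auto simp: coact_def add_pos_pos)

lemma length_wd: "int (length (wd a n [j])) = Coact a n (\<lambda>i. 1) j"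
  by (simp add: length_cnt cnt_wd_letter dot_Act)

text \<open>The word over \<open>j\<close> is viewed as a lattice path starting at 0, and
  \<open>x\<close> is a possible vertex of it. The coordinates \<open>x\<close> are those of level
  \<open>k\<close>, in which the unit vectors stand for whole words of that level.\<close>

definition passes :: "(nat \<Rightarrow> letter) \<Rightarrow> nat \<Rightarrow> (letter \<Rightarrow> int) \<Rightarrow> letter \<Rightarrow> bool" where
  "passes a k x j \<longleftrightarrow> (\<exists>P. prefix P (wd a k [j]) \<and> cnt P = Act a k x)"

text \<open>
  If \<open>x\<close> is not the abelianization of a prefix of the word over \<open>j\<close>, this persists one level down for
  a suitable pair \<open>(x', j')\<close> (lemma \<open>blocked_descent\<close>). Along this descent the differences
  \<open>x - e\<^sub>j\<close> stay mixed in sign, while their \<open>gap_bound\<close> drops in every two blocks that contain all letters.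
\<close>

definition gap_step :: "letter \<Rightarrow> (letter \<Rightarrow> int) \<Rightarrow> (letter \<Rightarrow> int) \<Rightarrow> bool" where
  "gap_step s z z' \<longleftrightarrow> (\<exists>\<epsilon>. (\<epsilon> = 0 \<or> \<epsilon> = 1) \<and> z' = (act s z)(s := act s z s + \<epsilon>))"

definition mixed :: "(letter \<Rightarrow> int) \<Rightarrow> bool" where
  "mixed z \<longleftrightarrow> (\<exists>i. 0 < z i) \<and> (\<exists>i. z i < 0)"

definition full :: "(nat \<Rightarrow> letter) \<Rightarrow> nat \<Rightarrow> nat \<Rightarrow> bool" where
  "full a k l \<longleftrightarrow> (\<forall>j. \<exists>i. k \<le> i \<and> i < l \<and> a i = j)"

text \<open>The trace that mixedness after a step at \<open>b\<close> leaves on the entries before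
  it: the other two must not both outweigh \<open>z b\<close> with the opposite sign. One inequality
  is strict and the other is not because \<epsilon> can only add.\<close>

definition balanced_at :: "letter \<Rightarrow> (letter \<Rightarrow> int) \<Rightarrow> bool" where
  "balanced_at b z \<longleftrightarrow> (\<forall>p q. p \<noteq> q \<longrightarrow> p \<noteq> b \<longrightarrow> q \<noteq> b \<longrightarrow>
     (z b < 0 \<longrightarrow> z p < - z b \<or> z q < - z b) \<and> (0 \<le> z b \<longrightarrow> - z p \<le> z b \<or> - z q \<le> z b))"

text \<open>In the enumeration 0, -1, 1, -2, 2, ... of the integers, starting with index 0, all
  entries have index at most \<open>N\<close>. The preference for negative values again matches
  \<epsilon>.\<close>

definition gap_bound :: "int \<Rightarrow> (letter \<Rightarrow> int) \<Rightarrow> bool" where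
  "gap_bound N z \<longleftrightarrow> (\<forall>i. 2 * z i \<le> N \<and> - 2 * z i - 1 \<le> N)"

section \<open>Single steps of the gap recursion\<close>

lemma gap_stepE:
  assumes "gap_step s z z'" "p \<noteq> q" "p \<noteq> s" "q \<noteq> s"
  obtains \<epsilon> where "\<epsilon> = 0 \<or> \<epsilon> = 1" "z' s = z s + z p + z q + \<epsilon>" "z' p = z p" "z' q = z q"
proof -
  obtain \<epsilon> where e: "\<epsilon> = 0 \<or> \<epsilon> = 1" "z' = (act s z)(s := act s z s + \<epsilon>)"
    using assms(1) unfolding gap_step_def by blast
  have "z' s = z s + z p + z q + \<epsilon>" "z' p = z p" "z' q = z q"
    unfolding e(2) using assms(3,4) by (simp_all add: act_eq[OF assms(2-4)])
  then show ?thesis using e(1) that by blast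
qed

lemma all_letters:
  fixes p q s :: letter
  assumes "p \<noteq> q" "p \<noteq> s" "q \<noteq> s"
  shows "(\<forall>i. Q i) \<longleftrightarrow> Q s \<and> Q p \<and> Q q"
proof -
  have "(\<forall>i. Q i) \<longleftrightarrow> (\<forall>i\<in>UNIV. Q i)" by simp
  also have "\<dots> \<longleftrightarrow> (\<forall>i\<in>{s, p, q}. Q i)" by (simp only: letters_of_distinct[OF assms])
  finally show ?thesis by simp
qed

lemma ex_letters:
  fixes p q s :: letter
  assumes "p \<noteq> q" "p \<noteq> s" "q \<noteq> s"
  shows "(\<exists>i. Q i) \<longleftrightarrow> Q s \<or> Q p \<or> Q q"
  using all_letters[OF assms, of "\<lambda>i. \<not> Q i"] by blast

lemma mixed_eq:
  assumes "p \<noteq> q" "p \<noteq> s" "q \<noteq> s"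
  shows "mixed z \<longleftrightarrow> (0 < z s \<or> 0 < z p \<or> 0 < z q) \<and> (z s < 0 \<or> z p < 0 \<or> z q < 0)"
  unfolding mixed_def ex_letters[OF assms] ..

lemma balanced_at_eq:
  assumes pq: "p \<noteq> q" "p \<noteq> b" "q \<noteq> b"
  shows "balanced_at b z \<longleftrightarrow> (z b < 0 \<longrightarrow> z p < - z b \<or> z q < - z b) \<and>
           (0 \<le> z b \<longrightarrow> - z p \<le> z b \<or> - z q \<le> z b)"
  unfolding balanced_at_def all_letters[OF pq] using pq by auto

lemma gap_bound_eq:
  assumes pq: "p \<noteq> q" "p \<noteq> b" "q \<noteq> b"
  shows "gap_bound N z \<longleftrightarrow> 2 * z b \<le> N \<and> - 2 * z b - 1 \<le> N \<and> 2 * z p \<le> N \<and> - 2 * z p - 1 \<le> N \<and>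
     2 * z q \<le> N \<and> - 2 * z q - 1 \<le> N"
  unfolding gap_bound_def all_letters[OF pq] by auto

text \<open>If both other entries outweighed \<open>z b\<close>, the new entry at \<open>b\<close>
  would take their sign and nothing of the opposite sign would be left.\<close>

lemma balanced_at_used:
  assumes "gap_step b z z'" "mixed z'"
  shows "balanced_at b z"
proof -
  obtain p q where pq: "p \<noteq> q" "p \<noteq> b" "q \<noteq> b" using other_letters by blast
  obtain \<epsilon> where "\<epsilon> = 0 \<or> \<epsilon> = 1" "z' b = z b + z p + z q + \<epsilon>" "z' p = z p" "z' q = z q"
    by (rule gap_stepE[OF assms(1) pq])
  then show ?thesis using assms(2) unfolding balanced_at_eq[OF pq] mixed_eq[OF pq]
    by linarith
qed

text \<open>A violation before the step survives it: the entry at \<open>s\<close> changes by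
  \<open>z b + z q + \<epsilon>\<close>, which in case of a violation does not bring it closer to
  0.\<close>

lemma balanced_at_unused:
  assumes "gap_step s z z'" "balanced_at b z'" "s \<noteq> b"
  shows "balanced_at b z"
proof -
  obtain q where q: "s \<noteq> q" "q \<noteq> b" using other_letter[OF assms(3)] by blast
  obtain \<epsilon> where "\<epsilon> = 0 \<or> \<epsilon> = 1" "z' s = z s + z b + z q + \<epsilon>" "z' b = z b" "z' q = z q"
    by (rule gap_stepE[OF assms(1), of b q]) (use assms(3) q in auto)
  then show ?thesis using assms(2)
    unfolding balanced_at_eq[OF q(1) assms(3) q(2)]
    by linarith
qed

text \<open>Only the entry at \<open>s\<close> is new. Mixedness supplies an entry of the opposite
  sign, and balance there leaves two cases: either this entry already dominates the new one, or the
  step did not move the entry at \<open>s\<close> towards the bound in question.\<close>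

lemma gap_bound_step:
  assumes "gap_step s z z'" "mixed z" "mixed z'" "\<And>b. balanced_at b z'" "gap_bound N z"
  shows "gap_bound N z'"
proof -
  obtain p q where pq: "p \<noteq> q" "p \<noteq> s" "q \<noteq> s" using other_letters by blast
  then have qp: "q \<noteq> p" "s \<noteq> q" "s \<noteq> p" by auto
  obtain \<epsilon> where e: "\<epsilon> = 0 \<or> \<epsilon> = 1" "z' s = z s + z p + z q + \<epsilon>" "z' p = z p" "z' q = z q"
    by (rule gap_stepE[OF assms(1) pq])
  show ?thesis
    using assms(2,3,5) assms(4)[of p] assms(4)[of q] e
    unfolding gap_bound_eq[OF pq] mixed_eq[OF pq] balanced_at_eq[OF qp(2) qp(3) qp(1)]
      balanced_at_eq[OF qp(3) qp(2) pq(1)]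
    by (smt (verit))
qed

text \<open>In the same dichotomy the first case is strict and the second becomes an equality. So an
  extreme entry is never created, only inherited from the level above.\<close>

lemma extreme_step:
  assumes "gap_step s z z'" "mixed z" "mixed z'" "\<And>b. balanced_at b z'" "gap_bound N z"
    and "2 * z' i = N \<or> - 2 * z' i - 1 = N"
  shows "z i = z' i"
proof (cases "i = s")
  case False
  then show ?thesis using assms(1) unfolding gap_step_def by (auto simp: act_def)
next
  case True
  obtain p q where pq: "p \<noteq> q" "p \<noteq> s" "q \<noteq> s" using other_letters by blast
  then have qp: "q \<noteq> p" "s \<noteq> q" "s \<noteq> p" by auto
  obtain \<epsilon> where e: "\<epsilon> = 0 \<or> \<epsilon> = 1" "z' s = z s + z p + z q + \<epsilon>" "z' p = z p" "z' q = z q"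
    by (rule gap_stepE[OF assms(1) pq])
  show ?thesis
    using assms(2,3,5,6) assms(4)[of p] assms(4)[of q] e True
    unfolding gap_bound_eq[OF pq] mixed_eq[OF pq] balanced_at_eq[OF qp(2) qp(3) qp(1)]
      balanced_at_eq[OF qp(3) qp(2) pq(1)]
    by (smt (verit))
qed

text \<open>Keeping the entry at \<open>s\<close> means \<open>z p + z q = - \<epsilon>\<close>. If
  \<epsilon> were 0, the two would be opposite and nonzero, and balance at the negative one would
  push the positive one beyond the maximum.\<close>

lemma max_kept:
  assumes "gap_step s z z'" "mixed z'" "\<And>b. balanced_at b z'" "gap_bound N z"
    and "2 * z' s = N" "z s = z' s" and pq: "p \<noteq> q" "p \<noteq> s" "q \<noteq> s"
  shows "z' p + z' q = - 1"
proof -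
  from pq have qp: "q \<noteq> p" "s \<noteq> q" "s \<noteq> p" by auto
  obtain \<epsilon> where e: "\<epsilon> = 0 \<or> \<epsilon> = 1" "z' s = z s + z p + z q + \<epsilon>" "z' p = z p" "z' q = z q"
    by (rule gap_stepE[OF assms(1) pq])
  show ?thesis
    using assms(2,4,5,6) assms(3)[of p] assms(3)[of q] e
    unfolding gap_bound_eq[OF pq] mixed_eq[OF pq] balanced_at_eq[OF qp(2) qp(3) qp(1)]
      balanced_at_eq[OF qp(3) qp(2) pq(1)]
    by (smt (verit))
qed

text \<open>A use of \<open>q\<close>, the negative one of the two, would turn its entry into
  \<open>z m - 1 + \<epsilon>\<close>, which is nonnegative, and nothing negative would be left. A
  use of \<open>p\<close> reproduces the old value, by balance at \<open>q\<close> and the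
  bound.\<close>

lemma max_kept_step:
  assumes "gap_step s z z'" "mixed z" "mixed z'" "\<And>b. balanced_at b z'" "gap_bound N z"
    and "2 * z m = N" "z' m = z m" "z p + z q = - 1" "0 \<le> z p" and pq: "p \<noteq> q" "p \<noteq> m" "q \<noteq> m"
  shows "s \<noteq> q \<and> z' p + z' q = - 1 \<and> 0 \<le> z' p"
proof -
  from pq have qp: "q \<noteq> p" "m \<noteq> q" "m \<noteq> p" by auto
  consider "s = m" | "s = p" | "s = q" using letter_cases[OF pq] by blast
  then show ?thesis
  proof cases
    case 1
    show ?thesis by (rule gap_stepE[OF assms(1), of p q]) (use 1 pq assms(8,9) in auto)
  next
    case 2
    obtain \<epsilon> where e: "\<epsilon> = 0 \<or> \<epsilon> = 1" "z' p = z p + z m + z q + \<epsilon>" "z' m = z m" "z' q = z q"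
      by (rule gap_stepE[OF assms(1), of m q]) (use 2 pq in auto)
    then show ?thesis using 2 assms(2,3,5-9) assms(4)[of q] qp
      unfolding gap_bound_eq[OF pq] mixed_eq[OF pq] balanced_at_eq[OF qp(3) qp(2) pq(1)]
      by (smt (verit))
  next
    case 3
    obtain \<epsilon> where e: "\<epsilon> = 0 \<or> \<epsilon> = 1" "z' q = z q + z m + z p + \<epsilon>" "z' m = z m" "z' p = z p"
      by (rule gap_stepE[OF assms(1), of m p]) (use 3 pq in auto)
    then show ?thesis using 3 assms(2,3,5-9) qp
      unfolding gap_bound_eq[OF pq] mixed_eq[OF pq]
      by (smt (verit))
  qed
qed

text \<open>Mirror image of the maximal case: now \<epsilon> = 1 is excluded, by balance at the
  positive one of the two.\<close>

lemma min_kept: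
  assumes "gap_step s z z'" "mixed z'" "\<And>b. balanced_at b z'" "gap_bound N z"
    and "- 2 * z' s - 1 = N" "z s = z' s" and pq: "p \<noteq> q" "p \<noteq> s" "q \<noteq> s"
  shows "z' p + z' q = 0"
proof -
  from pq have qp: "q \<noteq> p" "s \<noteq> q" "s \<noteq> p" by auto
  obtain \<epsilon> where e: "\<epsilon> = 0 \<or> \<epsilon> = 1" "z' s = z s + z p + z q + \<epsilon>" "z' p = z p" "z' q = z q"
    by (rule gap_stepE[OF assms(1) pq])
  show ?thesis
    using assms(2,4,5,6) assms(3)[of p] assms(3)[of q] e
    unfolding gap_bound_eq[OF pq] mixed_eq[OF pq] balanced_at_eq[OF qp(2) qp(3) qp(1)]
      balanced_at_eq[OF qp(3) qp(2) pq(1)]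
    by (smt (verit))
qed

text \<open>Dually, the positive one of the two must not be used: its entry would become
  \<open>z m + \<epsilon>\<close>, which is negative.\<close>

lemma min_kept_step:
  assumes "gap_step s z z'" "mixed z" "mixed z'" "\<And>b. balanced_at b z'" "gap_bound N z"
    and "- 2 * z m - 1 = N" "z' m = z m" "z p + z q = 0" "0 < z p"
    and pq: "p \<noteq> q" "p \<noteq> m" "q \<noteq> m"
  shows "s \<noteq> p \<and> z' p + z' q = 0 \<and> 0 < z' p"
proof -
  from pq have qp: "q \<noteq> p" "m \<noteq> q" "m \<noteq> p" by auto
  consider "s = m" | "s = p" | "s = q" using letter_cases[OF pq] by blast
  then show ?thesis
  proof cases
    case 1
    show ?thesis by (rule gap_stepE[OF assms(1), of p q]) (use 1 pq assms(8,9) in auto)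
  next
    case 2
    obtain \<epsilon> where e: "\<epsilon> = 0 \<or> \<epsilon> = 1" "z' p = z p + z m + z q + \<epsilon>" "z' m = z m" "z' q = z q"
      by (rule gap_stepE[OF assms(1), of m q]) (use 2 pq in auto)
    then show ?thesis using 2 assms(2,3,5-9) qp
      unfolding gap_bound_eq[OF pq] mixed_eq[OF pq]
      by (smt (verit))
  next
    case 3
    obtain \<epsilon> where e: "\<epsilon> = 0 \<or> \<epsilon> = 1" "z' q = z q + z m + z p + \<epsilon>" "z' m = z m" "z' p = z p"
      by (rule gap_stepE[OF assms(1), of m p]) (use 3 pq in auto)
    then show ?thesis using 3 assms(2,3,5-9) assms(4)[of p] qp
      unfolding gap_bound_eq[OF pq] mixed_eq[OF pq] balanced_at_eq[OF qp(2) qp(3) qp(1)]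
      by (smt (verit))
  qed
qed

section \<open>Orbits of gaps through many levels\<close>

locale gap_orbit =
  fixes a :: "nat \<Rightarrow> letter" and Z :: "nat \<Rightarrow> letter \<Rightarrow> int" and k0 T :: nat
  assumes gap_step: "\<And>k. k0 \<le> k \<Longrightarrow> k < T \<Longrightarrow> gap_step (a k) (Z (Suc k)) (Z k)"
    and mixed: "\<And>k. k0 \<le> k \<Longrightarrow> k \<le> T \<Longrightarrow> mixed (Z k)"
begin

text \<open>The use of \<open>b\<close> creates balance directly above it, and steps higher up, at
  \<open>b\<close> or not, preserve it.\<close>

lemma balanced_at_above:
  assumes "k0 \<le> i" "a i = b" "Suc i \<le> k" "k \<le> T"
  shows "balanced_at b (Z k)"
  using assms(3,4)
proof (induction k rule: dec_induct)
  case base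
  then show ?case using assms balanced_at_used[of b "Z (Suc i)" "Z i"] gap_step[of i] mixed[of i] by auto
next
  case (step k)
  show ?case
  proof (cases "a k = b")
    case True
    then show ?thesis
      using assms step balanced_at_used[of b "Z (Suc k)" "Z k"] gap_step[of k] mixed[of k] by auto
  next
    case False
    then show ?thesis
      using assms step balanced_at_unused[of "a k" "Z (Suc k)" "Z k" b] gap_step[of k] by auto
  qed
qed

lemma balanced_at_full: "full a k0 k1 \<Longrightarrow> k1 \<le> k \<Longrightarrow> k \<le> T \<Longrightarrow> balanced_at b (Z k)"
proof -
  assume f: "full a k0 k1" and k: "k1 \<le> k" "k \<le> T"
  obtain i where "k0 \<le> i" "i < k1" "a i = b" using f unfolding full_def by blast
  then show ?thesis using balanced_at_above[of i b k] k by simp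
qed

lemma full_less: "full b k l \<Longrightarrow> k < l"
  unfolding full_def by (metis order_le_less_trans)

lemma gap_bound_down:
  assumes "full a k0 k1" "k1 \<le> k" "k \<le> l" "l \<le> T" "gap_bound N (Z l)"
  shows "gap_bound N (Z k)"
  using assms(3)
proof (induction k rule: inc_induct)
  case (step n)
  have "k0 < k1" using assms(1) by (rule full_less)
  with step assms(2,4) have n: "k0 \<le> n" "k1 \<le> n" "n < T" by auto
  show ?case
    by (rule gap_bound_step[OF gap_step[of n] mixed mixed balanced_at_full[OF assms(1)] step.IH])
      (use n in auto)
qed (rule assms(5))

text \<open>If \<open>N\<close> is still attained at level \<open>p\<close>, say by the entry at
  \<open>m\<close>, then this entry had the same value on all levels up to \<open>r\<close>. The use
  of \<open>m\<close> in the upper round fixes the sum of the other two entries; from there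
  downwards one of these two letters must not be used, although the lower round contains it.\<close>

lemma gap_bound_drop:
  assumes f: "full a k0 k1" "k1 \<le> p" "full a p q" "full a q r" "r \<le> T" and N: "gap_bound N (Z r)"
  shows "gap_bound (N - 1) (Z p)"
proof (rule ccontr)
  assume neg: "\<not> gap_bound (N - 1) (Z p)"
  have lt: "k0 < k1" "p < q" "q < r" using f full_less by auto
  have bd: "gap_bound N (Z k)" if "p \<le> k" "k \<le> r" for k
    using gap_bound_down[OF f(1) _ _ f(5) N] that f(2) by auto
  obtain m where m: "2 * Z p m = N \<or> - 2 * Z p m - 1 = N"
  proof -
    obtain i where "\<not> (2 * Z p i \<le> N - 1 \<and> - 2 * Z p i - 1 \<le> N - 1)"
      using neg unfolding gap_bound_def by blast
    moreover have "2 * Z p i \<le> N \<and> - 2 * Z p i - 1 \<le> N"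
      using bd[of p] lt unfolding gap_bound_def by simp
    ultimately have "2 * Z p i = N \<or> - 2 * Z p i - 1 = N" by linarith
    then show ?thesis using that by blast
  qed
  have up: "Z k m = Z p m" if "p \<le> k" "k \<le> r" for k
    using that
  proof (induction k rule: dec_induct)
    case (step k)
    then have k: "k0 \<le> k" "k1 \<le> k" "k < T" using f lt by auto
    have "Z (Suc k) m = Z k m"
      by (rule extreme_step[OF gap_step[of k] mixed mixed balanced_at_full[OF f(1)] bd[of "Suc k"]])
        (use k step m in auto)
    then show ?case using step by simp
  qed simp
  obtain k where k: "q \<le> k" "k < r" "a k = m" using f(4) unfolding full_def by blast
  have k': "k0 \<le> k" "k1 \<le> k" "k < T" using k f lt by auto
  obtain x y where xy: "x \<noteq> y" "x \<noteq> m" "y \<noteq> m" using other_letters by blast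
  have eqs: "Z (Suc k) m = Z k m" "Z k m = Z p m" using up[of k] up[of "Suc k"] k lt by auto
  have bal: "balanced_at b (Z l)" if "k1 \<le> l" "l \<le> T" for b l
    using balanced_at_full[OF f(1)] that by blast
  have gs: "gap_step m (Z (Suc k)) (Z k)" using gap_step[of k] k k' by auto
  have mx: "mixed (Z k)" using mixed k' by auto
  have bk: "gap_bound N (Z (Suc k))" using bd k lt by auto
  show False
    using m
  proof
    assume M: "2 * Z p m = N"
    have "Z k x + Z k y = - 1"
      using max_kept[OF gs mx bal bk _ eqs(1) xy] M eqs k' by auto
    then obtain u v where uv: "u \<noteq> v" "u \<noteq> m" "v \<noteq> m" "Z k u + Z k v = - 1" "0 \<le> Z k u"
      using xy by (cases "0 \<le> Z k x") (auto intro: that[of x y] that[of y x])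
    have "Z l u + Z l v = - 1 \<and> 0 \<le> Z l u \<and> (l < k \<longrightarrow> a l \<noteq> v)" if "p \<le> l" "l \<le> k" for l
      using that(2,1)
    proof (induction l rule: inc_induct)
      case base
      then show ?case using uv by simp
    next
      case (step l)
      then have l: "k0 \<le> l" "k1 \<le> l" "l < T" "p \<le> l" "Suc l \<le> r" using f lt k k' by auto
      have "Z (Suc l) m = Z p m" "Z l m = Z p m" using up[of l] up[of "Suc l"] l by auto
      then show ?case
        using max_kept_step[OF gap_step[OF l(1,3)] mixed mixed bal bd[of "Suc l"] _ _ _ _ uv(1-3)]
          step M l by auto
    qed
    moreover obtain l where "p \<le> l" "l < q" "a l = v" using f(3) unfolding full_def by blast
    ultimately show False using k by (metis le_less_trans less_imp_le less_le_trans)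
  next
    assume M: "- 2 * Z p m - 1 = N"
    have s0: "Z k x + Z k y = 0"
      using min_kept[OF gs mx bal bk _ eqs(1) xy] M eqs k' by auto
    have "Z k x \<noteq> 0" using mx s0 unfolding mixed_eq[OF xy] by auto
    then obtain u v where uv: "u \<noteq> v" "u \<noteq> m" "v \<noteq> m" "Z k u + Z k v = 0" "0 < Z k u"
      using xy s0 by (cases "0 < Z k x") (auto intro: that[of x y] that[of y x])
    have "Z l u + Z l v = 0 \<and> 0 < Z l u \<and> (l < k \<longrightarrow> a l \<noteq> u)" if "p \<le> l" "l \<le> k" for l
      using that(2,1)
    proof (induction l rule: inc_induct)
      case base
      then show ?case using uv by simp
    next
      case (step l)
      then have l: "k0 \<le> l" "k1 \<le> l" "l < T" "p \<le> l" "Suc l \<le> r" using f lt k k' by auto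
      have "Z (Suc l) m = Z p m" "Z l m = Z p m" using up[of l] up[of "Suc l"] l by auto
      then show ?case
        using min_kept_step[OF gap_step[OF l(1,3)] mixed mixed bal bd[of "Suc l"] _ _ _ _ uv(1-3)]
          step M l by auto
    qed
    moreover obtain l where "p \<le> l" "l < q" "a l = u" using f(3) unfolding full_def by blast
    ultimately show False using k by (metis le_less_trans less_imp_le less_le_trans)
  qed
qed

text \<open>Two rounds are spent for each unit of the bound, and a bound of 0 leaves no positive
  entry.\<close>

lemma no_long_orbit:
  assumes "full a k0 k1" "k1 \<le> ls 0" "\<And>i. i < 2 * n \<Longrightarrow> full a (ls i) (ls (Suc i))"
    and "ls (2 * n) \<le> T" "gap_bound (int n) (Z (ls (2 * n)))"
  shows False
  using assms(3-5)
proof (induction n)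
  case 0
  then have "k0 \<le> ls 0" using full_less[OF assms(1)] assms(2) by auto
  then obtain i where "0 < Z (ls 0) i" using mixed[of "ls 0"] 0 unfolding mixed_def by auto
  moreover have "2 * Z (ls 0) i \<le> 0" using 0(3) by (simp add: gap_bound_def)
  ultimately show ?case by simp
next
  case (Suc n)
  note ful = Suc.prems(1)
  have mono: "ls 0 \<le> ls i" if "i \<le> 2 * Suc n" for i
    using that
  proof (induction i)
    case (Suc i)
    then show ?case using full_less[OF ful[of i]] by simp
  qed simp
  have "gap_bound (int (Suc n) - 1) (Z (ls (2 * n)))"
    by (rule gap_bound_drop[OF assms(1), of _ "ls (2 * n + 1)" "ls (2 * n + 2)"])
      (use Suc.prems mono[of "2 * n"] assms(2) ful[of "2 * n"] ful[of "2 * n + 1"] in auto)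
  moreover have "ls (2 * n) \<le> T"
    using full_less[OF ful[of "2 * n"]] full_less[OF ful[of "2 * n + 1"]] Suc.prems(2) by simp
  ultimately show ?case using Suc.IH Suc.prems(1) by auto
qed

end

text \<open>The obstruction to be refuted: measured by the functional \<open>g\<close>, the vertex
  lies at a height covered by the word over \<open>j\<close>, yet the path of this word misses
  it.\<close>

definition blocked :: "(nat \<Rightarrow> letter) \<Rightarrow> (letter \<Rightarrow> int) \<Rightarrow> nat \<Rightarrow> (letter \<Rightarrow> int) \<Rightarrow> letter \<Rightarrow> bool" where
  "blocked a g k x j \<longleftrightarrow>
     0 \<le> dot (Coact a k g) x \<and> dot (Coact a k g) x \<le> Coact a k g j \<and> \<not> passes a k x j"

definition gap :: "(letter \<Rightarrow> int) \<Rightarrow> letter \<Rightarrow> letter \<Rightarrow> int" where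
  "gap x j = (\<lambda>i. x i - unitv j i)"

definition gap_move :: "letter \<Rightarrow> (letter \<Rightarrow> int) \<Rightarrow> letter \<Rightarrow> (letter \<Rightarrow> int) \<Rightarrow> letter \<Rightarrow> bool" where
  "gap_move s z j z' j' \<longleftrightarrow> j' = s \<and> z' = act s z \<or>
     j' = j \<and> j \<noteq> s \<and> z' = (act s z)(s := act s z s + 1)"

text \<open>The word over \<open>j\<close> splits into the word over \<open>j\<close> and, if
  \<open>j\<close> is not \<open>a k\<close>, the word over \<open>a k\<close>. The height of the
  vertex selects the block that ought to contain it; a prefix of this block reaching it would give a
  prefix of the whole. Gaps refer to the end of the selected block, and the first block ends one
  unit vector of \<open>a k\<close> earlier, hence the 1.\<close>

lemma blocked_descent:
  assumes "blocked a g (Suc k) x j"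
  shows "\<exists>x' j'. blocked a g k x' j' \<and> gap_move (a k) (gap x j) j (gap x' j') j'"
proof -
  define M where "M = act (a k) x"
  define H where "H = Coact a k g"
  have d: "dot H M = dot (Coact a (Suc k) g) x" by (simp add: M_def H_def dot_act)
  have b: "0 \<le> dot H M" "dot H M \<le> Coact a (Suc k) g j" "\<not> passes a (Suc k) x j"
    using assms by (auto simp: blocked_def d simp del: Coact.simps)
  have lift: "passes a (Suc k) x j" if "prefix P (wd a (Suc k) [j])" "cnt P = Act a k M" for P
    using that by (auto simp: passes_def M_def)
  show ?thesis
  proof (cases "j = a k")
    case True
    have "\<not> passes a k M j"
      using lift b(3) True wd_Suc_letter[of a k j] by (auto simp: passes_def simp del: subst_prod.simps)
    then have "blocked a g k M j" using b True by (auto simp: blocked_def H_def)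
    moreover have "gap M j = act (a k) (gap x j)"
      by (simp add: gap_def M_def act_diff act_unitv True)
    ultimately show ?thesis using True unfolding gap_move_def by blast
  next
    case False
    have w: "wd a (Suc k) [j] = wd a k [j] @ wd a k [a k]" using wd_Suc_letter[of a k j] False by simp
    have h: "Coact a (Suc k) g j = H j + H (a k)" using False by (simp add: H_def)
    have e: "act (a k) (gap x j) = (\<lambda>i. M i - (unitv j i + unitv (a k) i))"
      by (simp add: gap_def M_def act_diff act_unitv False)
    show ?thesis
    proof (cases "dot H M \<le> H j")
      case True
      have "\<not> passes a k M j"
        using lift b(3) w by (auto simp: passes_def prefix_append simp del: subst_prod.simps)
      then have "blocked a g k M j" using b True by (auto simp: blocked_def H_def)
      moreover have "gap M j = (act (a k) (gap x j))(a k := act (a k) (gap x j) (a k) + 1)"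
        using False unfolding e by (auto simp: gap_def unitv_def)
      ultimately show ?thesis using False unfolding gap_move_def by blast
    next
      case le: False
      define x' where "x' = (\<lambda>i. M i - unitv j i)"
      have "dot H x' = dot H M - H j" by (simp add: x'_def dot_diff)
      then have "0 \<le> dot H x'" "dot H x' \<le> H (a k)" using b le h by auto
      moreover have "\<not> passes a k x' (a k)"
      proof
        assume "passes a k x' (a k)"
        then obtain P where P: "prefix P (wd a k [a k])" "cnt P = Act a k x'" by (auto simp: passes_def)
        have "cnt (wd a k [j] @ P) = Act a k M"
          using P by (simp add: cnt_wd_letter x'_def Act_diff)
        then show False using lift[of "wd a k [j] @ P"] b(3) w P by (auto simp: prefix_append)
      qed
      ultimately have "blocked a g k x' (a k)" by (auto simp: blocked_def H_def)
      moreover have "gap x' (a k) = act (a k) (gap x j)"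
        unfolding e by (auto simp: gap_def x'_def)
      ultimately show ?thesis unfolding gap_move_def by blast
    qed
  qed
qed

lemma blocked_orbit:
  assumes "blocked a g T x j"
  shows "\<exists>X J. X T = x \<and> J T = j \<and> (\<forall>k\<le>T. blocked a g k (X k) (J k)) \<and>
    (\<forall>k<T. gap_move (a k) (gap (X (Suc k)) (J (Suc k))) (J (Suc k)) (gap (X k) (J k)) (J k))"
  using assms
proof (induction T arbitrary: x j)
  case 0
  then show ?case by (intro exI[of _ "\<lambda>_. x"] exI[of _ "\<lambda>_. j"]) auto
next
  case (Suc T)
  obtain x' j' where x': "blocked a g T x' j'"
    "gap_move (a T) (gap x j) j (gap x' j') j'"
    using blocked_descent[OF Suc.prems] by blast
  obtain X J where XJ: "X T = x'" "J T = j'" "\<forall>k\<le>T. blocked a g k (X k) (J k)"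
    "\<forall>k<T. gap_move (a k) (gap (X (Suc k)) (J (Suc k))) (J (Suc k)) (gap (X k) (J k)) (J k)"
    using Suc.IH[OF x'(1)] by blast
  show ?case
    by (intro exI[of _ "X(Suc T := x)"] exI[of _ "J(Suc T := j)"])
      (use XJ x' Suc.prems in \<open>auto simp: le_Suc_eq less_Suc_eq\<close>)
qed

lemma dot_pos:
  fixes H z :: "letter \<Rightarrow> int"
  assumes "\<And>i. 0 < H i" "\<And>i. 0 \<le> z i" "z \<noteq> (\<lambda>i. 0)"
  shows "0 < dot H z"
proof -
  obtain s where s: "z s \<noteq> 0" using assms(3) by blast
  obtain p q where pq: "p \<noteq> q" "p \<noteq> s" "q \<noteq> s" using other_letters by blast
  have "0 < H s * z s" using s assms(1,2)[of s] by (auto simp: zero_less_mult_iff)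
  moreover have "0 \<le> H p * z p" "0 \<le> H q * z q"
    using assms(1,2) less_imp_le by (blast intro: mult_nonneg_nonneg)+
  ultimately show ?thesis by (simp add: dot_eq[OF pq])
qed

text \<open>A path visits both its ends, so \<open>x\<close> is neither 0 nor the end vertex. A gap
  without negative entry would put the vertex above the end, and a nonpositive gap that is negative
  at \<open>j\<close> would make \<open>x\<close> nonpositive, below the start.\<close>

lemma blocked_signs:
  assumes g: "\<And>i. 0 < g i" and b: "blocked a g k x j"
  shows "gap x j \<noteq> (\<lambda>i. 0)" "\<exists>i. gap x j i < 0" "(\<And>i. gap x j i \<le> 0) \<Longrightarrow> gap x j j = 0"
proof -
  define H where "H = Coact a k g"
  have H: "0 < H i" for i using Coact_pos[OF g] by (simp add: H_def)
  have b': "0 \<le> dot H x" "dot H x \<le> H j" "\<not> passes a k x j" using b by (auto simp: blocked_def H_def)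
  have x0: "x \<noteq> (\<lambda>i. 0)"
  proof
    assume "x = (\<lambda>i. 0)"
    then have "passes a k x j" unfolding passes_def by (intro exI[of _ "[]"]) simp
    then show False using b' by simp
  qed
  show z0: "gap x j \<noteq> (\<lambda>i. 0)"
  proof
    assume "gap x j = (\<lambda>i. 0)"
    then have "x i = unitv j i" for i by (metis gap_def eq_iff_diff_eq_0)
    then have "x = unitv j" by blast
    then have "passes a k x j" unfolding passes_def by (intro exI[of _ "wd a k [j]"]) (simp add: cnt_wd_letter)
    then show False using b' by simp
  qed
  have dg: "dot H (gap x j) = dot H x - H j" by (simp add: gap_def dot_diff)
  show "\<exists>i. gap x j i < 0"
  proof (rule ccontr)
    assume "\<not> ?thesis"
    then have "0 < dot H (gap x j)" using z0 H by (intro dot_pos) (auto simp: not_less)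
    then show False using dg b' by simp
  qed
  show "gap x j j = 0" if le: "\<And>i. gap x j i \<le> 0"
  proof (rule ccontr)
    assume "gap x j j \<noteq> 0"
    then have "gap x j j \<le> - 1" using le[of j] by auto
    then have "x i \<le> 0" for i using le[of i] by (cases "i = j") (auto simp: gap_def unitv_def)
    then have "0 < dot H (\<lambda>i. 0 - x i)" using H x0 by (intro dot_pos) (auto simp: fun_eq_iff)
    then show False using b'(1) dot_diff[of H "\<lambda>i. 0" x] by (simp add: dot_def)
  qed
qed

lemma full_exists:
  fixes a :: "nat \<Rightarrow> letter"
  assumes "\<And>k i. \<exists>m\<ge>k. a m = i"
  shows "\<exists>l. full a k l"
proof -
  obtain f where f: "\<And>i. k \<le> f i \<and> a (f i) = i" using assms[of k] by metis
  have "f i \<le> Max (range f)" for i by (intro Max_ge) auto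
  then have "full a k (Suc (Max (range f)))"
    unfolding full_def using f by (meson le_imp_less_Suc)
  then show ?thesis ..
qed

lemma rounds_exist:
  fixes a :: "nat \<Rightarrow> letter"
  assumes "\<And>k i. \<exists>m\<ge>k. a m = i"
  shows "\<exists>ls. ls 0 = k \<and> (\<forall>i. full a (ls i) (ls (Suc i)))"
proof -
  obtain f where f: "\<And>k. full a k (f k)" using full_exists[OF assms] by metis
  show ?thesis by (rule exI[of _ "rec_nat k (\<lambda>_. f)"]) (simp add: f)
qed

text \<open>Of the \<open>2 * n + 2\<close> rounds the lowest makes the gaps mixed, the next one
  balances them at every letter, and the others exhaust the bound. Gap entries are at most
  \<open>C + 1\<close> in modulus, so their index is at most \<open>2 * (C + 1)\<close>.\<close>

theorem passes_vertex:
  fixes g x :: "letter \<Rightarrow> int"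
  assumes g: "\<And>i. 0 < g i"
    and ls: "ls 0 = 0" "\<And>i. i < 2 * n + 2 \<Longrightarrow> full a (ls i) (ls (Suc i))" "ls (2 * n + 2) \<le> T"
    and x: "\<And>i. \<bar>x i\<bar> \<le> C" "2 * (C + 1) \<le> int n"
    and h: "0 \<le> dot (Coact a T g) x" "dot (Coact a T g) x \<le> Coact a T g j"
  shows "passes a T x j"
proof (rule ccontr)
  assume "\<not> passes a T x j"
  then have "blocked a g T x j" using h by (simp add: blocked_def)
  from blocked_orbit[OF this] obtain X J where XJ: "X T = x" "J T = j"
    "\<And>k. k \<le> T \<Longrightarrow> blocked a g k (X k) (J k)"
    "\<And>k. k < T \<Longrightarrow> gap_move (a k) (gap (X (Suc k)) (J (Suc k))) (J (Suc k)) (gap (X k) (J k)) (J k)"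
    by blast
  define Z where "Z k = gap (X k) (J k)" for k
  note signs = blocked_signs[OF g XJ(3)]
  \<comment> \<open>A step that leads to the letter \<open>a k\<close> makes the entry at this
    letter negative, against \<open>signs(3)\<close>. Any other step keeps the current letter
    without using it and leaves the gap nonpositive, so the descent cannot get past a use of that
    letter.\<close>
  have not_nonpos: False if "\<And>i. Z k i \<le> 0" "k \<le> T" "i < k" "a i = J k" for i k
    using that
  proof (induction k)
    case (Suc k)
    have z0: "Z (Suc k) (J (Suc k)) = 0" using signs(3)[of "Suc k"] Suc.prems by (simp add: Z_def)
    obtain p q where pq: "p \<noteq> q" "p \<noteq> a k" "q \<noteq> a k" using other_letters by blast
    have neg: "act (a k) (Z (Suc k)) (a k) < 0"
    proof -
      obtain i where "Z (Suc k) i < 0" using signs(2)[of "Suc k"] Suc.prems by (auto simp: Z_def)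
      then have "Z (Suc k) (a k) < 0 \<or> Z (Suc k) p < 0 \<or> Z (Suc k) q < 0"
        using letter_cases[OF pq, of i] by metis
      then show ?thesis using Suc.prems(1)[of p] Suc.prems(1)[of q] Suc.prems(1)[of "a k"] pq
        by (auto simp: act_eq)
    qed
    have other: "act (a k) (Z (Suc k)) i = Z (Suc k) i" if "i \<noteq> a k" for i using that by (simp add: act_def)
    consider "J k = a k" "Z k = act (a k) (Z (Suc k))" |
      "J k = J (Suc k)" "J (Suc k) \<noteq> a k"
      "Z k = (act (a k) (Z (Suc k)))(a k := act (a k) (Z (Suc k)) (a k) + 1)"
      using XJ(4)[of k] Suc.prems by (auto simp: Z_def gap_move_def)
    then show ?case
    proof cases
      case 1
      then have "Z k i \<le> 0" for i using neg other Suc.prems(1)[of i] by (cases "i = a k") auto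
      then have "Z k (J k) = 0" using signs(3)[of k] Suc.prems by (simp add: Z_def)
      then show ?thesis using 1 neg by simp
    next
      case 2
      then have "Z k i \<le> 0" for i using neg other Suc.prems(1)[of i] by (cases "i = a k") auto
      moreover have "i < k" using Suc.prems 2 by (metis less_antisym)
      ultimately show ?thesis using Suc.IH Suc.prems 2 by simp
    qed
  qed simp
  interpret gap_orbit a Z "ls 1" T
  proof
    fix k assume k: "ls 1 \<le> k"
    show "gap_step (a k) (Z (Suc k)) (Z k)" if "k < T"
      using XJ(4)[OF that] unfolding gap_step_def gap_move_def Z_def
      by (elim disjE) (auto intro: exI[of _ 0])
    show "mixed (Z k)" if "k \<le> T"
    proof -
      have "full a 0 (ls 1)" using ls(1) ls(2)[of 0] by simp
      then obtain i where "i < k" "a i = J k" using k unfolding full_def by (meson less_le_trans)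
      then have "\<exists>i. 0 < Z k i" using not_nonpos[of k i] that by (meson not_less)
      then show ?thesis using signs(2)[OF that] by (simp add: mixed_def Z_def)
    qed
  qed
  have f12: "full a (ls 1) (ls 2)" using ls(2)[of 1] by (simp add: numeral_2_eq_2)
  have fi: "full a (ls (i + 2)) (ls (Suc i + 2))" if "i < 2 * n" for i using ls(2)[of "i + 2"] that by simp
  have mono: "ls 2 \<le> ls (2 + i)" if "i \<le> 2 * n" for i
    using that
  proof (induction i)
    case (Suc i)
    then show ?case using full_less[OF fi[of i]] by (simp add: add.commute)
  qed simp
  have "gap_bound (int n) (Z T)"
    unfolding gap_bound_def
  proof
    fix i
    have "\<bar>Z T i\<bar> \<le> C + 1" using x(1)[of i] by (auto simp: Z_def gap_def XJ unitv_def)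
    then have "Z T i \<le> C + 1" "- (C + 1) \<le> Z T i" by simp_all
    then show "2 * Z T i \<le> int n \<and> - 2 * Z T i - 1 \<le> int n" using x(2) by simp
  qed
  then have "gap_bound (int n) (Z (ls (2 * n + 2)))"
    using gap_bound_down[OF f12, of "ls (2 * n + 2)" T "int n"] ls(3) mono[of "2 * n"]
    by (simp add: add.commute)
  then show False
    using no_long_orbit[OF f12, of "\<lambda>i. ls (i + 2)" n] fi ls(3) by (simp add: numeral_2_eq_2)
qed

section \<open>The limit direction\<close>

definition val :: "(letter \<Rightarrow> 'a::real_vector) \<Rightarrow> word \<Rightarrow> 'a" where
  "val c w = sum_list (map c w)"

lemma val_append [simp]: "val c (v @ w) = val c v + val c w" by (simp add: val_def)
lemma val_Nil [simp]: "val c [] = 0" by (simp add: val_def)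
lemma val_Cons [simp]: "val c (j # w) = c j + val c w" by (simp add: val_def)

lemma val_subst_word: "val c (subst_word (AR s) w) = val (coact s c) w"
  by (induction w) (auto simp: subst_word_def AR_def)

lemma val_wd: "val c (wd a n w) = val (Coact a n c) w"
  by (induction n arbitrary: w) (simp_all add: val_subst_word)

lemma dot_unitv_real [simp]: "dot c (\<lambda>i. real_of_int (unitv j i)) = c j"
proof -
  obtain p q where pq: "p \<noteq> q" "p \<noteq> j" "q \<noteq> j" using other_letters by blast
  then show ?thesis by (simp add: dot_eq[OF pq] unitv_def)
qed

lemma act_nonneg: "(\<And>i. 0 \<le> y i) \<Longrightarrow> 0 \<le> act s (y :: letter \<Rightarrow> real) i"
  by (simp add: act_def)

lemma Act_nonneg: "(\<And>i. 0 \<le> y i) \<Longrightarrow> 0 \<le> Act a n (y :: letter \<Rightarrow> real) i"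
  by (induction n arbitrary: y) (simp_all add: act_nonneg)

lemma act_ge: "(\<And>i. 0 \<le> y i) \<Longrightarrow> y i \<le> act s (y :: letter \<Rightarrow> real) i"
proof -
  assume y: "\<And>i. 0 \<le> y i"
  obtain p q where pq: "p \<noteq> q" "p \<noteq> s" "q \<noteq> s" using other_letters by blast
  show ?thesis using letter_cases[OF pq, of i] act_eq[OF pq, of y] y[of p] y[of q] by auto
qed

lemma Act_ge: "(\<And>i. 0 \<le> y i) \<Longrightarrow> y i \<le> Act a n (y :: letter \<Rightarrow> real) i"
proof (induction n arbitrary: y)
  case (Suc n)
  have "y i \<le> act (a n) y i" using Suc.prems by (rule act_ge)
  also have "\<dots> \<le> Act a n (act (a n) y) i" by (rule Suc.IH) (simp add: act_nonneg Suc.prems)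
  finally show ?case by simp
qed simp

lemma Act_scale: "Act a n (\<lambda>i. k * x i) = (\<lambda>i. k * Act a n x i :: real)"
proof (induction n arbitrary: x)
  case (Suc n)
  have "act (a n) (\<lambda>i. k * x i) = (\<lambda>i. k * act (a n) x i)" by (auto simp: act_def distrib_left)
  then show ?case by (simp add: Suc)
qed simp

lemma Act_pos:
  fixes y :: "letter \<Rightarrow> real"
  assumes "\<And>i. 0 \<le> y i" "y \<noteq> (\<lambda>i. 0)" "k < n" "a k = i"
  shows "0 < Act a n y i"
  using assms(1-3)
proof (induction n arbitrary: y)
  case (Suc n)
  have nn: "\<And>i. 0 \<le> act (a n) y i" by (simp add: act_nonneg Suc.prems(1))
  obtain s where s: "0 < y s" using Suc.prems(1,2) by (metis ext order_le_less)
  have pos: "0 < act (a n) y (a n)"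
  proof -
    obtain p q where pq: "p \<noteq> q" "p \<noteq> a n" "q \<noteq> a n" using other_letters by blast
    show ?thesis using letter_cases[OF pq, of s] s Suc.prems(1)[of p] Suc.prems(1)[of q]
        Suc.prems(1)[of "a n"] unfolding act_eq(1)[OF pq]
      by (metis add_nonneg_pos add_pos_nonneg add_nonneg_nonneg)
  qed
  show ?case
  proof (cases "k = n")
    case True
    then have "act (a n) y i \<le> Act a n (act (a n) y) i" using nn by (intro Act_ge) auto
    then show ?thesis using pos True assms(4) by simp
  next
    case False
    have "act (a n) y \<noteq> (\<lambda>i. 0)" using pos by (metis less_irrefl)
    then show ?thesis using Suc.IH[of "act (a n) y"] nn False Suc.prems(3) by simp
  qed
qed simp

lemma act_inj: "act s x = act s y \<Longrightarrow> x = y"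
proof -
  assume eq: "act s x = act s y"
  obtain p q where pq: "p \<noteq> q" "p \<noteq> s" "q \<noteq> s" using other_letters by blast
  have "x p = y p" "x q = y q" "x s + x p + x q = y s + y p + y q"
    using fun_cong[OF eq] act_eq[OF pq, of x] act_eq[OF pq, of y] by metis+
  then have "x i = y i" for i using letter_cases[OF pq, of i] by auto
  then show ?thesis by blast
qed

lemma Act_inj: "Act a n x = Act a n y \<Longrightarrow> x = y"
  by (induction n arbitrary: x y) (auto dest: act_inj)

lemma coact_nonzero: "c \<noteq> (\<lambda>i. 0) \<Longrightarrow> coact s c \<noteq> (\<lambda>i. 0)"
proof (rule notI)
  assume c: "c \<noteq> (\<lambda>i. 0)" "coact s c = (\<lambda>i. 0)"
  have "c s = 0" using fun_cong[OF c(2), of s] by simp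
  moreover have "c i = 0" if "i \<noteq> s" for i using fun_cong[OF c(2), of i] that \<open>c s = 0\<close> by simp
  ultimately have "c i = 0" for i by (cases "i = s") auto
  then show False using c(1) by blast
qed

lemma Coact_nonzero: "c \<noteq> (\<lambda>i. 0) \<Longrightarrow> Coact a n c \<noteq> (\<lambda>i. 0)"
  by (induction n) (simp_all add: coact_nonzero)

lemma dot_zero_mixed:
  fixes c y :: "letter \<Rightarrow> real"
  assumes "dot c y = 0" "\<And>i. 0 < y i" "c \<noteq> (\<lambda>i. 0)"
  shows "\<exists>i. 0 < c i" "\<exists>i. c i < 0"
proof -
  have *: "\<exists>i. 0 < c i" if c0: "dot c y = 0" and cn: "c \<noteq> (\<lambda>i. 0)" for c
  proof (rule ccontr)
    assume "\<not> ?thesis"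
    then have le: "c i \<le> 0" for i by (simp add: not_less)
    obtain s where s: "c s < 0" using cn le by (metis ext order_le_less)
    obtain p q where pq: "p \<noteq> q" "p \<noteq> s" "q \<noteq> s" using other_letters by blast
    have "c s * y s < 0" "c p * y p \<le> 0" "c q * y q \<le> 0"
      using s le assms(2) by (auto simp: mult_less_0_iff mult_le_0_iff less_imp_le)
    then show False using c0 by (simp add: dot_eq[OF pq])
  qed
  show "\<exists>i. 0 < c i" using * assms by blast
  have "dot (\<lambda>i. - c i) y = 0" using assms(1) by (simp add: dot_def)
  moreover have "(\<lambda>i. - c i) \<noteq> (\<lambda>i. 0)" using assms(3) by (metis neg_equal_0_iff_equal ext)
  ultimately show "\<exists>i. c i < 0" using *[of "\<lambda>i. - c i"] by auto
qed

text \<open>Membership in the open cones of all levels. Positivity at each level keeps every nonzero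
  functional that vanishes on \<open>u\<close> mixed.\<close>

definition direction :: "(nat \<Rightarrow> letter) \<Rightarrow> (letter \<Rightarrow> real) \<Rightarrow> bool" where
  "direction a u \<longleftrightarrow> (\<forall>n. \<exists>y. (\<forall>i. 0 < y i) \<and> Act a n y = u)"

lemma direction_pos: "direction a u \<Longrightarrow> 0 < u i"
  unfolding direction_def by (metis Act.simps(1))

lemma direction_shift:
  assumes "direction a u"
  obtains y where "Act a m y = u" "direction (sh m a) y"
proof -
  obtain y where y: "\<And>i. 0 < y i" "Act a m y = u" using assms unfolding direction_def by blast
  have "\<exists>z. (\<forall>i. 0 < z i) \<and> Act (sh m a) n z = y" for n
  proof -
    obtain z where z: "\<And>i. 0 < z i" "Act a (m + n) z = u" using assms unfolding direction_def by blast
    then have "Act (sh m a) n z = y" using y Act_inj[of a m] by (metis Act_add)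
    then show ?thesis using z by blast
  qed
  then show ?thesis using that y by (auto simp: direction_def)
qed

locale ar_sequence =
  fixes a :: "nat \<Rightarrow> letter" and h :: nat
  assumes rec: "\<And>n i. \<exists>m\<ge>n. a m = i"
    and runs: "\<And>n. \<exists>j\<le>h. a (n + j) \<noteq> a n"
begin

lemma ar_sequence_sh: "ar_sequence (sh m a) h"
proof
  show "\<exists>k\<ge>n. sh m a k = i" for n i
    using rec[of "m + n" i] by (metis sh_apply le_add_diff_inverse nat_add_left_cancel_le add_leD1 le_iff_add add.assoc)
  show "\<exists>j\<le>h. sh m a (n + j) \<noteq> sh m a n" for n
    using runs[of "m + n"] by (simp add: sh_def add.assoc)
qed

lemma dual_orbit:
  assumes "direction a u" "dot c u = 0" "c \<noteq> (\<lambda>i. 0)"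
  shows "mixed_dual_orbit a (\<lambda>n. Coact a n c) h"
proof
  fix n
  obtain y where y: "\<And>i. 0 < y i" "Act a n y = u" using assms(1) unfolding direction_def by blast
  have "dot (Coact a n c) y = 0" using y(2) assms(2) by (metis dot_Act)
  then show "\<exists>i. 0 < Coact a n c i" "\<exists>i. Coact a n c i < 0"
    using dot_zero_mixed[of "Coact a n c" y] y(1) Coact_nonzero[OF assms(3)] by blast+
qed (use rec runs in auto)

text \<open>The sum of the weights contributes \<open>(h + 1) * (h + 2) + 1\<close>, the innermost
  letter of a suffix 1, and the value of the whole word 1.\<close>

definition "bnd = real ((h + 1) * (h + 2) + 3)"

lemma bnd_pos: "0 < bnd" by (simp add: bnd_def add_pos_nonneg)

text \<open>Suffixes fit the recursion because blocks are appended on the right: a suffix that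
  reaches beyond the last block contains all of it, and this block contributes exactly the weight of
  the step.\<close>

lemma suffix_val_le:
  fixes c :: "letter \<Rightarrow> real"
  assumes "suffix s (wd a n [j])" "\<And>j. \<bar>c j\<bar> \<le> L"
  shows "\<bar>val c s\<bar> \<le> L + (\<Sum>k=0..<n. \<bar>Coact a k c (a k)\<bar>)"
  using assms(1)
proof (induction n arbitrary: j s)
  case 0
  have "0 \<le> L" using assms(2)[of 1] by linarith
  then show ?case using 0 assms(2)[of j] by (auto simp: suffix_Cons)
next
  case (Suc n)
  let ?B = "L + (\<Sum>k=0..<n. \<bar>Coact a k c (a k)\<bar>)"
  have "suffix s (wd a n [j] @ (if j = a n then [] else wd a n [a n]))"
    using Suc.prems by (simp only: wd_Suc_letter)
  then consider "suffix s (wd a n [j])" | "suffix s (wd a n [a n])" |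
    s' where "s = s' @ wd a n [a n]" "suffix s' (wd a n [j])"
    by (auto simp: suffix_append split: if_splits)
  then show ?case
  proof cases
    case 1
    then show ?thesis using Suc.IH[of s j] by simp
  next
    case 2
    then show ?thesis using Suc.IH[of s "a n"] by simp
  next
    case 3
    have "val c s = val c s' + Coact a n c (a n)" by (simp add: 3 val_wd)
    then show ?thesis using Suc.IH[OF 3(2)] by simp
  qed
qed

text \<open>A prefix is the whole word minus a suffix. The bound is independent of \<open>n\<close>;
  this is the balance of the words in all directions transverse to \<open>u\<close>.\<close>

lemma prefix_val_le:
  assumes u: "direction a u" "dot c u = 0" and P: "prefix P (wd a n [j])"
  shows "\<bar>val c P\<bar> \<le> bnd * spread c"
proof (cases "c = (\<lambda>i. 0)")
  case True
  then have "val c w = 0" for w by (induction w) auto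
  moreover have "spread c = 0" using True by (simp add: spread_def)
  ultimately show ?thesis by simp
next
  case False
  interpret mixed_dual_orbit a "\<lambda>n. Coact a n c" h by (rule dual_orbit[OF u False])
  obtain s where s: "wd a n [j] = P @ s" using P by (auto simp: prefix_def)
  have 1: "\<bar>c j\<bar> \<le> spread c" for j using abs_le_spread[OF weakly_mixed[of 0]] by simp
  have "\<bar>val c s\<bar> \<le> spread c + (\<Sum>k=0..<n. \<bar>Coact a k c (a k)\<bar>)"
    using suffix_val_le[of s n j c] s 1 by (metis suffixI)
  also have "(\<Sum>k=0..<n. \<bar>Coact a k c (a k)\<bar>) \<le> real ((h + 1) * (h + 2) + 1) * spread c"
    using sum_letter_weights_le[of 0 n] by simp
  finally have "\<bar>val c s\<bar> \<le> spread c + real ((h + 1) * (h + 2) + 1) * spread c" by simp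
  moreover have "\<bar>Coact a n c j\<bar> \<le> spread c"
    using abs_le_spread[OF weakly_mixed[of n], of j] spread_antimono[of 0 n] by simp
  moreover have "val c P + val c s = Coact a n c j"
    using s val_append[of c P s] val_wd[of c a n "[j]"] by simp
  ultimately have "\<bar>val c P\<bar> \<le> spread c + (spread c + real ((h + 1) * (h + 2) + 1) * spread c)"
    by linarith
  also have "\<dots> = bnd * spread c" by (simp add: bnd_def algebra_simps)
  finally show ?thesis .
qed

lemma Coact_tendsto_zero:
  assumes "direction a u" "dot c u = 0"
  shows "(\<lambda>n. Coact a n c j) \<longlonglongrightarrow> 0"
proof (cases "c = (\<lambda>i. 0)")
  case True
  have "Coact a n (\<lambda>i. 0::real) = (\<lambda>i. 0)" for n by (induction n) (auto simp: coact_def)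
  then show ?thesis using True by simp
next
  case False
  interpret mixed_dual_orbit a "\<lambda>n. Coact a n c" h by (rule dual_orbit[OF assms False])
  show ?thesis by (rule tendsto_zero)
qed

text \<open>\<open>dot c x\<close> equals \<open>dot (Coact a n c) y\<close> with preimages
  \<open>y\<close> bounded by \<open>x\<close>, while the functionals tend to 0. So \<open>x\<close>
  is killed by everything that kills \<open>u\<close>.\<close>

lemma direction_unique:
  fixes x :: "letter \<Rightarrow> real"
  assumes u: "direction a u" and x: "\<And>n. \<exists>y. (\<forall>i. 0 \<le> y i) \<and> Act a n y = x"
  shows "\<exists>k\<ge>0. x = (\<lambda>i. k * u i)"
proof -
  have ortho: "dot c x = 0" if c: "dot c u = 0" for c
  proof -
    have "\<bar>dot c x\<bar> \<le> (\<bar>Coact a n c 1\<bar> + \<bar>Coact a n c 2\<bar> + \<bar>Coact a n c 3\<bar>) * (x 1 + x 2 + x 3)" for n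
    proof -
      obtain y where y: "\<And>i. 0 \<le> y i" "Act a n y = x" using x by blast
      have yx: "y i \<le> x i" for i using Act_ge[of y i a n] y by simp
      have x0: "0 \<le> x i" for i using yx y(1) order_trans by blast
      have t: "\<bar>Coact a n c i * y i\<bar> \<le> \<bar>Coact a n c i\<bar> * (x 1 + x 2 + x 3)" for i
        unfolding abs_mult using yx[of i] y(1)[of i] x0[of 1] x0[of 2] x0[of 3] exhaust_3[of i]
        by (intro mult_left_mono) auto
      have "dot c x = dot (Coact a n c) y" using y(2) by (metis dot_Act)
      then have "\<bar>dot c x\<bar> \<le> \<bar>Coact a n c 1 * y 1\<bar> + \<bar>Coact a n c 2 * y 2\<bar> + \<bar>Coact a n c 3 * y 3\<bar>"
        unfolding dot_def using abs_triangle_ineq order_trans add_right_mono by (smt (verit, ccfv_threshold))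
      also have "\<dots> \<le> \<bar>Coact a n c 1\<bar> * (x 1 + x 2 + x 3) + \<bar>Coact a n c 2\<bar> * (x 1 + x 2 + x 3)
          + \<bar>Coact a n c 3\<bar> * (x 1 + x 2 + x 3)"
        by (intro add_mono t)
      finally show ?thesis by (simp only: distrib_right)
    qed
    moreover have "(\<lambda>n. (\<bar>Coact a n c 1\<bar> + \<bar>Coact a n c 2\<bar> + \<bar>Coact a n c 3\<bar>) * (x 1 + x 2 + x 3))
        \<longlonglongrightarrow> (\<bar>0\<bar> + \<bar>0\<bar> + \<bar>0\<bar>) * (x 1 + x 2 + x 3)"
      by (intro tendsto_intros Coact_tendsto_zero[OF u c])
    ultimately have "\<bar>dot c x\<bar> \<le> (\<bar>0\<bar> + \<bar>0\<bar> + \<bar>0\<bar>) * (x 1 + x 2 + x 3)"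
      by (intro LIMSEQ_le_const[where X = "\<lambda>n. (\<bar>Coact a n c 1\<bar> + \<bar>Coact a n c 2\<bar> + \<bar>Coact a n c 3\<bar>) * (x 1 + x 2 + x 3)"]) auto
    then show ?thesis by simp
  qed
  have up: "0 < u i" for i using direction_pos[OF u] .
  define k where "k = x 1 / u 1"
  have "x i = k * u i" for i
  proof (cases "i = 1")
    case True
    then show ?thesis using up[of 1] by (simp add: k_def)
  next
    case False
    then obtain q where pq: "i \<noteq> q" "q \<noteq> 1" using other_letter by blast
    define c where "c = (\<lambda>j. if j = 1 then u i else if j = i then - u 1 else 0)"
    have "dot c u = 0" "dot c x = u i * x 1 - u 1 * x i"
      using pq False by (auto simp: dot_eq[OF pq(1) False pq(2)] c_def)
    then show ?thesis using ortho[of c] up[of 1] by (simp add: k_def field_simps)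
  qed
  moreover have "0 \<le> x 1" using x[of 0] by auto
  then have "0 \<le> k" using up[of 1] by (simp add: k_def)
  ultimately show ?thesis by blast
qed

end

section \<open>The nested cones of the incidence matrices\<close>

lemma incidence_matrix_AR: "incidence_matrix (AR s) *v x = (\<chi> i. act s (($) x) i)"
proof -
  have "(1::letter) \<noteq> 2" "(1::letter) \<noteq> 3" "(2::letter) \<noteq> 3" by simp_all
  then have "(incidence_matrix (AR s) *v x) $ i = act s (($) x) i" for i
    using exhaust_3[of s] exhaust_3[of i]
    by (elim disjE) (simp_all add: incidence_matrix_def AR_def act_def matrix_vector_mult_def sum_3)
  then show ?thesis by (simp add: vec_eq_iff)
qed

lemma matrix_prod_AR: "matrix_prod (\<lambda>i. AR (a i)) n *v x = (\<chi> i. Act a n (($) x) i)"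
proof (induction n arbitrary: x)
  case (Suc n)
  have "matrix_prod (\<lambda>i. AR (a i)) (Suc n) *v x =
      matrix_prod (\<lambda>i. AR (a i)) n *v (incidence_matrix (AR (a n)) *v x)"
    by (simp add: matrix_vector_mul_assoc)
  then show ?case by (simp add: incidence_matrix_AR Suc)
qed simp

context ar_sequence
begin

definition "icone n = (\<lambda>x. matrix_prod (\<lambda>i. AR (a i)) n *v x) ` nonneg_cone"

lemma in_cone_iff: "x \<in> icone n \<longleftrightarrow> (\<exists>y. (\<forall>i. 0 \<le> y i) \<and> Act a n y = ($) x)"
proof
  assume "x \<in> icone n"
  then obtain y where "y \<in> nonneg_cone" "x = (\<chi> i. Act a n (($) y) i)"
    by (auto simp: icone_def matrix_prod_AR)
  then show "\<exists>y. (\<forall>i. 0 \<le> y i) \<and> Act a n y = ($) x"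
    by (intro exI[of _ "($) y"]) (auto simp: nonneg_cone_def)
next
  assume "\<exists>y. (\<forall>i. 0 \<le> y i) \<and> Act a n y = ($) x"
  then obtain y where y: "\<And>i. 0 \<le> y i" "Act a n y = ($) x" by blast
  have "($) (\<chi> i. y i) = y" by auto
  then have "x = matrix_prod (\<lambda>i. AR (a i)) n *v (\<chi> i. y i)"
    using y(2) by (simp add: matrix_prod_AR vec_eq_iff)
  moreover have "(\<chi> i. y i) \<in> nonneg_cone" using y(1) by (simp add: nonneg_cone_def)
  ultimately show "x \<in> icone n" by (auto simp: icone_def)
qed

lemma closed_nonneg_cone: "closed nonneg_cone"
proof -
  have "nonneg_cone = (\<Inter>i. {x::real^3. 0 \<le> x $ i})" by (auto simp: nonneg_cone_def)
  also have "closed \<dots>" by (intro closed_INT ballI closed_Collect_le continuous_intros)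
  finally show ?thesis .
qed

lemma closed_cone: "closed (icone n)"
  unfolding icone_def
proof (rule closed_injective_linear_image[OF closed_nonneg_cone])
  show "linear (\<lambda>x. matrix_prod (\<lambda>i. AR (a i)) n *v x)" by (rule matrix_vector_mul_linear)
  show "inj (\<lambda>x. matrix_prod (\<lambda>i. AR (a i)) n *v x)"
  proof (rule injI)
    fix x y assume "matrix_prod (\<lambda>i. AR (a i)) n *v x = matrix_prod (\<lambda>i. AR (a i)) n *v y"
    then have "Act a n (($) x) = Act a n (($) y)" by (simp add: matrix_prod_AR vec_eq_iff fun_eq_iff)
    then show "x = y" using Act_inj by (metis vec_eq_iff)
  qed
qed

lemma cone_antimono: "m \<le> n \<Longrightarrow> icone n \<subseteq> icone m"
proof
  fix x assume "m \<le> n" "x \<in> icone n"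
  then obtain y where y: "\<And>i. 0 \<le> y i" "Act a n y = ($) x" by (auto simp: in_cone_iff)
  then have "Act a m (Act (sh m a) (n - m) y) = ($) x" using \<open>m \<le> n\<close> by (simp flip: Act_add)
  moreover have "0 \<le> Act (sh m a) (n - m) y i" for i by (rule Act_nonneg[OF y(1)])
  ultimately show "x \<in> icone m" unfolding in_cone_iff by (intro exI[of _ "Act (sh m a) (n - m) y"]) simp
qed

text \<open>The normalised cones are nested nonempty compact sets. A common point has positive
  coordinates at level \<open>n\<close> because its coordinates at a level \<open>l\<close>, a full
  block later, are nonnegative and not all 0.\<close>

lemma direction_exists: "\<exists>u. direction a u \<and> u 1 + u 2 + u 3 = 1"
proof -
  define K where "K n = icone n \<inter> {x. x $ 1 + x $ 2 + x $ 3 = 1}" for n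
  have K1: "K n \<noteq> {}" for n
  proof -
    define y where "y = Act a n (\<lambda>i. real_of_int (unitv 1 i))"
    have y0: "0 \<le> y i" for i unfolding y_def by (intro Act_nonneg) (simp add: unitv_def)
    have "1 \<le> y 1" using Act_ge[of "\<lambda>i. real_of_int (unitv 1 i)" 1 a n] by (simp add: y_def unitv_def)
    define t where "t = y 1 + y 2 + y 3"
    have t: "0 < t" using \<open>1 \<le> y 1\<close> y0[of 2] y0[of 3] by (simp add: t_def)
    have "(\<chi> i. y i / t) \<in> K n"
    proof -
      have "(\<chi> i. y i / t) \<in> icone n"
        unfolding in_cone_iff
      proof (intro exI conjI allI)
        show "0 \<le> (1 / t) * real_of_int (unitv 1 i)" for i using t by (simp add: unitv_def)
        show "Act a n (\<lambda>i. (1 / t) * real_of_int (unitv 1 i)) = ($) (\<chi> i. y i / t)"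
          by (simp only: Act_scale) (auto simp: y_def)
      qed
      then show ?thesis using t by (simp add: K_def t_def flip: add_divide_distrib)
    qed
    then show ?thesis by blast
  qed
  have K2: "compact (K n)" for n
  proof (rule compact_Int_closed[of "K n" "K n", simplified] | rule compact_eq_bounded_closed[THEN iffD2], intro conjI)
    have "K n \<subseteq> icone 0 \<inter> {x. x $ 1 + x $ 2 + x $ 3 = 1}" using cone_antimono[of 0 n] by (auto simp: K_def)
    also have "\<dots> \<subseteq> cbox 0 1"
    proof
      fix x assume x: "x \<in> icone 0 \<inter> {x. x $ 1 + x $ 2 + x $ 3 = 1}"
      then have x0: "0 \<le> x $ i" for i by (auto simp: in_cone_iff)
      have "x $ 1 + x $ 2 + x $ 3 = 1" using x by simp
      then have "x $ 1 \<le> 1 \<and> x $ 2 \<le> 1 \<and> x $ 3 \<le> 1" using x0[of 1] x0[of 2] x0[of 3] by linarith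
      then have "x $ i \<le> 1" for i using exhaust_3[of i] by auto
      then show "x \<in> cbox 0 1" using x0 by (simp add: mem_box_cart)
    qed
    finally show "bounded (K n)" using bounded_cbox bounded_subset by blast
    show "closed (K n)" unfolding K_def
      by (intro closed_Int closed_cone closed_Collect_eq continuous_intros)
  qed
  have K3: "K n \<subseteq> K m" if "m \<le> n" for m n using cone_antimono[OF that] by (auto simp: K_def)
  have "\<Inter> (range K) \<noteq> {}" using K1 K2 K3 by (intro compact_nest)
  then obtain x where x: "\<And>n. x \<in> K n" by blast
  have "\<exists>y. (\<forall>i. 0 < y i) \<and> Act a n y = ($) x" for n
  proof -
    obtain l where l: "full a n l" using full_exists rec by blast
    then have nl: "n < l" unfolding full_def using order_le_less_trans by blast
    obtain z where z: "\<And>i. 0 \<le> z i" "Act a l z = ($) x" using x[of l] by (auto simp: K_def in_cone_iff)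
    define y where "y = Act (sh n a) (l - n) z"
    have "Act a n y = ($) x" using z(2) nl Act_add[of a n "l - n" z] by (simp add: y_def)
    moreover have "z \<noteq> (\<lambda>i. 0)"
    proof
      assume "z = (\<lambda>i. 0)"
      then have "($) x = (\<lambda>i. 0)" using z(2) by simp
      then show False using x[of 0] by (simp add: K_def)
    qed
    then have "0 < y i" for i
    proof -
      obtain k where "n \<le> k" "k < l" "a k = i" using l unfolding full_def by blast
      then show ?thesis unfolding y_def using z(1) \<open>z \<noteq> _\<close>
        by (intro Act_pos[of z "k - n"]) (auto simp: sh_def)
    qed
    ultimately show ?thesis by blast
  qed
  then have "direction a (($) x)" by (simp add: direction_def)
  moreover have "x $ 1 + x $ 2 + x $ 3 = 1" using x[of 0] by (simp add: K_def)
  ultimately show ?thesis by blast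
qed

lemma right_eigenvector_direction:
  assumes u: "direction a u"
  shows "right_eigenvector (\<lambda>i. AR (a i)) (\<chi> i. u i)"
proof -
  have "(\<Inter>n. icone n) = {c *\<^sub>R (\<chi> i. u i) |c. 0 \<le> c}"
  proof
    show "(\<Inter>n. icone n) \<subseteq> {c *\<^sub>R (\<chi> i. u i) |c. 0 \<le> c}"
    proof
      fix x assume "x \<in> (\<Inter>n. icone n)"
      then have "\<And>n. \<exists>y. (\<forall>i. 0 \<le> y i) \<and> Act a n y = ($) x" by (simp add: in_cone_iff)
      then obtain k where "0 \<le> k" "($) x = (\<lambda>i. k * u i)" using direction_unique[OF u] by blast
      then show "x \<in> {c *\<^sub>R (\<chi> i. u i) |c. 0 \<le> c}" by (auto simp: vec_eq_iff)
    qed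
    show "{c *\<^sub>R (\<chi> i. u i) |c. 0 \<le> c} \<subseteq> (\<Inter>n. icone n)"
    proof clarify
      fix c :: real and n :: nat assume c: "0 \<le> c"
      obtain y where y: "\<And>i. 0 < y i" "Act a n y = u" using u unfolding direction_def by blast
      show "c *\<^sub>R (\<chi> i. u i) \<in> icone n"
        unfolding in_cone_iff using c y
        by (intro exI[of _ "\<lambda>i. c * y i"]) (auto simp: Act_scale less_imp_le)
    qed
  qed
  then show ?thesis using direction_pos[OF u] by (simp add: right_eigenvector_def icone_def)
qed

text \<open>\<open>limit_direction\<close> is picked by \<open>SOME\<close>, but equality of the
  rays makes it a nonzero multiple of \<open>u\<close>, and the projection ignores the
  factor.\<close>

lemma proj_along_limit_direction:
  assumes u: "direction a u" "u 1 + u 2 + u 3 = 1"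
  shows "proj_along (limit_direction (\<lambda>i. AR (a i))) x =
     (\<chi> i. x $ i - (x $ 1 + x $ 2 + x $ 3) * u i)"
proof -
  let ?v = "limit_direction (\<lambda>i. AR (a i))"
  have v: "right_eigenvector (\<lambda>i. AR (a i)) ?v"
    unfolding limit_direction_def by (rule someI[of "right_eigenvector (\<lambda>i. AR (a i))", OF right_eigenvector_direction[OF u(1)]])
  have "{c *\<^sub>R ?v |c. 0 \<le> c} = {c *\<^sub>R (\<chi> i. u i) |c. 0 \<le> c}"
    using v right_eigenvector_direction[OF u(1)] by (simp add: right_eigenvector_def)
  then have "1 *\<^sub>R ?v \<in> {c *\<^sub>R (\<chi> i. u i) |c. 0 \<le> c}" by (metis (mono_tags, lifting) mem_Collect_eq zero_le_one)
  then obtain c where c: "?v = c *\<^sub>R (\<chi> i. u i)" by auto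
  have "0 < ?v $ 1" using v by (simp add: right_eigenvector_def)
  then have "c \<noteq> 0" using c by auto
  have dot1: "y \<bullet> 1 = y $ 1 + y $ 2 + y $ 3" for y :: "real^3"
    by (simp add: inner_vec_def sum_3)
  have "?v \<bullet> 1 = c" using u(2) by (simp add: dot1 c flip: distrib_left)
  then show ?thesis using \<open>c \<noteq> 0\<close> by (simp add: proj_along_def dot1 vec_eq_iff c)
qed

end

section \<open>The tiles\<close>

definition vdot :: "(letter \<Rightarrow> real^2) \<Rightarrow> (letter \<Rightarrow> real) \<Rightarrow> real^2" where
  "vdot T x = x 1 *\<^sub>R T 1 + x 2 *\<^sub>R T 2 + x 3 *\<^sub>R T 3"

lemma vdot_eq:
  assumes "a \<noteq> b" "a \<noteq> s" "b \<noteq> s"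
  shows "vdot T x = x s *\<^sub>R T s + x a *\<^sub>R T a + x b *\<^sub>R T b"
  unfolding vdot_def using sum_letters[OF assms, of "\<lambda>i. x i *\<^sub>R T i"] .

lemma vdot_act: "vdot T (act s x) = vdot (coact s T) x"
proof -
  obtain p q where "p \<noteq> q" "p \<noteq> s" "q \<noteq> s" using other_letters by blast
  then show ?thesis by (simp add: vdot_eq act_eq algebra_simps)
qed

lemma vdot_Act: "vdot T (Act a n x) = vdot (Coact a n T) x"
  by (induction n arbitrary: x) (simp_all add: vdot_act)

lemma vdot_add: "vdot T (\<lambda>i. x i + y i) = vdot T x + vdot T y"
  by (simp add: vdot_def algebra_simps)

lemma vdot_diff: "vdot T (\<lambda>i. x i - y i) = vdot T x - vdot T y"
  by (simp add: vdot_def algebra_simps)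

lemma vdot_scale: "vdot T (\<lambda>i. k * x i) = k *\<^sub>R vdot T x"
  by (simp add: vdot_def scaleR_add_right)

lemma vdot_unitv [simp]: "vdot T (\<lambda>i. real_of_int (unitv j i)) = T j"
proof -
  obtain p q where pq: "p \<noteq> q" "p \<noteq> j" "q \<noteq> j" using other_letters by blast
  then show ?thesis by (simp add: vdot_eq[OF pq] unitv_def)
qed

lemma val_vdot: "val T w = vdot T (\<lambda>i. real_of_int (cnt w i))"
  by (induction w) (simp_all add: cnt_Cons vdot_add, simp add: vdot_def)

lemma norm_vdot_le: "norm (vdot T x) \<le> \<bar>x 1\<bar> * norm (T 1) + \<bar>x 2\<bar> * norm (T 2) + \<bar>x 3\<bar> * norm (T 3)"
  unfolding vdot_def by (intro order_trans[OF norm_triangle_ineq] add_mono) simp_all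

lemma inner_Coact: "Coact a n (\<lambda>j. v \<bullet> T j) j = v \<bullet> (Coact a n T j :: real^2)"
  by (induction n arbitrary: j) (auto simp: coact_def inner_add_right)

lemma nth_Coact: "Coact a n (\<lambda>j. T j $ i) j = (Coact a n T j :: real^2) $ i"
  by (induction n arbitrary: j) (auto simp: coact_def)

lemma inner_val: "v \<bullet> val T w = val (\<lambda>j. v \<bullet> (T j :: real^2)) w"
  by (induction w) (auto simp: inner_add_right)

lemma nth_val: "val T w $ i = val (\<lambda>j. (T j :: real^2) $ i) w"
  by (induction w) auto

lemma inner_vdot: "v \<bullet> vdot T x = dot (\<lambda>j. v \<bullet> T j) x"
  by (simp add: vdot_def dot_def inner_add_right mult.commute)

lemma spread_le: "spread c \<le> 2 * (\<bar>c 1\<bar> + \<bar>c 2\<bar> + \<bar>c 3\<bar>)"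
proof -
  have "(2::letter) \<noteq> 3" "(2::letter) \<noteq> 1" "(3::letter) \<noteq> 1" by simp_all
  note eq = spread_eq[OF this, of c]
  define S where "S = \<bar>c 1\<bar> + \<bar>c 2\<bar> + \<bar>c 3\<bar>"
  have "c 1 \<le> S" "c 2 \<le> S" "c 3 \<le> S" "- S \<le> c 1" "- S \<le> c 2" "- S \<le> c 3"
    unfolding S_def by linarith+
  then have "max (c 1) (max (c 2) (c 3)) \<le> S" "- S \<le> min (c 1) (min (c 2) (c 3))" by simp_all
  from diff_mono[OF this] have "spread c \<le> S - (- S)" unfolding eq .
  also have "S - (- S) = 2 * (\<bar>c 1\<bar> + \<bar>c 2\<bar> + \<bar>c 3\<bar>)" unfolding S_def by simp
  finally show ?thesis .
qed

text \<open>The prefix-letter pairs behind the tiles, with finite words in place of limit words;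
  \<open>limit_word_iff_PL\<close> identifies the two. The finite form composes directly with
  substitutions and shifts.\<close>

definition PL :: "(nat \<Rightarrow> letter) \<Rightarrow> word \<Rightarrow> letter \<Rightarrow> bool" where
  "PL b r j \<longleftrightarrow> (\<exists>n i. prefix (r @ [j]) (wd b n [i]))"

lemma prefix_wd_add: "prefix (wd b n [i]) (wd b (n + k) [i])"
proof (induction k)
  case (Suc k)
  then show ?case by (simp only: add_Suc_right wd_Suc_letter) (meson prefix_def prefix_prefix)
qed simp

lemma prefix_wd_mono: "prefix v w \<Longrightarrow> prefix (wd b n v) (wd b n w)"
  by (auto simp: prefix_def)

text \<open>Desubstitution: the marked letter \<open>i\<close> lies in the block of one letter
  \<open>j\<close> of \<open>W\<close>, and keeping it attached makes \<open>P\<close> a proper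
  prefix of this block.\<close>

lemma prefix_wd_split:
  "prefix (r @ [i]) (wd b l W) \<Longrightarrow>
    \<exists>V j P. prefix (V @ [j]) W \<and> prefix (P @ [i]) (wd b l [j]) \<and> r = wd b l V @ P"
proof (induction W arbitrary: r)
  case (Cons x W)
  consider "prefix (r @ [i]) (wd b l [x])" |
    z where "r @ [i] = wd b l [x] @ z" "prefix z (wd b l W)" "z \<noteq> []"
    using Cons.prems by (metis wd_Cons prefix_append append_Nil2 prefix_order.order_refl)
  then show ?case
  proof cases
    case 1
    then show ?thesis by (intro exI[of _ "[]"] exI[of _ x] exI[of _ r]) simp
  next
    case 2
    then obtain r' where r': "z = r' @ [i]" "r = wd b l [x] @ r'"
      by (metis append_assoc append_butlast_last_id last_appendR last_snoc butlast_append butlast_snoc)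
    then obtain V j P where "prefix (V @ [j]) W" "prefix (P @ [i]) (wd b l [j])" "r' = wd b l V @ P"
      using Cons.IH 2(2) by blast
    then show ?thesis using r'(2) wd_Cons[of b l x V]
      by (intro exI[of _ "x # V"] exI[of _ j] exI[of _ P]) simp
  qed
qed simp

lemma PL_lift:
  assumes "PL (sh m b) r j" "prefix (P @ [i]) (wd b m [j])"
  shows "PL b (wd b m r @ P) i"
proof -
  obtain n i0 where n: "prefix (r @ [j]) (wd (sh m b) n [i0])" using assms(1) by (auto simp: PL_def)
  then have "prefix (wd b m r @ wd b m [j]) (wd b (m + n) [i0])"
    using prefix_wd_mono[OF n, of b m] by (simp add: wd_add)
  moreover have "prefix ((wd b m r @ P) @ [i]) (wd b m r @ wd b m [j])" using assms(2) by simp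
  ultimately show ?thesis unfolding PL_def by (meson prefix_order.order_trans)
qed

lemma PL_split:
  assumes "PL b r i"
  shows "\<exists>V j P. PL (sh m b) V j \<and> prefix (P @ [i]) (wd b m [j]) \<and> r = wd b m V @ P"
proof -
  obtain n i0 where n: "prefix (r @ [i]) (wd b n [i0])" using assms by (auto simp: PL_def)
  have "prefix (wd b n [i0]) (wd b m (wd (sh m b) n [i0]))"
    using prefix_wd_add[of b n i0 m] by (simp add: wd_add[symmetric] add.commute)
  then have "prefix (r @ [i]) (wd b m (wd (sh m b) n [i0]))" using n by (meson prefix_order.order_trans)
  from prefix_wd_split[OF this] show ?thesis unfolding PL_def by blast
qed

lemma letter_in_wd:
  assumes "k < n" "b k = i"
  shows "i \<in> set (wd b n [j])"
  using assms(1)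
proof (induction n)
  case (Suc n)
  show ?case
  proof (cases "k = n")
    case True
    obtain p where "wd b (Suc n) [j] = p @ wd b n [i]" using wd_Suc_last[of b n j] True assms(2) by auto
    then show ?thesis using wd_letter_hd[of b n i] by auto
  next
    case False
    then show ?thesis using Suc unfolding wd_Suc_letter by auto
  qed
qed simp

lemma int_vectors_add: "x \<in> int_vectors \<Longrightarrow> y \<in> int_vectors \<Longrightarrow> x + y \<in> int_vectors"
  by (auto simp: int_vectors_def)

lemma int_vectors_diff: "x \<in> int_vectors \<Longrightarrow> y \<in> int_vectors \<Longrightarrow> x - y \<in> int_vectors"
  by (auto simp: int_vectors_def)

lemma int_vectors_zero [simp]: "0 \<in> int_vectors"
  by (auto simp: int_vectors_def)

lemma int_vectors_uminus: "x \<in> int_vectors \<Longrightarrow> - x \<in> int_vectors"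
  by (auto simp: int_vectors_def)

lemma closed_int_vectors: "closed (int_vectors :: (real^'n) set)"
proof -
  have "int_vectors = (\<Inter>i. {x::real^'n. x $ i \<in> \<int>})" by (auto simp: int_vectors_def)
  also have "closed \<dots>"
    by (intro closed_INT ballI)
       (simp add: closed_vimage[OF closed_Ints, of "\<lambda>x. x $ i" for i, unfolded vimage_def] continuous_intros)
  finally show ?thesis .
qed

lemma countable_int_vectors: "countable (int_vectors :: (real^2) set)"
proof -
  have "int_vectors \<subseteq> range (\<lambda>(p::int, q::int). (vector [real_of_int p, real_of_int q] :: real^2))"
  proof
    fix x :: "real^2" assume "x \<in> int_vectors"
    then obtain p q where "x $ 1 = real_of_int p" "x $ 2 = real_of_int q"
      unfolding int_vectors_def by (metis Ints_cases mem_Collect_eq)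
    then have "x = vector [real_of_int p, real_of_int q]" by (simp add: vec_eq_iff forall_2)
    then show "x \<in> range (\<lambda>(p::int, q::int). (vector [real_of_int p, real_of_int q] :: real^2))" by auto
  qed
  then show ?thesis by (rule countable_subset) simp
qed

context ar_sequence
begin

lemma length_wd_unbounded: "\<exists>n. N < length (wd a n [j])"
proof (induction N)
  case 0
  then show ?case using wd_nonempty[of "[j]" a 0] by (metis length_greater_0_conv list.distinct(1))
next
  case (Suc N)
  then obtain n where n: "N < length (wd a n [j])" by blast
  obtain i :: letter where i: "i \<noteq> j" using other_letters[of j] by blast
  obtain k where k: "n \<le> k" "a k = i" using rec by blast
  have "length (wd a n [j]) \<le> length (wd a k [j])"
    using prefix_length_le[OF prefix_wd_add[of a n j "k - n"]] k by simp
  moreover have "length (wd a (Suc k) [j]) > length (wd a k [j])"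
    using k i wd_letter_hd[of a k i] unfolding wd_Suc_letter by auto
  ultimately show ?case using n by (intro exI[of _ "Suc k"]) linarith
qed

end

section \<open>Tiles, subdivision and covering\<close>

locale ar_direction = ar_sequence +
  fixes u :: "letter \<Rightarrow> real"
  assumes dir: "direction a u" and norm_u: "u 1 + u 2 + u 3 = 1"
begin

text \<open>The plane is parametrised by the first two coordinates, so that its integer vectors
  become those of \<open>real^2\<close>. As \<open>u\<close> has sum 1, projecting a unit vector
  subtracts \<open>u\<close>.\<close>

definition tau :: "letter \<Rightarrow> real^2" where
  "tau j = vector [of_bool (j = 1) - u 1, of_bool (j = 2) - u 2]"

text \<open>\<open>lev m j\<close> is the displacement along the whole word of level
  \<open>m\<close> over \<open>j\<close>.\<close>

definition "lev m = Coact a m tau"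

lemma vdot_tau: "vdot tau x = vector [x 1 - (x 1 + x 2 + x 3) * u 1, x 2 - (x 1 + x 2 + x 3) * u 2]"
  by (simp add: vec_eq_iff forall_2 vdot_def tau_def algebra_simps)

lemma vdot_tau_u: "vdot tau u = 0"
  by (simp add: vdot_tau norm_u vec_eq_iff forall_2)

lemma val_wd_lev: "val tau (wd a m w) = val (lev m) w"
  by (simp add: val_wd lev_def)

lemma vdot_lev: "vdot (lev m) x = vdot tau (Act a m x)"
  by (simp add: lev_def vdot_Act)

text \<open>A functional on letters that kills the direction factors through the plane. This turns
  the scalar bounds for words into bounds for inner products on the tiles of level
  \<open>m\<close>.\<close>

lemma dual_vector:
  assumes y: "Act a m y = u" and c: "dot c y = 0"
  shows "\<exists>v. \<forall>j. c j = v \<bullet> lev m j"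
proof -
  obtain c0 where c0: "Coact a m c0 = c" using Coact_surj by blast
  have u3: "u 3 = 1 - u 1 - u 2" using norm_u by simp
  have "dot c0 u = 0" using dot_Act[of c0 a m y] y c c0 by simp
  then have z: "c0 1 * u 1 + c0 2 * u 2 + c0 3 * (1 - u 1 - u 2) = 0"
    unfolding dot_def u3 .
  define v :: "real^2" where "v = vector [c0 1 - c0 3, c0 2 - c0 3]"
  have "c0 j = v \<bullet> tau j" for j
    using exhaust_3[of j] z by (auto simp: v_def tau_def inner_vec_def sum_2 algebra_simps)
  then have "c0 = (\<lambda>j. v \<bullet> tau j)" by blast
  then have "c j = v \<bullet> lev m j" for j using c0 inner_Coact[of a m v tau j] by (simp add: lev_def)
  then show ?thesis by blast
qed

lemma val_le:
  assumes "PL (sh m a) r j" "Act a m y = u" "direction (sh m a) y" "dot c y = 0"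
  shows "\<bar>val c r\<bar> \<le> bnd * spread c"
proof -
  interpret s: ar_sequence "sh m a" h by (rule ar_sequence_sh)
  obtain n i where "prefix (r @ [j]) (wd (sh m a) n [i])" using assms(1) by (auto simp: PL_def)
  then have "prefix r (wd (sh m a) n [i])" by (metis append_prefixD)
  from s.prefix_val_le[OF assms(3,4) this] show ?thesis .
qed

text \<open>
  The tile of level \<open>m\<close>, already contracted into the coordinates of level \<open>0\<close>.
\<close>

definition "Q m j = closure {val (lev m) r | r. PL (sh m a) r j}"

lemma val_lev_norm_le:
  assumes "PL (sh m a) r j"
  shows "norm (val (lev m) r) \<le> 4 * bnd * (\<Sum>i\<in>UNIV. \<bar>lev m 1 $ i\<bar> + \<bar>lev m 2 $ i\<bar> + \<bar>lev m 3 $ i\<bar>)"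
proof -
  obtain y where y: "Act a m y = u" "direction (sh m a) y" using direction_shift[OF dir] by blast
  have "\<bar>val (lev m) r $ i\<bar> \<le> bnd * (2 * (\<bar>lev m 1 $ i\<bar> + \<bar>lev m 2 $ i\<bar> + \<bar>lev m 3 $ i\<bar>))" for i
  proof -
    have "vdot (lev m) y = 0" using y(1) by (simp add: vdot_lev vdot_tau_u)
    then have "vdot (lev m) y $ i = 0" by simp
    then have "dot (\<lambda>j. lev m j $ i) y = 0" by (simp add: vdot_def dot_def mult.commute)
    from val_le[OF assms y this] have "\<bar>val (lev m) r $ i\<bar> \<le> bnd * spread (\<lambda>j. lev m j $ i)"
      by (simp add: nth_val)
    also have "\<dots> \<le> bnd * (2 * (\<bar>lev m 1 $ i\<bar> + \<bar>lev m 2 $ i\<bar> + \<bar>lev m 3 $ i\<bar>))"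
      using bnd_pos spread_le[of "\<lambda>j. lev m j $ i"] by (intro mult_left_mono) auto
    finally show ?thesis .
  qed
  then have "norm (val (lev m) r) \<le> (\<Sum>i\<in>UNIV. bnd * (2 * (\<bar>lev m 1 $ i\<bar> + \<bar>lev m 2 $ i\<bar> + \<bar>lev m 3 $ i\<bar>)))"
    by (intro order_trans[OF norm_le_l1_cart] sum_mono)
  also have "\<dots> = 2 * bnd * (\<Sum>i\<in>UNIV. \<bar>lev m 1 $ i\<bar> + \<bar>lev m 2 $ i\<bar> + \<bar>lev m 3 $ i\<bar>)"
    by (simp add: sum_distrib_left algebra_simps)
  also have "\<dots> \<le> 4 * bnd * (\<Sum>i\<in>UNIV. \<bar>lev m 1 $ i\<bar> + \<bar>lev m 2 $ i\<bar> + \<bar>lev m 3 $ i\<bar>)"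
    using bnd_pos by (intro mult_right_mono sum_nonneg) auto
  finally show ?thesis .
qed

lemma lev_tendsto_zero: "(\<lambda>m. lev m j $ i) \<longlonglongrightarrow> 0"
proof -
  have "vdot tau u $ i = 0" by (simp add: vdot_tau_u)
  then have "dot (\<lambda>j. tau j $ i) u = 0" by (simp add: vdot_def dot_def mult.commute)
  from Coact_tendsto_zero[OF dir this, of j] show ?thesis by (simp add: lev_def nth_Coact)
qed

lemma Q_small:
  assumes "0 < \<epsilon>"
  obtains M where "\<And>m j. M \<le> m \<Longrightarrow> Q m j \<subseteq> cball 0 \<epsilon>" "\<And>m j. M \<le> m \<Longrightarrow> norm (lev m j) \<le> \<epsilon>"
proof -
  let ?s = "\<lambda>m. \<Sum>i\<in>UNIV. \<bar>lev m 1 $ i\<bar> + \<bar>lev m 2 $ i\<bar> + \<bar>lev m 3 $ i\<bar>"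
  have "(\<lambda>m. (4 * bnd + 1) * ?s m) \<longlonglongrightarrow> (4 * bnd + 1) * (\<Sum>i\<in>(UNIV::2 set). \<bar>0\<bar> + \<bar>0\<bar> + \<bar>0\<bar>)"
    by (intro tendsto_intros lev_tendsto_zero)
  then have "(\<lambda>m. (4 * bnd + 1) * ?s m) \<longlonglongrightarrow> 0" by simp
  then have "eventually (\<lambda>m. (4 * bnd + 1) * ?s m < \<epsilon>) sequentially" using assms by (rule order_tendstoD)
  then obtain M where M: "\<And>m. M \<le> m \<Longrightarrow> (4 * bnd + 1) * ?s m < \<epsilon>"
    unfolding eventually_sequentially by blast
  have s0: "0 \<le> ?s m" for m by (intro sum_nonneg) auto
  show ?thesis
  proof (rule that)
    fix m j assume "M \<le> m"
    note * = M[OF this]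
    have "4 * bnd * ?s m \<le> \<epsilon>" using * s0[of m] by (simp add: algebra_simps)
    then have "norm (val (lev m) r) \<le> \<epsilon>" if "PL (sh m a) r j" for r
      using val_lev_norm_le[OF that] by linarith
    then have "{val (lev m) r | r. PL (sh m a) r j} \<subseteq> cball 0 \<epsilon>" by auto
    then show "Q m j \<subseteq> cball 0 \<epsilon>" unfolding Q_def by (intro closure_minimal) auto
    have "norm (lev m j) \<le> (\<Sum>i\<in>UNIV. \<bar>lev m j $ i\<bar>)" by (rule norm_le_l1_cart)
    also have "\<dots> \<le> ?s m" using exhaust_3[of j] by (intro sum_mono) auto
    also have "\<dots> \<le> \<epsilon>" using * s0[of m] bnd_pos by (smt (verit) mult_le_cancel_right1 mult_less_cancel_right)
    finally show "norm (lev m j) \<le> \<epsilon>" .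
  qed
qed

lemma compact_Q: "compact (Q m j)"
proof -
  have "bounded {val (lev m) r | r. PL (sh m a) r j}"
    unfolding bounded_iff using val_lev_norm_le by blast
  then show ?thesis by (simp add: Q_def compact_closure)
qed

text \<open>Splitting prefix-letter pairs at level \<open>m + l\<close> gives the identity on
  generating points; it passes to closures because the union is finite.\<close>

lemma Q_eq:
  "Q m i = (\<Union>(j, P)\<in>{(j, P). prefix (P @ [i]) (wd (sh m a) l [j])}. (+) (val (lev m) P) ` Q (m + l) j)"
    (is "_ = \<Union>(?f ` ?E)")
proof
  have lev_add: "lev (m + l) = Coact (sh m a) l (lev m)" by (simp add: lev_def Coact_add)
  have val_wd': "val (lev m) (wd (sh m a) l V) = val (lev (m + l)) V" for V
    by (simp add: val_wd lev_add)
  have fin: "finite ?E"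
  proof -
    have "?E \<subseteq> (\<Union>j. {j} \<times> set (prefixes (wd (sh m a) l [j])))"
      by (auto dest: append_prefixD)
    then show ?thesis by (rule finite_subset) auto
  qed
  have "{val (lev m) r | r. PL (sh m a) r i} \<subseteq> \<Union>(?f ` ?E)"
  proof clarify
    fix r assume "PL (sh m a) r i"
    then obtain V j P where V: "PL (sh l (sh m a)) V j" "prefix (P @ [i]) (wd (sh m a) l [j])"
      "r = wd (sh m a) l V @ P"
      using PL_split by blast
    then have "val (lev (m + l)) V \<in> Q (m + l) j"
      unfolding Q_def sh_sh by (intro subsetD[OF closure_subset]) auto
    moreover have "val (lev m) r = val (lev m) P + val (lev (m + l)) V" by (simp add: V(3) val_wd')
    ultimately show "val (lev m) r \<in> \<Union>(?f ` ?E)" using V(2) by auto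
  qed
  moreover have "closed (\<Union>(?f ` ?E))"
    using fin compact_Q by (intro closed_UN) (auto intro!: compact_imp_closed compact_translation)
  ultimately show "Q m i \<subseteq> \<Union>(?f ` ?E)" unfolding Q_def[of m i] by (rule closure_minimal)
  show "\<Union>(?f ` ?E) \<subseteq> Q m i"
  proof clarify
    fix j P x assume P: "prefix (P @ [i]) (wd (sh m a) l [j])" and x: "x \<in> Q (m + l) j"
    have "(+) (val (lev m) P) ` {val (lev (m + l)) r | r. PL (sh (m + l) a) r j}
        \<subseteq> {val (lev m) r | r. PL (sh m a) r i}"
    proof clarify
      fix r assume "PL (sh (m + l) a) r j"
      then have "PL (sh m a) (wd (sh m a) l r @ P) i" using PL_lift[of l "sh m a" r j P i] P by (simp add: sh_sh)
      moreover have "val (lev m) P + val (lev (m + l)) r = val (lev m) (wd (sh m a) l r @ P)"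
        by (simp add: val_wd')
      ultimately show "\<exists>s. val (lev m) P + val (lev (m + l)) r = val (lev m) s \<and> PL (sh m a) s i" by blast
    qed
    then have "(+) (val (lev m) P) ` Q (m + l) j \<subseteq> Q m i"
      unfolding Q_def closure_translation[symmetric] by (rule closure_mono)
    then show "val (lev m) P + x \<in> Q m i" using x by blast
  qed
qed

lemma Q_0_eq: "Q 0 i = (\<Union>(j, P)\<in>{(j, P). prefix (P @ [i]) (wd a m [j])}. (+) (val tau P) ` Q m j)"
  using Q_eq[of 0 i m] by (simp add: lev_def)

text \<open>All \<open>tau j\<close> agree modulo integer vectors, so modulo the lattice only the
  length of a word matters.\<close>

lemma val_tau_lattice:
  assumes "length v = length w"
  shows "val tau v - val tau w \<in> int_vectors"
proof -
  have "int (length v) = int (length w)" using assms by simp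
  then have "cnt v 1 + cnt v 2 + cnt v 3 = cnt w 1 + cnt w 2 + cnt w 3" by (simp add: length_cnt dot_def)
  then have "real_of_int (cnt v 1) + real_of_int (cnt v 2) + real_of_int (cnt v 3) =
      real_of_int (cnt w 1) + real_of_int (cnt w 2) + real_of_int (cnt w 3)"
    by (metis of_int_add)
  then show ?thesis by (simp add: val_vdot vdot_tau int_vectors_def forall_2)
qed

lemma word_exists: "(\<And>i. 0 \<le> x i) \<Longrightarrow> \<exists>w. cnt w = x"
proof -
  assume x: "\<And>i. 0 \<le> x i"
  have rep: "cnt (replicate n j) i = (if i = j then int n else 0)" for n j i
    by (induction n) (auto simp: cnt_def)
  have d: "(1::letter) \<noteq> 2" "(1::letter) \<noteq> 3" "(2::letter) \<noteq> 3" by simp_all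
  define w where "w = replicate (nat (x 1)) 1 @ replicate (nat (x 2)) 2 @ replicate (nat (x 3)) (3::letter)"
  have "cnt w i = x i" for i
    using exhaust_3[of i] x d by (elim disjE) (simp_all add: w_def rep)
  then show ?thesis by blast
qed

text \<open>A real solution of \<open>vdot tau x = y\<close> is rewritten at a level with short
  steps, made nonnegative by adding a multiple of the direction, which projects to 0, and rounded
  down. Rounding costs at most one step for each letter.\<close>

lemma val_tau_dense: "0 < \<epsilon> \<Longrightarrow> \<exists>w. dist (val tau w) y < \<epsilon>"
proof -
  assume "0 < \<epsilon>"
  define x :: "letter \<Rightarrow> real" where "x j = (if j = 1 then y $ 1 else if j = 2 then y $ 2 else - y $ 1 - y $ 2)" for j
  have xy: "vdot tau x = y" by (simp add: vdot_tau x_def vec_eq_iff forall_2)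
  obtain m where m: "\<And>j. norm (lev m j) \<le> \<epsilon> / 4" using Q_small[of "\<epsilon> / 4"] \<open>0 < \<epsilon>\<close> by (metis order_refl divide_pos_pos zero_less_numeral)
  obtain x' where x': "Act a m x' = x" using Act_surj by blast
  obtain z where z: "\<And>i. 0 < z i" "Act a m z = u" using dir unfolding direction_def by blast
  define K where "K = (\<bar>x' 1\<bar> / z 1 + \<bar>x' 2\<bar> / z 2 + \<bar>x' 3\<bar> / z 3)"
  define x2 where "x2 i = x' i + K * z i" for i
  have x2: "0 \<le> x2 i" for i
  proof -
    have "\<bar>x' i\<bar> / z i \<le> K" using exhaust_3[of i] z(1)[of 1] z(1)[of 2] z(1)[of 3] by (auto simp: K_def less_imp_le)
    then have "\<bar>x' i\<bar> \<le> K * z i" using z(1)[of i] by (simp add: divide_le_eq)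
    then show ?thesis by (simp add: x2_def)
  qed
  have v: "vdot (lev m) x2 = y"
    unfolding x2_def vdot_add vdot_scale by (simp add: vdot_lev x' z xy vdot_tau_u)
  obtain w where w: "cnt w = (\<lambda>i. \<lfloor>x2 i\<rfloor>)" using word_exists[of "\<lambda>i. \<lfloor>x2 i\<rfloor>"] x2 by auto
  have e: "y - val (lev m) w = vdot (lev m) (\<lambda>i. x2 i - real_of_int \<lfloor>x2 i\<rfloor>)"
    by (simp add: vdot_diff v val_vdot w)
  have "norm (y - val (lev m) w) \<le> \<bar>x2 1 - real_of_int \<lfloor>x2 1\<rfloor>\<bar> * norm (lev m 1) +
     \<bar>x2 2 - real_of_int \<lfloor>x2 2\<rfloor>\<bar> * norm (lev m 2) + \<bar>x2 3 - real_of_int \<lfloor>x2 3\<rfloor>\<bar> * norm (lev m 3)"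
    unfolding e by (rule norm_vdot_le)
  also have "\<dots> \<le> 1 * (\<epsilon> / 4) + 1 * (\<epsilon> / 4) + 1 * (\<epsilon> / 4)"
  proof -
    have "\<bar>x2 i - real_of_int \<lfloor>x2 i\<rfloor>\<bar> \<le> 1" for i by linarith
    then show ?thesis by (intro add_mono mult_mono m) auto
  qed
  also have "\<dots> < \<epsilon>" using \<open>0 < \<epsilon>\<close> by simp
  finally have "dist (val tau (wd a m w)) y < \<epsilon>" by (simp add: val_wd_lev dist_norm norm_minus_commute)
  then show ?thesis by blast
qed

lemma PL_length: "\<exists>r j. PL a r j \<and> length r = n"
proof -
  obtain k where k: "n < length (wd a k [1])" using length_wd_unbounded by blast
  have "prefix (take n (wd a k [1]) @ [wd a k [1] ! n]) (wd a k [1])"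
    using take_is_prefix[of "Suc n" "wd a k [1]"] k by (simp add: take_Suc_conv_app_nth)
  then show ?thesis unfolding PL_def using k by (intro exI[of _ "take n (wd a k [1])"]) auto
qed

lemma Q_0_memI: "PL a r j \<Longrightarrow> val tau r \<in> Q 0 j"
  unfolding Q_def by (intro subsetD[OF closure_subset]) (auto simp: lev_def)

definition "R = (\<Union>j. Q 0 j)"

lemma compact_R: "compact R"
  unfolding R_def by (intro compact_UN) (auto simp: compact_Q)

text \<open>Every word has the length of some admissible prefix, so its projection lies in a lattice
  translate of \<open>R\<close>. These projections are dense, and the union of the translates is
  closed because \<open>R\<close> is compact.\<close>

lemma R_covers: "\<exists>l\<in>int_vectors. x - l \<in> R"
proof -
  let ?S = "\<Union>x\<in>R. \<Union>y\<in>int_vectors. {x + y}"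
  have cl: "closed ?S" by (rule compact_closed_sums[OF compact_R closed_int_vectors])
  have "x \<in> closure ?S"
    unfolding closure_approachable
  proof (intro allI impI)
    fix e :: real assume "0 < e"
    then obtain w where w: "dist (val tau w) x < e" using val_tau_dense by blast
    obtain r j where r: "PL a r j" "length r = length w" using PL_length by blast
    have "val tau r \<in> R" using Q_0_memI[OF r(1)] by (auto simp: R_def)
    moreover have "val tau w - val tau r \<in> int_vectors" using val_tau_lattice r(2) by simp
    moreover have "val tau w = val tau r + (val tau w - val tau r)" by simp
    ultimately have "val tau w \<in> ?S" by blast
    then show "\<exists>y\<in>?S. dist y x < e" using w by blast
  qed
  then have "x \<in> ?S" using cl by simp
  then show ?thesis by (auto intro!: bexI)
qed

text \<open>By covering and subdivision, countably many translates of the tiles of level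
  \<open>m\<close> fill the plane, so they cannot all be nowhere dense.\<close>

lemma interior_Q_exists: "\<exists>j. interior (Q m j) \<noteq> {}"
proof (rule ccontr)
  assume empty: "\<not> ?thesis"
  define F where "F = (\<lambda>(l, j, P). - ((+) (l + val tau P) ` Q m j))"
  define I where "I = (int_vectors :: (real^2) set) \<times> (UNIV :: letter set) \<times> (UNIV :: word set)"
  have "UNIV \<subseteq> closure (\<Inter>(F ` I))"
  proof (rule Baire)
    show "countable (F ` I)" unfolding I_def by (intro countable_image countable_SIGMA countable_int_vectors) auto
    fix T assume "T \<in> F ` I"
    then obtain l j P where T: "T = - ((+) (l + val tau P) ` Q m j)" by (auto simp: F_def)
    have "closed ((+) (l + val tau P) ` Q m j)"
      using compact_Q by (intro compact_imp_closed compact_translation)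
    moreover have "interior ((+) (l + val tau P) ` Q m j) = {}"
      using empty by (simp only: interior_translation) auto
    ultimately show "openin (top_of_set UNIV) T \<and> UNIV \<subseteq> closure T"
      by (simp add: T closure_complement open_Compl)
  qed simp
  then obtain x where x: "x \<in> \<Inter>(F ` I)" by (metis closure_empty empty_iff equals0I top.extremum_uniqueI UNIV_I)
  obtain l where l: "l \<in> int_vectors" "x - l \<in> R" using R_covers by blast
  then obtain i where "x - l \<in> Q 0 i" by (auto simp: R_def)
  then obtain j P q where "q \<in> Q m j" "x - l = val tau P + q" using Q_0_eq[of i m] by auto
  then have "x \<in> (+) (l + val tau P) ` Q m j" by (auto simp: algebra_simps intro!: image_eqI[of _ _ q])
  then have "x \<notin> F (l, j, P)" by (simp add: F_def)
  moreover have "(l, j, P) \<in> I" using l by (simp add: I_def)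
  ultimately show False using x by blast
qed

text \<open>The depth is chosen past a use of \<open>i\<close>; then \<open>i\<close> occurs in
  every word of that depth, and \<open>Q m i\<close> contains a translate of each tile
  there.\<close>

lemma interior_Q: "interior (Q m i) \<noteq> {}"
proof -
  obtain k where k: "m \<le> k" "a k = i" using rec by blast
  define l where "l = Suc (k - m)"
  obtain j where j: "interior (Q (m + l) j) \<noteq> {}" using interior_Q_exists by blast
  have "i \<in> set (wd (sh m a) l [j])" using k by (intro letter_in_wd[of "k - m"]) (auto simp: l_def sh_def)
  then obtain P s where "wd (sh m a) l [j] = P @ i # s" by (meson split_list)
  then have "prefix (P @ [i]) (wd (sh m a) l [j])" by (auto simp: prefix_def)
  then have "(+) (val (lev m) P) ` Q (m + l) j \<subseteq> Q m i" unfolding Q_eq[of m i l] by blast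
  then have "interior ((+) (val (lev m) P) ` Q (m + l) j) \<subseteq> interior (Q m i)" by (rule interior_mono)
  then show ?thesis using j by (auto simp: interior_translation)
qed

lemma Q_0_regular: "Q 0 i = closure (interior (Q 0 i))"
proof
  show "closure (interior (Q 0 i)) \<subseteq> Q 0 i"
    using compact_Q[of 0 i] by (intro closure_minimal interior_subset compact_imp_closed)
  show "Q 0 i \<subseteq> closure (interior (Q 0 i))"
  proof
    fix x assume x: "x \<in> Q 0 i"
    show "x \<in> closure (interior (Q 0 i))"
      unfolding closure_approachable
    proof (intro allI impI)
      fix e :: real assume e: "0 < e"
      obtain m where m: "\<And>j. Q m j \<subseteq> cball 0 (e / 3)" using Q_small[of "e / 3"] e by (metis order_refl divide_pos_pos zero_less_numeral)
      obtain j P q where P: "prefix (P @ [i]) (wd a m [j])" "q \<in> Q m j" "x = val tau P + q"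
        using x Q_0_eq[of i m] by auto
      have sub: "(+) (val tau P) ` Q m j \<subseteq> Q 0 i" using P(1) unfolding Q_0_eq[of i m] by blast
      obtain z where z: "z \<in> interior (Q m j)" using interior_Q by blast
      then have "val tau P + z \<in> interior ((+) (val tau P) ` Q m j)" by (simp add: interior_translation)
      then have "val tau P + z \<in> interior (Q 0 i)" using interior_mono[OF sub] by blast
      moreover have "dist (val tau P + z) x < e"
      proof -
        have "norm z \<le> e / 3" "norm q \<le> e / 3" using m[of j] z P(2) interior_subset[of "Q m j"] by auto
        then show ?thesis using e norm_triangle_ineq4[of z q] by (simp add: P(3) dist_norm)
      qed
      ultimately show "\<exists>y\<in>interior (Q 0 i). dist y x < e" by blast
    qed
  qed
qed

end

section \<open>Overlaps\<close>

definition cube :: "(real^2) set" where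
  "cube = {x. \<forall>i. 0 \<le> x $ i \<and> x $ i < 1}"

lemma cube_borel [measurable]: "cube \<in> sets borel"
proof -
  have "cube = ({x. 0 \<le> x $ 1} \<inter> {x. x $ 1 < 1}) \<inter> ({x. 0 \<le> x $ 2} \<inter> {x. x $ 2 < 1})"
    by (auto simp: cube_def forall_2)
  also have "\<dots> \<in> sets borel"
    by (intro sets.Int borel_closed borel_open closed_Collect_le open_Collect_less continuous_intros)
  finally show ?thesis .
qed

definition floor_vec :: "real^2 \<Rightarrow> real^2" where
  "floor_vec x = (\<chi> i. of_int \<lfloor>x $ i\<rfloor>)"

lemma floor_vec_int: "floor_vec x \<in> int_vectors"
  by (simp add: floor_vec_def int_vectors_def)

lemma diff_mem_cube_iff:
  assumes "l \<in> int_vectors"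
  shows "x - l \<in> cube \<longleftrightarrow> l = floor_vec x"
proof
  assume c: "x - l \<in> cube"
  have "l $ i = of_int \<lfloor>x $ i\<rfloor>" for i
  proof -
    obtain k where k: "l $ i = of_int k" using assms unfolding int_vectors_def by (metis Ints_cases mem_Collect_eq)
    have "0 \<le> x $ i - l $ i" "x $ i - l $ i < 1" using c by (auto simp: cube_def)
    then have "\<lfloor>x $ i\<rfloor> = k" unfolding k by (intro floor_unique) auto
    then show ?thesis by (simp add: k)
  qed
  then show "l = floor_vec x" by (simp add: floor_vec_def vec_eq_iff)
next
  assume "l = floor_vec x"
  then show "x - l \<in> cube" by (simp add: cube_def floor_vec_def) linarith
qed

text \<open>Unfolding over the lattice: each point has exactly one translate in the half-open cube,
  so the indicators of the translated cubes sum to 1.\<close>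

lemma nn_integral_fold:
  fixes g :: "real^2 \<Rightarrow> ennreal"
  assumes [measurable]: "g \<in> borel_measurable borel"
  shows "(\<integral>\<^sup>+x. g x \<partial>lborel) =
     (\<integral>\<^sup>+x. indicator cube x * (\<integral>\<^sup>+l. g (x + l) \<partial>count_space int_vectors) \<partial>lborel)"
proof -
  have one: "(\<integral>\<^sup>+l. indicator cube (y - l) \<partial>count_space int_vectors) = 1" for y :: "real^2"
  proof -
    have "(\<integral>\<^sup>+l. indicator cube (y - l) \<partial>count_space int_vectors) =
       (\<integral>\<^sup>+l. indicator {floor_vec y} l \<partial>count_space int_vectors)"
      by (intro nn_integral_cong) (auto simp: indicator_def diff_mem_cube_iff)
    also have "\<dots> = emeasure (count_space int_vectors) {floor_vec y}"
      by (intro nn_integral_indicator) (simp add: floor_vec_int)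
    also have "\<dots> = 1" by (simp add: floor_vec_int)
    finally show ?thesis .
  qed
  have "(\<integral>\<^sup>+x. g x \<partial>lborel) = (\<integral>\<^sup>+y. g y * (\<integral>\<^sup>+l. indicator cube (y - l) \<partial>count_space int_vectors) \<partial>lborel)"
    by (simp add: one)
  also have "\<dots> = (\<integral>\<^sup>+y. (\<integral>\<^sup>+l. g y * indicator cube (y - l) \<partial>count_space int_vectors) \<partial>lborel)"
    by (intro nn_integral_cong nn_integral_cmult[symmetric]) simp
  also have "\<dots> = (\<integral>\<^sup>+l. (\<integral>\<^sup>+y. g y * indicator cube (y - l) \<partial>lborel) \<partial>count_space int_vectors)"
    by (intro nn_integral_count_space_nn_integral countable_int_vectors) measurable
  also have "\<dots> = (\<integral>\<^sup>+l. (\<integral>\<^sup>+x. indicator cube x * g (x + l) \<partial>lborel) \<partial>count_space int_vectors)"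
  proof (rule nn_integral_cong)
    fix l :: "real^2"
    have "(\<integral>\<^sup>+y. g y * indicator cube (y - l) \<partial>lborel) =
       (\<integral>\<^sup>+y. g y * indicator cube (y - l) \<partial>distr lborel borel ((+) l))"
      by (simp add: lborel_distr_plus)
    also have "\<dots> = (\<integral>\<^sup>+x. g (l + x) * indicator cube (l + x - l) \<partial>lborel)"
      by (intro nn_integral_distr) measurable
    finally show "(\<integral>\<^sup>+y. g y * indicator cube (y - l) \<partial>lborel) =
        (\<integral>\<^sup>+x. indicator cube x * g (x + l) \<partial>lborel)"
      by (simp add: mult.commute add.commute)
  qed
  also have "\<dots> = (\<integral>\<^sup>+x. (\<integral>\<^sup>+l. indicator cube x * g (x + l) \<partial>count_space int_vectors) \<partial>lborel)"
    by (intro nn_integral_count_space_nn_integral[symmetric] countable_int_vectors) measurable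
  also have "\<dots> = (\<integral>\<^sup>+x. indicator cube x * (\<integral>\<^sup>+l. g (x + l) \<partial>count_space int_vectors) \<partial>lborel)"
    by (intro nn_integral_cong nn_integral_cmult) simp
  finally show ?thesis .
qed

lemma emeasure_cube: "emeasure lborel cube = 1"
proof -
  have "box 0 1 \<subseteq> cube" "cube \<subseteq> cbox 0 (1 :: real^2)"
    by (auto simp: cube_def mem_box_cart less_imp_le)
  then have "emeasure lborel (box 0 (1 :: real^2)) \<le> emeasure lborel cube"
    "emeasure lborel cube \<le> emeasure lborel (cbox 0 (1 :: real^2))"
    by (auto intro!: emeasure_mono)
  moreover have "(1 :: real^2) \<bullet> b = 1" if "b \<in> Basis" for b
    using that by (auto simp: Basis_vec_def inner_axis)
  ultimately show ?thesis
    by (simp add: emeasure_lborel_box_eq emeasure_lborel_cbox_eq antisym)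
qed

lemma abs_add3_le: "\<bar>p\<bar> \<le> r \<Longrightarrow> \<bar>q\<bar> \<le> r \<Longrightarrow> \<bar>s\<bar> \<le> r \<Longrightarrow> \<bar>p + q + s\<bar> \<le> 3 * (r::real)"
  by linarith

text \<open>The integer vector of coordinate sum 0 above \<open>l\<close>, so that lattice
  translations do not affect lengths of words. The floors only convert integral entries to type
  \<open>int\<close>.\<close>

definition lift_int :: "real^2 \<Rightarrow> letter \<Rightarrow> int" where
  "lift_int l j = (if j = 1 then \<lfloor>l $ 1\<rfloor> else if j = 2 then \<lfloor>l $ 2\<rfloor> else - \<lfloor>l $ 1\<rfloor> - \<lfloor>l $ 2\<rfloor>)"

lemma dot_one_lift_int: "dot (\<lambda>i. 1) (lift_int l) = 0"
  by (simp add: dot_def lift_int_def)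

lemma lift_int_inj:
  assumes "l \<in> int_vectors" "l' \<in> int_vectors" "lift_int l = lift_int l'"
  shows "l = l'"
proof -
  have "\<lfloor>l $ 1\<rfloor> = \<lfloor>l' $ 1\<rfloor>" "\<lfloor>l $ 2\<rfloor> = \<lfloor>l' $ 2\<rfloor>"
    using fun_cong[OF assms(3), of 1] fun_cong[OF assms(3), of 2] by (simp_all add: lift_int_def)
  moreover have "l $ i = of_int \<lfloor>l $ i\<rfloor>" "l' $ i = of_int \<lfloor>l' $ i\<rfloor>" for i
    using assms(1,2) by (auto simp: int_vectors_def)
  ultimately have "l $ 1 = l' $ 1" "l $ 2 = l' $ 2" by metis+
  then show ?thesis by (simp add: vec_eq_iff forall_2)
qed

lemma Act_of_int: "Act b n (\<lambda>i. real_of_int (x i)) = (\<lambda>i. real_of_int (Act b n x i))"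
proof (induction n arbitrary: x)
  case (Suc n)
  have "act (b n) (\<lambda>i. real_of_int (x i)) = (\<lambda>i. real_of_int (act (b n) x i))" by (auto simp: act_def)
  then show ?case by (simp add: Suc)
qed simp

section \<open>Integer differences of meeting pieces\<close>

context ar_direction
begin

lemma vdot_lift_int: "l \<in> int_vectors \<Longrightarrow> vdot tau (\<lambda>i. real_of_int (lift_int l i)) = l"
  by (auto simp: vdot_tau lift_int_def vec_eq_iff forall_2 int_vectors_def)

abbreviation "hgt m j \<equiv> length (wd a m [j])"

lemma dot_hgt: "dot (\<lambda>j. int (hgt m j)) d = dot (\<lambda>i. 1) (Act a m d)"
  by (simp add: dot_Act length_wd)

definition good :: "real \<Rightarrow> nat \<Rightarrow> bool" where
  "good \<rho> m \<longleftrightarrow> (\<forall>i j. real (hgt m i) \<le> \<rho> * real (hgt m j))"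

text \<open>Bounds the integer differences, read at a good level, of two pieces that meet.\<close>

definition gapC :: "real \<Rightarrow> int" where
  "gapC \<rho> = \<lceil>12 * bnd + \<rho> * (1 + 36 * bnd)\<rceil>"

lemma inner_Q_le:
  assumes v: "\<And>j. c j = v \<bullet> lev m j" and y: "Act a m y = u" "direction (sh m a) y" "dot c y = 0"
    and c: "\<And>j. \<bar>c j\<bar> \<le> 1" and q: "q \<in> Q m j"
  shows "\<bar>v \<bullet> q\<bar> \<le> 6 * bnd"
proof -
  have "Q m j \<subseteq> {x. \<bar>v \<bullet> x\<bar> \<le> 6 * bnd}"
    unfolding Q_def
  proof (rule closure_minimal)
    show "closed {x. \<bar>v \<bullet> x\<bar> \<le> 6 * bnd}" by (intro closed_Collect_le continuous_intros)
    show "{val (lev m) r | r. PL (sh m a) r j} \<subseteq> {x. \<bar>v \<bullet> x\<bar> \<le> 6 * bnd}"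
    proof clarify
      fix r assume r: "PL (sh m a) r j"
      have "c = (\<lambda>j. v \<bullet> lev m j)" using v by blast
      then have "v \<bullet> val (lev m) r = val c r" by (simp add: inner_val)
      also have "\<bar>\<dots>\<bar> \<le> bnd * spread c" by (rule val_le[OF r y])
      also have "\<dots> \<le> bnd * 6"
        using bnd_pos spread_le[of c] c[of 1] c[of 2] c[of 3] by (intro mult_left_mono) auto
      finally show "\<bar>v \<bullet> val (lev m) r\<bar> \<le> 6 * bnd" by simp
    qed
  qed
  then show ?thesis using q by blast
qed

text \<open>Functionals killing the direction read off positions inside the two tiles, so they are
  bounded on \<open>d\<close>. What remains is the coordinate sum \<open>s\<close>, which is bounded
  through lengths: two prefixes differ in length by at most the longest word \<open>H\<close>,
  whereas one unit along the normalised direction \<open>w\<close> gains at least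
  \<open>H / \<rho>\<close>.\<close>

lemma gap_vector:
  assumes g: "good \<rho> m"
    and P: "prefix (P @ [i]) (wd a m [j])" "prefix (P' @ [i']) (wd a m [j'])"
    and l: "l \<in> int_vectors" "l' \<in> int_vectors" and q: "q \<in> Q m j" "q' \<in> Q m j'"
    and eq: "l + val tau P + q = l' + val tau P' + q'"
  shows "\<exists>d. Act a m d = (\<lambda>k. (cnt P k + lift_int l k) - (cnt P' k + lift_int l' k)) \<and> (\<forall>k. \<bar>d k\<bar> \<le> gapC \<rho>)"
proof -
  obtain d where d: "Act a m d = (\<lambda>k. (cnt P k + lift_int l k) - (cnt P' k + lift_int l' k))"
    using Act_surj by blast
  define x where "x k = real_of_int (d k)" for k
  have "vdot (lev m) x = vdot tau (\<lambda>k. real_of_int (Act a m d k))"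
    by (simp add: vdot_lev x_def[abs_def] Act_of_int)
  also have "\<dots> = (val tau P + l) - (val tau P' + l')"
    by (simp add: d vdot_diff vdot_add val_vdot vdot_lift_int l)
  also have "l + val tau P = l' + val tau P' + q' - q" using eq by (metis add_diff_cancel_right')
  then have "(val tau P + l) - (val tau P' + l') = q' - q" by (simp add: algebra_simps)
  finally have vx: "vdot (lev m) x = q' - q" .
  obtain y where y: "Act a m y = u" "direction (sh m a) y" using direction_shift[OF dir] by blast
  have y0: "0 < y i" for i using direction_pos[OF y(2)] .
  define t where "t = y 1 + y 2 + y 3"
  define w where "w i = y i / t" for i
  have t: "0 < t" using y0 by (simp add: t_def add_pos_pos)
  have w: "0 < w i" "w 1 + w 2 + w 3 = 1" for i
    using y0 t by (auto simp: w_def t_def simp flip: add_divide_distrib)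
  have w1: "w i \<le> 1" for i using w(1)[of 1] w(1)[of 2] w(1)[of 3] w(2) exhaust_3[of i] by auto
  define s where "s = x 1 + x 2 + x 3"
  have comp: "\<bar>x k - s * w k\<bar> \<le> 12 * bnd" for k
  proof -
    define c where "c j = of_bool (j = k) - w k" for j :: letter
    have "dot c y = y k - w k * t"
      using exhaust_3[of k] by (auto simp: dot_def c_def t_def algebra_simps)
    then have cy: "dot c y = 0" using t by (simp add: w_def)
    obtain v where v: "\<And>j. c j = v \<bullet> lev m j" using dual_vector[OF y(1) cy] by blast
    have c1: "\<bar>c j\<bar> \<le> 1" for j using w(1)[of k] w1[of k] by (auto simp: c_def)
    have "x k - s * w k = dot c x" using exhaust_3[of k] by (auto simp: dot_def c_def s_def algebra_simps)
    also have "\<dots> = v \<bullet> vdot (lev m) x" by (simp add: inner_vdot flip: v)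
    also have "\<dots> = v \<bullet> q' - v \<bullet> q" by (simp add: vx inner_diff_right)
    finally show ?thesis
      using inner_Q_le[OF v y cy c1 q(1)] inner_Q_le[OF v y cy c1 q(2)] by linarith
  qed
  define H where "H = real (Max (range (hgt m)))"
  have hH: "real (hgt m k) \<le> H" for k by (simp add: H_def)
  have "Max (range (hgt m)) \<in> range (hgt m)" by (intro Max_in) auto
  then obtain k0 where "Max (range (hgt m)) = hgt m k0" by (rule rangeE)
  then have k0: "H = real (hgt m k0)" by (simp add: H_def)
  have Hpos: "0 < H" using wd_nonempty[of "[k0]" a m] by (simp add: k0)
  have hlow: "H \<le> \<rho> * real (hgt m k)" for k using g unfolding good_def k0 by blast
  have \<rho>: "0 < \<rho>" using hlow[of 1] Hpos by (smt (verit) mult_nonpos_nonneg of_nat_0_le_iff)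
  have "\<bar>dot (\<lambda>j. real (hgt m j)) x\<bar> \<le> H"
  proof -
    have "dot (\<lambda>j. int (hgt m j)) d = int (length P) - int (length P')"
      unfolding dot_hgt d by (simp add: dot_diff dot_add dot_one_lift_int length_cnt)
    then have "real_of_int (dot (\<lambda>j. int (hgt m j)) d) = real (length P) - real (length P')" by simp
    moreover have "real_of_int (dot (\<lambda>j. int (hgt m j)) d) = dot (\<lambda>j. real (hgt m j)) x"
      by (simp add: dot_def x_def)
    moreover have "length P < hgt m j" "length P' < hgt m j'"
      using prefix_length_le[OF P(1)] prefix_length_le[OF P(2)] by auto
    ultimately show ?thesis using hH[of j] hH[of j'] by linarith
  qed
  moreover have "dot (\<lambda>j. real (hgt m j)) x =
     dot (\<lambda>j. real (hgt m j)) (\<lambda>k. x k - s * w k) + s * dot (\<lambda>j. real (hgt m j)) w"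
    by (simp add: dot_def algebra_simps)
  moreover have "\<bar>dot (\<lambda>j. real (hgt m j)) (\<lambda>k. x k - s * w k)\<bar> \<le> 36 * bnd * H"
  proof -
    have "\<bar>real (hgt m k) * (x k - s * w k)\<bar> \<le> H * (12 * bnd)" for k
      unfolding abs_mult using hH[of k] comp[of k] Hpos by (intro mult_mono) auto
    from abs_add3_le[OF this[of 1] this[of 2] this[of 3]]
    have "\<bar>dot (\<lambda>j. real (hgt m j)) (\<lambda>k. x k - s * w k)\<bar> \<le> 3 * (H * (12 * bnd))" unfolding dot_def .
    also have "3 * (H * (12 * bnd)) = 36 * bnd * H" by simp
    finally show ?thesis .
  qed
  moreover have "H / \<rho> \<le> dot (\<lambda>j. real (hgt m j)) w"
  proof -
    have "H / \<rho> * w k \<le> real (hgt m k) * w k" for k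
      using hlow[of k] \<rho> w(1)[of k] by (intro mult_right_mono) (auto simp: divide_le_eq mult.commute)
    from this[of 1] this[of 2] this[of 3] have "H / \<rho> * (w 1 + w 2 + w 3) \<le> dot (\<lambda>j. real (hgt m j)) w"
      by (simp add: dot_def distrib_left)
    then show ?thesis using w(2) by simp
  qed
  ultimately have "\<bar>s * dot (\<lambda>j. real (hgt m j)) w\<bar> \<le> H + 36 * bnd * H"
    and dw: "H / \<rho> \<le> dot (\<lambda>j. real (hgt m j)) w" by linarith+
  moreover have "0 < H / \<rho>" using Hpos \<rho> by simp
  ultimately have le: "\<bar>s * dot (\<lambda>j. real (hgt m j)) w\<bar> \<le> H + 36 * bnd * H"
    and "0 \<le> dot (\<lambda>j. real (hgt m j)) w" by linarith+
  then have "\<bar>s\<bar> * dot (\<lambda>j. real (hgt m j)) w = \<bar>s * dot (\<lambda>j. real (hgt m j)) w\<bar>"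
    by (simp add: abs_mult)
  also have "\<dots> \<le> H + 36 * bnd * H" by (rule le)
  also have "\<dots> = H * (1 + 36 * bnd)" by (simp add: distrib_left)
  finally have "\<bar>s\<bar> * dot (\<lambda>j. real (hgt m j)) w \<le> H * (1 + 36 * bnd)" .
  moreover have "\<bar>s\<bar> * (H / \<rho>) \<le> \<bar>s\<bar> * dot (\<lambda>j. real (hgt m j)) w"
    using dw by (intro mult_left_mono) auto
  ultimately have "\<bar>s\<bar> * (H / \<rho>) \<le> H * (1 + 36 * bnd)" by linarith
  then have "H * (\<bar>s\<bar> / \<rho>) \<le> H * (1 + 36 * bnd)" by (simp add: mult.commute)
  then have "\<bar>s\<bar> / \<rho> \<le> 1 + 36 * bnd" using Hpos by (rule mult_left_le_imp_le)
  then have s: "\<bar>s\<bar> \<le> \<rho> * (1 + 36 * bnd)" using \<rho> by (simp add: divide_le_eq mult.commute)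
  have "\<bar>d k\<bar> \<le> gapC \<rho>" for k
  proof -
    have "\<bar>s * w k\<bar> \<le> \<bar>s\<bar> * 1" unfolding abs_mult using w(1)[of k] w1[of k] by (intro mult_left_mono) auto
    then have "\<bar>x k\<bar> \<le> 12 * bnd + \<rho> * (1 + 36 * bnd)" using comp[of k] s by linarith
    then have "real_of_int \<bar>d k\<bar> \<le> 12 * bnd + \<rho> * (1 + 36 * bnd)" by (simp add: x_def)
    then show ?thesis unfolding gapC_def by linarith
  qed
  then show ?thesis using d by blast
qed

text \<open>
  Every word of level \<open>n + 1\<close> ends in the block of the letter \<open>a n\<close>. If the difference of two meeting pieces
  comes from a prefix at level \<open>n + 1\<close>, a piece inside that last block can only meet itself.
\<close>

lemma shared_last_edge:
  assumes nm: "n < m" and g: "good \<rho> m"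
    and pv: "\<And>x j. (\<And>k. \<bar>x k\<bar> \<le> gapC \<rho> + 1) \<Longrightarrow> 0 \<le> dot (\<lambda>j. int (hgt m j)) x \<Longrightarrow>
        dot (\<lambda>j. int (hgt m j)) x \<le> int (hgt m j) \<Longrightarrow> passes (sh (Suc n) a) (m - Suc n) x j"
    and W: "wd (sh n a) (m - n) [j] = W @ [a n]"
    and P: "P = wd a n W @ P0" "prefix (P @ [i]) (wd a m [j])" "prefix (P' @ [i']) (wd a m [j'])"
    and l: "l \<in> int_vectors" and q: "q \<in> Q m j" "q' \<in> Q m j'"
    and eq: "val tau P + q = l + val tau P' + q'"
  shows "l = 0 \<and> i = i'"
proof -
  define b where "b = sh (Suc n) a"
  define T where "T = m - Suc n"
  define h where "h = dot (\<lambda>j. int (hgt m j))"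
  have h_unit: "h (unitv k) = int (hgt m k)" for k by (simp add: h_def)
  have lev_n: "wd (sh n a) (m - n) w = subst_word (AR (a n)) (wd b T w)" for w
  proof -
    have "sh (Suc 0) (sh n a) = b" by (simp add: b_def sh_sh)
    then have "wd (sh n a) (Suc 0 + T) w = wd (sh n a) (Suc 0) (wd b T w)"
      by (simp only: wd_add)
    moreover have "m - n = Suc 0 + T" using nm by (simp add: T_def)
    ultimately show ?thesis by (simp add: sh_def)
  qed
  have lev_m: "wd a m w = wd a n (wd (sh n a) (m - n) w)" for w
    using wd_add[of a n "m - n" w] nm by simp
  have Act_m: "Act a m x = Act a n (act (a n) (Act b T x))" for x :: "letter \<Rightarrow> int"
  proof -
    have "m = Suc n + T" using nm by (simp add: T_def)
    then show ?thesis by (simp only: Act_add b_def) simp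
  qed
  have sub_snoc: "\<exists>v. subst_word (AR (a n)) (w @ [k]) = subst_word (AR (a n)) w @ v @ [a n]" for w k
    by (auto simp: subst_word_def AR_def)
  have cnt_sub: "cnt (subst_word (AR (a n)) w) = act (a n) (cnt w)" for w
    using cnt_wd[of "\<lambda>_. a n" "Suc 0" w] by simp
  have len_m: "int (length (wd a n (subst_word (AR (a n)) w))) = h x" if "cnt w = Act b T x" for w x
  proof -
    have "h x = dot (\<lambda>i. 1) (Act a m x)" unfolding h_def by (rule dot_hgt)
    then show ?thesis by (simp add: length_cnt cnt_wd cnt_sub that Act_m)
  qed
  obtain d where d: "Act a m d = (\<lambda>k. (cnt P k + lift_int 0 k) - (cnt P' k + lift_int l k))"
    and dC: "\<And>k. \<bar>d k\<bar> \<le> gapC \<rho>"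
  proof -
    have "0 + val tau P + q = l + val tau P' + q'" using eq by simp
    from gap_vector[OF g P(2,3) int_vectors_zero l q this] show ?thesis using that by blast
  qed
  have z0: "lift_int 0 = (\<lambda>k. 0)" by (auto simp: lift_int_def)
  have hd: "h d = int (length P) - int (length P')"
    unfolding h_def dot_hgt d z0 by (simp add: dot_diff dot_add dot_one_lift_int length_cnt)
  have lens: "length P < hgt m j" "length P' < hgt m j'"
    using prefix_length_le[OF P(2)] prefix_length_le[OF P(3)] by auto
  show ?thesis
  \<comment> \<open>Relative to the start of the word over \<open>j\<close>, the word over
    \<open>j'\<close> starts at \<open>d\<close>. If it does not end earlier, the end of the word
    over \<open>j\<close> is a vertex at a height covered by the word over
    \<open>j'\<close>.\<close>
  proof (cases "int (hgt m j) \<le> h d + int (hgt m j')")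
    case True
    define x where "x k = unitv j k - d k" for k
    have hx: "h x = int (hgt m j) - h d" by (simp add: x_def[abs_def] h_def dot_diff)
    have "passes b T x j'"
      unfolding b_def T_def
    proof (rule pv)
      show "\<bar>x k\<bar> \<le> gapC \<rho> + 1" for k using dC[of k] by (auto simp: x_def unitv_def)
    qed (use hx hd lens True in \<open>auto simp: h_def\<close>)
    then obtain P1 where P1: "prefix P1 (wd b T [j'])" "cnt P1 = Act b T x" by (auto simp: passes_def)
    have "P1 \<noteq> []"
    proof
      assume "P1 = []"
      then have "h x = 0" using len_m[OF P1(2)] by (simp add: subst_word_def)
      then show False using hx hd lens by simp
    qed
    then obtain P2 k where "P1 = P2 @ [k]" by (metis append_butlast_last_id)
    \<comment> \<open>The path over \<open>j'\<close> thus has a prefix ending where the word over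
      \<open>j\<close> ends, and one level down this prefix also ends in \<open>a n\<close>. So the
      two last blocks coincide, and with them the positions inside.\<close>
    then obtain V where V: "subst_word (AR (a n)) P1 = V @ [a n]" using sub_snoc[of P2 k] by auto
    have "cnt (V @ [a n]) = act (a n) (Act b T x)" using cnt_sub[of P1] P1(2) V by simp
    then have 1: "Act a n (cnt (V @ [a n])) = Act a m x" by (simp add: Act_m)
    have "cnt (W @ [a n]) = act (a n) (Act b T (unitv j))"
      using cnt_sub[of "wd b T [j]"] lev_n[of "[j]"] W by (simp add: cnt_wd_letter)
    then have 2: "Act a n (cnt (W @ [a n])) = Act a m (unitv j)" by (simp add: Act_m)
    have "Act a m x = (\<lambda>k. Act a m (unitv j) k - Act a m d k)" by (simp add: x_def[abs_def] Act_diff)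
    then have "Act a n (cnt V) k = Act a n (cnt W) k - Act a m d k" for k
      using fun_cong[OF 1, of k] fun_cong[OF 2, of k] by (simp add: Act_sum)
    then have 3: "cnt (wd a n V @ P0) k = cnt P' k + lift_int l k" for k
      using d z0 by (simp add: cnt_wd P(1))
    then have "cnt (wd a n V @ P0) = (\<lambda>k. cnt P' k + lift_int l k)" by blast
    then have "int (length (wd a n V @ P0)) = int (length P')"
      unfolding length_cnt by (simp add: dot_add dot_one_lift_int)
    moreover have pre: "prefix ((wd a n V @ P0) @ [i]) (wd a m [j'])"
    proof -
      have "prefix (P0 @ [i]) (wd a n [a n])"
        using P(2) unfolding P(1) lev_m W by (simp del: subst_prod.simps)
      then have "prefix ((wd a n V @ P0) @ [i]) (wd a n (subst_word (AR (a n)) P1))"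
        by (simp add: V)
      moreover have "prefix (wd a n (subst_word (AR (a n)) P1)) (wd a m [j'])"
      proof -
        obtain z where "wd b T [j'] = P1 @ z" using P1(1) by (auto simp: prefix_def)
        then have "subst_word (AR (a n)) (wd b T [j']) = subst_word (AR (a n)) P1 @ subst_word (AR (a n)) z"
          by (simp add: subst_word_def)
        then show ?thesis unfolding lev_m lev_n by simp
      qed
      ultimately show ?thesis by (meson prefix_order.order_trans)
    qed
    ultimately have "(wd a n V @ P0) @ [i] = P' @ [i']"
      using P(3) pre by (metis length_append_singleton of_nat_eq_iff prefix_length_prefix prefix_order.antisym le_refl)
    then have e: "wd a n V @ P0 = P'" "i = i'" by auto
    then have "lift_int l k = 0" for k using 3[of k] by simp
    then have "lift_int l = lift_int 0" by (auto simp: z0)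
    then show ?thesis using e lift_int_inj[OF l int_vectors_zero] by blast
  next
    case False
    \<comment> \<open>Here the word over \<open>j'\<close> ends at a vertex strictly inside the word
      over \<open>j\<close>, hence no later than its last block begins. Then \<open>P\<close> is too
      high to be at the height of \<open>P'\<close>.\<close>
    define x where "x k = d k + unitv j' k" for k
    have hx: "h x = h d + int (hgt m j')" by (simp add: x_def[abs_def] h_def dot_add)
    have "passes b T x j"
      unfolding b_def T_def
    proof (rule pv)
      show "\<bar>x k\<bar> \<le> gapC \<rho> + 1" for k using dC[of k] by (auto simp: x_def unitv_def)
    qed (use hx hd lens False in \<open>auto simp: h_def\<close>)
    then obtain P1 where P1: "prefix P1 (wd b T [j])" "cnt P1 = Act b T x" by (auto simp: passes_def)
    have l1: "int (length (wd a n (subst_word (AR (a n)) P1))) = h x" by (rule len_m[OF P1(2)])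
    obtain z where z: "wd b T [j] = P1 @ z" using P1(1) by (auto simp: prefix_def)
    have "z \<noteq> []"
    proof
      assume "z = []"
      then have "wd a m [j] = wd a n (subst_word (AR (a n)) P1)" using z by (simp add: lev_m lev_n)
      then show False using l1 hx False by simp
    qed
    then obtain z' k where "z = z' @ [k]" by (metis append_butlast_last_id)
    then obtain v where "subst_word (AR (a n)) (wd b T [j]) = subst_word (AR (a n)) P1 @ v @ [a n]"
      using z sub_snoc[of z' k] by (auto simp: subst_word_def)
    then have "W = subst_word (AR (a n)) P1 @ v" using W lev_n[of "[j]"] by simp
    then have "int (length (wd a n W)) \<ge> h x" using l1 by simp
    moreover have "length (wd a n W) \<le> length P" by (simp add: P(1))
    ultimately show ?thesis using hx hd lens False by linarith
  qed
qed

end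

lemma nn_integral_lborel_shift:
  fixes g :: "real^2 \<Rightarrow> ennreal"
  assumes [measurable]: "g \<in> borel_measurable borel"
  shows "(\<integral>\<^sup>+x. g (c + x) \<partial>lborel) = (\<integral>\<^sup>+x. g x \<partial>lborel)"
proof -
  have "(\<integral>\<^sup>+x. g x \<partial>lborel) = (\<integral>\<^sup>+x. g x \<partial>distr lborel borel ((+) c))"
    by (simp add: lborel_distr_plus)
  also have "\<dots> = (\<integral>\<^sup>+x. g (c + x) \<partial>lborel)"
    by (intro nn_integral_distr) measurable
  finally show ?thesis by simp
qed

lemma emeasure_lborel_shift:
  fixes S :: "(real^2) set"
  assumes "S \<in> sets borel"
  shows "emeasure lborel ((+) c ` S) = emeasure lborel S"
proof -
  have [measurable]: "S \<in> sets borel" by fact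
  have im: "(+) c ` S = (\<lambda>x. - c + x) -` S" by (auto intro!: image_eqI[of _ _ "- c + x" for x])
  have "(\<lambda>x. - c + x) -` S \<inter> space lborel \<in> sets lborel" by measurable
  then have b: "(+) c ` S \<in> sets lborel" by (simp add: im)
  have "emeasure lborel ((+) c ` S) = (\<integral>\<^sup>+x. indicator ((+) c ` S) x \<partial>lborel)" using b by simp
  also have "\<dots> = (\<integral>\<^sup>+x. indicator S (- c + x) \<partial>lborel)" by (simp add: im indicator_def)
  also have "\<dots> = (\<integral>\<^sup>+x. indicator S x \<partial>lborel)" by (rule nn_integral_lborel_shift) measurable
  finally show ?thesis using assms by simp
qed

lemma strict_prefixes_eq: "{P. \<exists>i. prefix (P @ [i]) w} = set (prefixes w) - {w}"
proof
  show "{P. \<exists>i. prefix (P @ [i]) w} \<subseteq> set (prefixes w) - {w}"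
    by (auto simp: prefix_def)
  show "set (prefixes w) - {w} \<subseteq> {P. \<exists>i. prefix (P @ [i]) w}"
  proof
    fix P assume "P \<in> set (prefixes w) - {w}"
    then obtain z where z: "w = P @ z" "z \<noteq> []" by (auto simp: prefix_def)
    then obtain i s where "z = i # s" by (cases z) auto
    then show "P \<in> {P. \<exists>i. prefix (P @ [i]) w}" using z by (auto simp: prefix_def)
  qed
qed

lemma length_wd_sum_list: "real (length (wd b n W)) = sum_list (map (\<lambda>k. real (length (wd b n [k]))) W)"
proof (induction W)
  case (Cons x W)
  then show ?case using wd_Cons[of b n x W] by simp
qed simp

text \<open>Each position in the image of \<open>W\<close> belongs to the block of one letter of
  \<open>W\<close>, so positions are counted block by block.\<close>

lemma card_positions:
  assumes "\<And>k. finite (B k)"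
  shows "finite {wd b n V @ P0 | V k P0. prefix (V @ [k]) W \<and> P0 \<in> B k} \<and>
    card {wd b n V @ P0 | V k P0. prefix (V @ [k]) W \<and> P0 \<in> B k} \<le> sum_list (map (\<lambda>k. card (B k)) W)"
proof (induction W rule: rev_induct)
  case (snoc x W)
  have "{wd b n V @ P0 | V k P0. prefix (V @ [k]) (W @ [x]) \<and> P0 \<in> B k} \<subseteq>
     {wd b n V @ P0 | V k P0. prefix (V @ [k]) W \<and> P0 \<in> B k} \<union> (\<lambda>P0. wd b n W @ P0) ` B x"
    by (auto simp: prefix_snoc)
  moreover have "finite ({wd b n V @ P0 | V k P0. prefix (V @ [k]) W \<and> P0 \<in> B k} \<union> (\<lambda>P0. wd b n W @ P0) ` B x)"
    using snoc assms by auto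
  moreover have "card ({wd b n V @ P0 | V k P0. prefix (V @ [k]) W \<and> P0 \<in> B k} \<union> (\<lambda>P0. wd b n W @ P0) ` B x)
     \<le> sum_list (map (\<lambda>k. card (B k)) (W @ [x]))"
  proof -
    have "card ((\<lambda>P0. wd b n W @ P0) ` B x) \<le> card (B x)" using assms by (rule card_image_le)
    then show ?thesis using snoc
      by (intro order_trans[OF card_Un_le]) simp
  qed
  ultimately show ?case by (meson card_mono finite_subset order_trans)
qed simp

section \<open>The proportion of overlapping pieces\<close>

context ar_direction
begin

definition "strictP m j = {P. \<exists>i. prefix (P @ [i]) (wd a m [j])}"

lemma finite_strictP: "finite (strictP m j)"
  by (simp add: strictP_def strict_prefixes_eq)

lemma card_strictP: "card (strictP m j) = hgt m j"
  by (simp add: strictP_def strict_prefixes_eq card_set_prefixes)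

text \<open>
  Prefixes whose piece meets a different piece modulo the lattice.
\<close>

definition "badset m j = {P. \<exists>i j' P' i' l q q'. prefix (P @ [i]) (wd a m [j]) \<and> prefix (P' @ [i']) (wd a m [j']) \<and>
    l \<in> int_vectors \<and> (l \<noteq> 0 \<or> i \<noteq> i') \<and> q \<in> Q m j \<and> q' \<in> Q m j' \<and> val tau P + q = l + val tau P' + q'}"

lemma badset_subset: "badset m j \<subseteq> strictP m j"
  unfolding badset_def strictP_def by blast

lemma finite_badset: "finite (badset m j)"
  using badset_subset finite_strictP by (rule finite_subset)

lemma floor_split:
  assumes "n \<le> m" "prefix (P @ [i]) (wd a m [j])" "q \<in> Q m j"
  obtains V k P0 where "prefix (V @ [k]) (wd (sh n a) (m - n) [j])" "prefix (P0 @ [i]) (wd a n [k])"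
    "P = wd a n V @ P0" "val tau (wd a n V) + q \<in> Q n k"
proof -
  have "wd a m [j] = wd a n (wd (sh n a) (m - n) [j])" using wd_add[of a n "m - n"] assms(1) by simp
  then have "prefix (P @ [i]) (wd a n (wd (sh n a) (m - n) [j]))" using assms(2) by simp
  from prefix_wd_split[OF this] obtain V k P0 where V: "prefix (V @ [k]) (wd (sh n a) (m - n) [j])"
    "prefix (P0 @ [i]) (wd a n [k])" "P = wd a n V @ P0"
    by blast
  have "val (lev n) V + q \<in> Q n k"
    using V(1) assms(1,3) unfolding Q_eq[of n k "m - n"] by auto
  then show ?thesis using that V by (simp add: val_wd_lev)
qed

text \<open>A piece of level \<open>m\<close> is contained in one of level \<open>n\<close>, so
  pieces that meet lie in pieces of level \<open>n\<close> that meet, with the same letters and the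
  same lattice vector.\<close>

lemma badset_inherit:
  assumes "n \<le> m"
  shows "badset m j \<subseteq> {wd a n V @ P0 | V k P0. prefix (V @ [k]) (wd (sh n a) (m - n) [j]) \<and> P0 \<in> badset n k}"
proof
  fix P assume "P \<in> badset m j"
  then obtain i j' P' i' l q q' where B: "prefix (P @ [i]) (wd a m [j])" "prefix (P' @ [i']) (wd a m [j'])"
    "l \<in> int_vectors" "l \<noteq> 0 \<or> i \<noteq> i'" "q \<in> Q m j" "q' \<in> Q m j'" "val tau P + q = l + val tau P' + q'"
    unfolding badset_def by blast
  obtain V k P0 where V: "prefix (V @ [k]) (wd (sh n a) (m - n) [j])" "prefix (P0 @ [i]) (wd a n [k])"
    "P = wd a n V @ P0" "val tau (wd a n V) + q \<in> Q n k"
    by (rule floor_split[OF assms B(1,5)])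
  obtain V' k' P0' where V': "prefix (V' @ [k']) (wd (sh n a) (m - n) [j'])" "prefix (P0' @ [i']) (wd a n [k'])"
    "P' = wd a n V' @ P0'" "val tau (wd a n V') + q' \<in> Q n k'"
    by (rule floor_split[OF assms B(2,6)])
  have "val tau P0 + (val tau (wd a n V) + q) = l + val tau P0' + (val tau (wd a n V') + q')"
    using B(7) unfolding V(3) V'(3) by (simp add: algebra_simps)
  then have "P0 \<in> badset n k"
    unfolding badset_def using V(2,4) V'(2,4) B(3,4) by blast
  then show "P \<in> {wd a n V @ P0 | V k P0. prefix (V @ [k]) (wd (sh n a) (m - n) [j]) \<and> P0 \<in> badset n k}"
    using V(1,3) by blast
qed

lemma card_positions_le:
  assumes "\<And>k. real (card (badset n k)) \<le> \<beta> * real (hgt n k)"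
  shows "real (card {wd a n V @ P0 | V k P0. prefix (V @ [k]) W \<and> P0 \<in> badset n k}) \<le> \<beta> * real (length (wd a n W))"
proof -
  have "real (sum_list (map (\<lambda>k. card (badset n k)) W)) = sum_list (map (\<lambda>k. real (card (badset n k))) W)"
    by (induction W) auto
  also have "\<dots> \<le> sum_list (map (\<lambda>k. \<beta> * real (hgt n k)) W)"
    using assms by (intro sum_list_mono) auto
  also have "\<dots> = \<beta> * real (length (wd a n W))"
    by (simp only: sum_list_const_mult length_wd_sum_list[of a n W])
  finally have "real (sum_list (map (\<lambda>k. card (badset n k)) W)) \<le> \<beta> * real (length (wd a n W))" .
  moreover have "card {wd a n V @ P0 | V k P0. prefix (V @ [k]) W \<and> P0 \<in> badset n k}
     \<le> sum_list (map (\<lambda>k. card (badset n k)) W)"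
    using card_positions[of "badset n" a n W] finite_badset by blast
  ultimately show ?thesis by linarith
qed

lemma bad_fraction_mono:
  assumes "n \<le> m" "\<And>k. real (card (badset n k)) \<le> \<beta> * real (hgt n k)"
  shows "real (card (badset m j)) \<le> \<beta> * real (hgt m j)"
proof -
  let ?W = "wd (sh n a) (m - n) [j]"
  have "card (badset m j) \<le> card {wd a n V @ P0 | V k P0. prefix (V @ [k]) ?W \<and> P0 \<in> badset n k}"
    using card_positions[of "badset n" a n ?W] finite_badset badset_inherit[OF assms(1)]
    by (intro card_mono) auto
  then have "real (card (badset m j)) \<le> \<beta> * real (length (wd a n ?W))"
    using card_positions_le[OF assms(2), of ?W] by linarith
  also have "wd a n ?W = wd a m [j]" using wd_add[of a n "m - n" "[j]"] assms(1) by simp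
  finally show ?thesis .
qed

text \<open>The conclusion of \<open>passes_vertex\<close> between the levels \<open>n + 1\<close>
  and \<open>m\<close>. The 1 makes room for the unit vector added to a gap; the start is
  \<open>n + 1\<close> because a nonempty prefix of that level ends, one level down, in
  \<open>a n\<close>.\<close>

definition contracting :: "real \<Rightarrow> nat \<Rightarrow> nat \<Rightarrow> bool" where
  "contracting \<rho> n m \<longleftrightarrow> (\<forall>x j. (\<forall>k. \<bar>x k\<bar> \<le> gapC \<rho> + 1) \<longrightarrow> 0 \<le> dot (\<lambda>j. int (hgt m j)) x \<longrightarrow>
        dot (\<lambda>j. int (hgt m j)) x \<le> int (hgt m j) \<longrightarrow> passes (sh (Suc n) a) (m - Suc n) x j)"

text \<open>In each word of level \<open>m\<close> the last block of level \<open>n\<close> is free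
  of bad prefixes and makes up at least the proportion \<delta>. Elsewhere the bad proportion is
  inherited from level \<open>n\<close>.\<close>

lemma bad_fraction_contract:
  assumes nm: "n < m" and g: "good \<rho> m" and c: "contracting \<rho> n m"
    and \<delta>: "\<And>j. \<delta> * real (hgt m j) \<le> real (hgt n (a n))" and \<beta>: "0 \<le> \<beta>"
    and b: "\<And>k. real (card (badset n k)) \<le> \<beta> * real (hgt n k)"
  shows "real (card (badset m j)) \<le> ((1 - \<delta>) * \<beta>) * real (hgt m j)"
proof -
  have "\<exists>W. wd (sh n a) (m - n) [j] = W @ [a n]"
  proof -
    have "wd (sh n a) (Suc 0 + (m - Suc n)) [j] = wd (sh n a) (Suc 0) (wd (sh (Suc 0) (sh n a)) (m - Suc n) [j])"
      by (rule wd_add)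
    moreover have "m - n = Suc 0 + (m - Suc n)" using nm by simp
    moreover obtain w k where "wd (sh (Suc 0) (sh n a)) (m - Suc n) [j] = w @ [k]"
      using wd_nonempty[of "[j]"] by (metis append_butlast_last_id list.distinct(1))
    ultimately have "wd (sh n a) (m - n) [j] = wd (sh n a) (Suc 0) w @ wd (sh n a) (Suc 0) [k]" by (simp only: wd_append)
    then show ?thesis by (auto simp: subst_word_def AR_def sh_def)
  qed
  then obtain W where W: "wd (sh n a) (m - n) [j] = W @ [a n]" by blast
  have "badset m j \<subseteq> {wd a n V @ P0 | V k P0. prefix (V @ [k]) W \<and> P0 \<in> badset n k}"
  proof
    fix P assume P: "P \<in> badset m j"
    have "P \<in> {wd a n V @ P0 | V k P0. prefix (V @ [k]) (W @ [a n]) \<and> P0 \<in> badset n k}"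
      using subsetD[OF badset_inherit[of n m j] P] nm unfolding W by simp
    then obtain V k P0 where V: "P = wd a n V @ P0" "prefix (V @ [k]) (W @ [a n])" "P0 \<in> badset n k"
      by blast
    have "V @ [k] \<noteq> W @ [a n]"
    proof
      assume e: "V @ [k] = W @ [a n]"
      obtain i j' P' i' l q q' where B: "prefix (P @ [i]) (wd a m [j])" "prefix (P' @ [i']) (wd a m [j'])"
        "l \<in> int_vectors" "l \<noteq> 0 \<or> i \<noteq> i'" "q \<in> Q m j" "q' \<in> Q m j'" "val tau P + q = l + val tau P' + q'"
        using P unfolding badset_def by blast
      have "P = wd a n W @ P0" using V(1) e by simp
      from shared_last_edge[OF nm g _ W this B(1,2,3,5,6,7)] c have "l = 0 \<and> i = i'"
        unfolding contracting_def by blast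
      then show False using B(4) by blast
    qed
    then have "prefix (V @ [k]) W" using V(2) unfolding prefix_snoc by blast
    then show "P \<in> {wd a n V @ P0 | V k P0. prefix (V @ [k]) W \<and> P0 \<in> badset n k}" using V by blast
  qed
  then have "card (badset m j) \<le> card {wd a n V @ P0 | V k P0. prefix (V @ [k]) W \<and> P0 \<in> badset n k}"
    using card_positions[of "badset n" a n W] finite_badset by (intro card_mono) auto
  then have "real (card (badset m j)) \<le> \<beta> * real (length (wd a n W))"
    using card_positions_le[OF b, of W] by linarith
  also have "real (length (wd a n W)) = real (hgt m j) - real (hgt n (a n))"
    using wd_add[of a n "m - n" "[j]"] nm W by simp
  also have "\<beta> * (real (hgt m j) - real (hgt n (a n))) \<le> \<beta> * ((1 - \<delta>) * real (hgt m j))"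
    using \<delta>[of j] \<beta> by (intro mult_left_mono) (auto simp: algebra_simps)
  finally show ?thesis by (simp add: algebra_simps)
qed

section \<open>The area covered by overlaps\<close>

definition multD :: "real \<Rightarrow> nat" where
  "multD \<rho> = card ((UNIV :: letter set) \<times> {d :: letter \<Rightarrow> int. \<forall>k. \<bar>d k\<bar> \<le> gapC \<rho>})"

lemma finite_bounded_gaps: "finite {d :: letter \<Rightarrow> int. \<forall>k. \<bar>d k\<bar> \<le> C}"
proof -
  have "{d :: letter \<Rightarrow> int. \<forall>k. \<bar>d k\<bar> \<le> C} = PiE UNIV (\<lambda>_. {- C..C})"
    by (auto simp: PiE_def abs_le_iff minus_le_iff)
  then show ?thesis by (simp add: finite_PiE)
qed

text \<open>Relative to one fixed piece over the point, any other is determined by its top letter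
  and its gap vector: coordinate sums give the length of the prefix, the length singles out the
  prefix in the word over \<open>j\<close>, and then the lattice vector is known.
  \<open>multD\<close> counts the available pairs.\<close>

lemma multiplicity:
  assumes g: "good \<rho> m"
  shows "finite {(j, P, l). P \<in> strictP m j \<and> l \<in> int_vectors \<and> x + l - val tau P \<in> Q m j} \<and>
    card {(j, P, l). P \<in> strictP m j \<and> l \<in> int_vectors \<and> x + l - val tau P \<in> Q m j} \<le> multD \<rho>"
    (is "finite ?A \<and> card ?A \<le> _")
proof (cases "?A = {}")
  case False
  then obtain j0 P0 l0 where e0: "P0 \<in> strictP m j0" "l0 \<in> int_vectors" "x + l0 - val tau P0 \<in> Q m j0" by auto
  obtain i0 where i0: "prefix (P0 @ [i0]) (wd a m [j0])" using e0(1) by (auto simp: strictP_def)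
  define rel where "rel P l d \<longleftrightarrow> Act a m d = (\<lambda>k. (cnt P0 k + lift_int (- l0) k) - (cnt P k + lift_int (- l) k))
      \<and> (\<forall>k. \<bar>d k\<bar> \<le> gapC \<rho>)" for P l d
  have ex: "\<exists>d. rel P l d" if fl: "P \<in> strictP m j" "l \<in> int_vectors" "x + l - val tau P \<in> Q m j" for j P l
  proof -
    obtain i where "prefix (P @ [i]) (wd a m [j])" using fl(1) by (auto simp: strictP_def)
    from gap_vector[OF g i0 this int_vectors_uminus[OF e0(2)] int_vectors_uminus[OF fl(2)] e0(3) fl(3)]
    show ?thesis unfolding rel_def by simp
  qed
  define D where "D P l = (SOME d. rel P l d)" for P l
  have D: "rel P l (D P l)" if "P \<in> strictP m j" "l \<in> int_vectors" "x + l - val tau P \<in> Q m j" for j P l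
    unfolding D_def using someI_ex[OF ex[OF that]] .
  define f where "f = (\<lambda>(j :: letter, P, l). (j, D P l))"
  have "inj_on f ?A"
  proof (rule inj_onI)
    fix e e' assume e: "e \<in> ?A" "e' \<in> ?A" and fe: "f e = f e'"
    obtain j P l where 1: "e = (j, P, l)" "P \<in> strictP m j" "l \<in> int_vectors" "x + l - val tau P \<in> Q m j"
      using e(1) by auto
    obtain j' P' l' where 2: "e' = (j', P', l')" "P' \<in> strictP m j'" "l' \<in> int_vectors" "x + l' - val tau P' \<in> Q m j'"
      using e(2) by auto
    have f: "f (j, P, l) = f (j', P', l')" using fe 1(1) 2(1) by simp
    have jj: "j = j'" and dd: "D P l = D P' l'" using f by (auto simp: f_def)
    have "(\<lambda>k. (cnt P0 k + lift_int (- l0) k) - (cnt P k + lift_int (- l) k)) =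
      (\<lambda>k. (cnt P0 k + lift_int (- l0) k) - (cnt P' k + lift_int (- l') k))"
      using D[OF 1(2-4)] D[OF 2(2-4)] dd by (simp add: rel_def)
    then have eq: "cnt P k + lift_int (- l) k = cnt P' k + lift_int (- l') k" for k
      by (metis (no_types, lifting) diff_left_imp_eq)
    then have "dot (\<lambda>i. 1) (\<lambda>k. cnt P k + lift_int (- l) k) = dot (\<lambda>i. 1) (\<lambda>k. cnt P' k + lift_int (- l') k)" by simp
    then have len: "length P = length P'" by (simp add: dot_add dot_one_lift_int flip: length_cnt)
    obtain i i' where "prefix (P @ [i]) (wd a m [j])" "prefix (P' @ [i']) (wd a m [j])"
      using 1(2) 2(2) jj by (auto simp: strictP_def)
    then have PP: "P = P'" using len by (metis append_prefixD prefix_length_prefix prefix_order.antisym order_refl)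
    then have "lift_int (- l) = lift_int (- l')" using eq by auto
    then have "- l = - l'" using lift_int_inj int_vectors_uminus 1(3) 2(3) by blast
    then show "e = e'" using jj PP 1(1) 2(1) by simp
  qed
  moreover have "f ` ?A \<subseteq> UNIV \<times> {d. \<forall>k. \<bar>d k\<bar> \<le> gapC \<rho>}"
    using D by (auto simp: f_def rel_def)
  moreover have "finite ((UNIV :: letter set) \<times> {d :: letter \<Rightarrow> int. \<forall>k. \<bar>d k\<bar> \<le> gapC \<rho>})"
    using finite_bounded_gaps by simp
  ultimately show ?thesis unfolding multD_def by (meson card_inj_on_le inj_on_finite)
next
  case True
  show ?thesis unfolding True by simp
qed

lemma Q_borel [measurable]: "Q m j \<in> sets borel"
  using compact_Q compact_imp_closed borel_closed by blast

text \<open>Folding the indicators of all pieces into the unit cube integrates the multiplicity over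
  a set of measure 1.\<close>

lemma total_area_le:
  assumes g: "good \<rho> m"
  shows "(\<Sum>j\<in>UNIV. of_nat (hgt m j) * emeasure lborel (Q m j)) \<le> of_nat (multD \<rho>)"
proof -
  define E where "E = (SIGMA j:UNIV. strictP m j)"
  have fE: "finite E" unfolding E_def using finite_strictP by auto
  define g where "g = (\<lambda>(j, P) x. indicator (Q m j) (x - val tau P) :: ennreal)"
  have gm [measurable]: "g f \<in> borel_measurable borel" for f
    by (cases f) (simp add: g_def)
  have gi: "(\<integral>\<^sup>+x. g (j, P) x \<partial>lborel) = emeasure lborel (Q m j)" for j P
  proof -
    have "(\<integral>\<^sup>+x. g (j, P) x \<partial>lborel) = (\<integral>\<^sup>+x. g (j, P) (val tau P + x) \<partial>lborel)"
      by (rule nn_integral_lborel_shift[symmetric]) measurable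
    then show ?thesis by (simp add: g_def)
  qed
  have "(\<Sum>j\<in>UNIV. of_nat (hgt m j) * emeasure lborel (Q m j)) = (\<Sum>(j, P)\<in>E. emeasure lborel (Q m j))"
    unfolding E_def by (subst sum.Sigma[symmetric]) (auto simp: finite_strictP card_strictP)
  also have "\<dots> = (\<Sum>f\<in>E. \<integral>\<^sup>+x. g f x \<partial>lborel)"
    by (intro sum.cong) (auto simp: gi)
  also have "\<dots> = (\<integral>\<^sup>+x. (\<Sum>f\<in>E. g f x) \<partial>lborel)"
    by (rule nn_integral_sum[symmetric]) measurable
  also have "\<dots> = (\<integral>\<^sup>+x. indicator cube x * (\<integral>\<^sup>+l. (\<Sum>f\<in>E. g f (x + l)) \<partial>count_space int_vectors) \<partial>lborel)"
    by (rule nn_integral_fold) measurable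
  also have "\<dots> \<le> (\<integral>\<^sup>+x. indicator cube x * of_nat (multD \<rho>) \<partial>lborel)"
  proof (intro nn_integral_mono mult_left_mono)
    fix x :: "real^2"
    define L where "L = (\<lambda>(j, P). {l \<in> int_vectors. x + l - val tau P \<in> Q m j})"
    have S: "(\<lambda>(j, P, l). ((j, P), l)) ` {(j, P, l). P \<in> strictP m j \<and> l \<in> int_vectors \<and> x + l - val tau P \<in> Q m j} = Sigma E L"
      by (auto simp: E_def L_def image_iff)
    have "inj (\<lambda>(j :: letter, P :: word, l :: real^2). ((j, P), l))" by (auto simp: inj_on_def)
    then have cS: "card (Sigma E L) \<le> multD \<rho>" "finite (Sigma E L)"
      using multiplicity[OF g, of x] S
      by (metis (no_types, lifting) card_image inj_on_subset subset_UNIV, metis (no_types, lifting) finite_imageI)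
    have fL: "finite (L f)" if "f \<in> E" for f
      by (rule finite_subset[of _ "snd ` Sigma E L"]) (use that cS(2) in force)+
    have "(\<integral>\<^sup>+l. (\<Sum>f\<in>E. g f (x + l)) \<partial>count_space int_vectors) =
      (\<Sum>f\<in>E. \<integral>\<^sup>+l. g f (x + l) \<partial>count_space int_vectors)"
      by (rule nn_integral_sum) simp
    also have "\<dots> = (\<Sum>f\<in>E. of_nat (card (L f)))"
    proof (rule sum.cong[OF refl])
      fix f assume f: "f \<in> E"
      obtain j P where jP: "f = (j, P)" by (cases f)
      have "(\<integral>\<^sup>+l. g f (x + l) \<partial>count_space int_vectors) = (\<integral>\<^sup>+l. indicator (L f) l \<partial>count_space int_vectors)"
        by (intro nn_integral_cong) (auto simp: g_def L_def jP indicator_def)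
      also have "\<dots> = emeasure (count_space int_vectors) (L f)"
        by (intro nn_integral_indicator) (auto simp: L_def jP)
      also have "\<dots> = of_nat (card (L f))"
        using fL[OF f] by (intro emeasure_count_space_finite) (auto simp: L_def jP)
      finally show "(\<integral>\<^sup>+l. g f (x + l) \<partial>count_space int_vectors) = of_nat (card (L f))" .
    qed
    also have "\<dots> = of_nat (card (Sigma E L))"
      using fE fL by (simp add: card_SigmaI)
    also have "\<dots> \<le> of_nat (multD \<rho>)" using cS(1) by simp
    finally show "(\<integral>\<^sup>+l. (\<Sum>f\<in>E. g f (x + l)) \<partial>count_space int_vectors) \<le> of_nat (multD \<rho>)" .
  qed simp
  also have "\<dots> = of_nat (multD \<rho>)"
    by (simp add: nn_integral_multc emeasure_cube)
  finally show ?thesis .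
qed

text \<open>Bad pieces cover the overlap, and over each letter they are at most the fraction \<beta>
  of equally large pieces.\<close>

lemma overlap_area_le:
  assumes g: "good \<rho> m" and \<beta>: "0 \<le> \<beta>" and b: "\<And>k. real (card (badset m k)) \<le> \<beta> * real (hgt m k)"
    and l: "l \<in> int_vectors" "l \<noteq> 0 \<or> i \<noteq> i'"
  shows "emeasure lborel (Q 0 i \<inter> (+) l ` Q 0 i') \<le> ennreal (\<beta> * real (multD \<rho>))"
proof -
  have "Q 0 i \<inter> (+) l ` Q 0 i' \<subseteq> (\<Union>j. \<Union>P\<in>badset m j. (+) (val tau P) ` Q m j)"
  proof
    fix x assume x: "x \<in> Q 0 i \<inter> (+) l ` Q 0 i'"
    then obtain j P q where 1: "prefix (P @ [i]) (wd a m [j])" "q \<in> Q m j" "x = val tau P + q"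
      using Q_0_eq[of i m] by auto
    obtain j' P' q' where 2: "prefix (P' @ [i']) (wd a m [j'])" "q' \<in> Q m j'" "x = l + (val tau P' + q')"
      using x Q_0_eq[of i' m] by auto
    have "val tau P + q = l + val tau P' + q'" using 1(3) 2(3) by (simp add: add.assoc)
    then have "P \<in> badset m j" unfolding badset_def using 1(1,2) 2(1,2) l by blast
    then show "x \<in> (\<Union>j. \<Union>P\<in>badset m j. (+) (val tau P) ` Q m j)" using 1 by blast
  qed
  moreover have TB: "(+) v ` Q m j \<in> sets borel" for v j
    using compact_Q by (intro borel_compact compact_translation)
  ultimately have "emeasure lborel (Q 0 i \<inter> (+) l ` Q 0 i')
      \<le> emeasure lborel (\<Union>j. \<Union>P\<in>badset m j. (+) (val tau P) ` Q m j)"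
    using finite_badset by (intro emeasure_mono) (auto intro!: sets.finite_UN)
  also have "\<dots> \<le> (\<Sum>j\<in>UNIV. emeasure lborel (\<Union>P\<in>badset m j. (+) (val tau P) ` Q m j))"
    using finite_badset TB by (intro emeasure_subadditive_finite) (auto intro!: sets.finite_UN)
  also have "\<dots> \<le> (\<Sum>j\<in>UNIV. \<Sum>P\<in>badset m j. emeasure lborel ((+) (val tau P) ` Q m j))"
    using finite_badset TB by (intro sum_mono emeasure_subadditive_finite) auto
  also have "\<dots> = (\<Sum>j\<in>UNIV. of_nat (card (badset m j)) * emeasure lborel (Q m j))"
    by (simp add: emeasure_lborel_shift)
  also have "\<dots> \<le> (\<Sum>j\<in>UNIV. ennreal \<beta> * (of_nat (hgt m j) * emeasure lborel (Q m j)))"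
  proof (rule sum_mono)
    fix j
    have "(of_nat (card (badset m j)) :: ennreal) = ennreal (real (card (badset m j)))"
      by (simp add: ennreal_of_nat_eq_real_of_nat)
    also have "\<dots> \<le> ennreal (\<beta> * real (hgt m j))" using b by (intro ennreal_leI)
    also have "\<dots> = ennreal \<beta> * of_nat (hgt m j)"
      using \<beta> by (simp add: ennreal_mult ennreal_of_nat_eq_real_of_nat)
    finally show "of_nat (card (badset m j)) * emeasure lborel (Q m j)
        \<le> ennreal \<beta> * (of_nat (hgt m j) * emeasure lborel (Q m j))"
      by (simp add: mult_right_mono flip: mult.assoc)
  qed
  also have "\<dots> = ennreal \<beta> * (\<Sum>j\<in>UNIV. of_nat (hgt m j) * emeasure lborel (Q m j))"
    by (simp add: sum_distrib_left)
  also have "\<dots> \<le> ennreal \<beta> * of_nat (multD \<rho>)"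
    by (intro mult_left_mono total_area_le[OF g]) simp
  also have "\<dots> = ennreal (\<beta> * real (multD \<rho>))"
    using \<beta> by (simp add: ennreal_mult ennreal_of_nat_eq_real_of_nat)
  finally show ?thesis .
qed

end

section \<open>Recurring blocks and null overlaps\<close>

locale ar_recurrent = ar_direction +
  assumes rcr: "\<And>k l. infinite {m. \<forall>j<l. a (m + j) = a (k + j)}"
begin

text \<open>Behind a block in which all letters occur, every word contains each word of level
  \<open>s\<close> and consists of boundedly many of them. The ratio depends on the block only, not
  on \<open>s\<close>.\<close>

lemma good_after_block:
  assumes L0: "full a 0 L0" and s: "\<And>i. i < L0 \<Longrightarrow> a (s + i) = a i"
  shows "good (real (Max (range (\<lambda>j. length (wd a L0 [j]))))) (s + L0)"
  unfolding good_def
proof (intro allI)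
  fix i j
  define M where "M = Max (range (hgt s))"
  have M: "hgt s k \<le> M" for k by (simp add: M_def)
  have eq: "wd (sh s a) L0 w = wd a L0 w" for w using s by (intro wd_cong) (simp add: sh_def)
  have "real (hgt (s + L0) i) = sum_list (map (\<lambda>k. real (hgt s k)) (wd a L0 [i]))"
    unfolding wd_add eq by (rule length_wd_sum_list)
  also have "\<dots> \<le> sum_list (map (\<lambda>k. real M) (wd a L0 [i]))" using M by (intro sum_list_mono) auto
  also have "\<dots> = real (length (wd a L0 [i])) * real M" by (simp add: sum_list_triv)
  also have "\<dots> \<le> real (Max (range (\<lambda>j. length (wd a L0 [j])))) * real M"
    by (intro mult_right_mono) auto
  also have "real M \<le> real (hgt (s + L0) j)"
  proof -
    have "M \<in> range (hgt s)" unfolding M_def by (intro Max_in) auto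
    then obtain k where k: "M = hgt s k" by (rule rangeE)
    obtain t where "t < L0" "a t = k" using L0 unfolding full_def by blast
    then have "k \<in> set (wd a L0 [j])" by (rule letter_in_wd)
    then have "real (hgt s k) \<le> sum_list (map (\<lambda>k. real (hgt s k)) (wd a L0 [j]))"
      by (intro member_le_sum_list) auto
    then show ?thesis by (simp only: k wd_add eq length_wd_sum_list[of a s "wd a L0 [j]"])
  qed
  then have "real (Max (range (\<lambda>j. length (wd a L0 [j])))) * real M
     \<le> real (Max (range (\<lambda>j. length (wd a L0 [j])))) * real (hgt (s + L0) j)"
    by (intro mult_left_mono) auto
  finally show "real (hgt (s + L0) i) \<le> real (Max (range (\<lambda>j. length (wd a L0 [j])))) * real (hgt (s + L0) j)" .
qed

lemma contracting_blocks:
  obtains \<rho> \<delta> where "0 < \<delta>" "\<delta> < 1"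
    "\<And>N. \<exists>n m. N \<le> n \<and> n < m \<and> good \<rho> m \<and> contracting \<rho> n m \<and> (\<forall>j. \<delta> * real (hgt m j) \<le> real (hgt n (a n)))"
proof -
  obtain L0 where L0: "full a 0 L0" using full_exists rec by blast
  define \<rho> where "\<rho> = real (Max (range (\<lambda>j. length (wd a L0 [j]))))"
  have \<rho>: "1 \<le> \<rho>"
  proof -
    have "length (wd a L0 [1]) \<le> Max (range (\<lambda>j. length (wd a L0 [j])))" by (intro Max_ge) auto
    moreover have "1 \<le> length (wd a L0 [1])" using wd_nonempty[of "[1]" a L0] by (cases "wd a L0 [1]") auto
    ultimately show ?thesis unfolding \<rho>_def by linarith
  qed
  \<comment> \<open>\<open>passes_vertex\<close> will be applied with
    \<open>C = gapC \<rho> + 1\<close>, which asks for \<open>2 * (C + 1)\<close>.\<close>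
  define r where "r = nat (2 * (gapC \<rho> + 2))"
  have "\<And>k i. \<exists>m\<ge>k. sh (Suc L0) a m = i"
    using ar_sequence.rec[OF ar_sequence_sh] by blast
  from rounds_exist[OF this, of 0] obtain ls where ls: "ls 0 = 0"
    "\<And>i. full (sh (Suc L0) a) (ls i) (ls (Suc i))" by blast
  define T0 where "T0 = ls (2 * r + 2)"
  have ls_mono: "ls i \<le> ls j" if "i \<le> j" for i j
    using that
  proof (induction j rule: dec_induct)
    case (step j)
    have "ls j < ls (Suc j)" using ls(2)[of j] unfolding full_def by (metis order_le_less_trans)
    then show ?case using step by simp
  qed simp
  \<comment> \<open>A return of the initial block, late enough for all rounds to fit in
    between.\<close>
  obtain p where p: "p \<ge> Suc L0 + T0" "\<And>i. i < L0 \<Longrightarrow> a (p + i) = a i"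
    using rcr[of L0 0] unfolding infinite_nat_iff_unbounded_le by auto
  define N0 where "N0 = real (Max (range (\<lambda>j. length (wd (sh L0 a) p [j]))))"
  have N0: "1 \<le> N0"
  proof -
    have "length (wd (sh L0 a) p [1]) \<le> Max (range (\<lambda>j. length (wd (sh L0 a) p [j])))" by (intro Max_ge) auto
    moreover have "1 \<le> length (wd (sh L0 a) p [1])" using wd_nonempty[of "[1]" "sh L0 a" p]
      by (cases "wd (sh L0 a) p [1]") auto
    ultimately show ?thesis unfolding N0_def by linarith
  qed
  \<comment> \<open>A word of level \<open>m\<close> will consist of at most \<open>N0\<close> words
    of level \<open>n\<close>, each at most \<rho> times as long as the one over \<open>a n\<close>;
    the 2 keeps \<delta> below 1.\<close>
  define \<delta> where "\<delta> = 1 / (2 * N0 * \<rho>)"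
  have N\<rho>: "1 \<le> N0 * \<rho>" using N0 \<rho> mult_mono[of 1 N0 1 \<rho>] by simp
  show ?thesis
  proof (rule that)
    show "0 < \<delta>" "\<delta> < 1" using N\<rho> by (auto simp: \<delta>_def)
    fix N
    \<comment> \<open>The stretch from the initial block through its return recurs as a whole. The
      levels \<open>n\<close> and \<open>m\<close> are the ends of the two copies of the block in
      it, so both are good.\<close>
    obtain s where s: "s \<ge> N" "\<And>i. i < p + L0 \<Longrightarrow> a (s + i) = a i"
      using rcr[of "p + L0" 0] unfolding infinite_nat_iff_unbounded_le by auto
    define n where "n = s + L0"
    define m where "m = s + p + L0"
    have nm: "N \<le> n" "n < m" using s(1) p(1) by (auto simp: n_def m_def)
    have gm: "good \<rho> m"
      unfolding \<rho>_def m_def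
    proof (rule good_after_block[OF L0])
      fix i assume i: "i < L0"
      then have "a (s + (p + i)) = a (p + i)" by (intro s(2)) auto
      then show "a (s + p + i) = a i" using p(2)[OF i] by (simp add: add.assoc)
    qed
    have gn: "good \<rho> n" unfolding \<rho>_def n_def by (rule good_after_block[OF L0]) (use s(2) in auto)
    have \<delta>le: "\<delta> * real (hgt m j) \<le> real (hgt n (a n))" for j
    proof -
      have m: "m = n + p" by (simp add: m_def n_def)
      have eq: "wd (sh n a) p w = wd (sh L0 a) p w" for w
        using s(2) by (intro wd_cong) (simp add: sh_def n_def add.assoc)
      have "real (hgt m j) = sum_list (map (\<lambda>k. real (hgt n k)) (wd (sh L0 a) p [j]))"
        unfolding m wd_add eq by (rule length_wd_sum_list)
      also have "\<dots> \<le> sum_list (map (\<lambda>k. \<rho> * real (hgt n (a n))) (wd (sh L0 a) p [j]))"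
        using gn unfolding good_def by (intro sum_list_mono) auto
      also have "\<dots> = real (length (wd (sh L0 a) p [j])) * (\<rho> * real (hgt n (a n)))"
        by (simp add: sum_list_triv)
      also have "\<dots> \<le> N0 * (\<rho> * real (hgt n (a n)))"
        using \<rho> unfolding N0_def by (intro mult_right_mono) auto
      finally have "\<delta> * real (hgt m j) \<le> \<delta> * (N0 * (\<rho> * real (hgt n (a n))))"
        using \<open>0 < \<delta>\<close> by (intro mult_left_mono) auto
      also have "\<dots> = real (hgt n (a n)) / 2" using N0 \<rho> by (simp add: \<delta>_def)
      finally show ?thesis by simp
    qed
    define b where "b = sh (Suc n) a"
    define T where "T = m - Suc n"
    have T: "T = p - 1" "T0 \<le> T" using p(1) by (auto simp: T_def m_def n_def)
    have bb: "b k = sh (Suc L0) a k" if "k < T0" for k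
    proof -
      have "a (s + (Suc L0 + k)) = a (Suc L0 + k)" using that p(1) by (intro s(2)) auto
      then show ?thesis by (simp add: b_def sh_def n_def add.assoc)
    qed
    have fl: "full b (ls i) (ls (Suc i))" if "i < 2 * r + 2" for i
      unfolding full_def
    proof
      fix j
      obtain k where k: "ls i \<le> k" "k < ls (Suc i)" "sh (Suc L0) a k = j"
        using ls(2)[of i] unfolding full_def by blast
      have "k < T0" using k(2) ls_mono[of "Suc i" "2 * r + 2"] that by (simp add: T0_def)
      then show "\<exists>k. ls i \<le> k \<and> k < ls (Suc i) \<and> b k = j" using k bb by auto
    qed
    have hg: "Coact b T (\<lambda>k. int (hgt (Suc n) k)) = (\<lambda>k. int (hgt m k))"
    proof -
      have "m = Suc n + T" using nm by (simp add: T_def)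
      then have "Coact a m (\<lambda>_. 1) = Coact b T (Coact a (Suc n) (\<lambda>_. 1 :: int))"
        by (simp only: Coact_add b_def)
      then show ?thesis by (simp only: length_wd)
    qed
    have "contracting \<rho> n m"
      unfolding contracting_def
    proof (intro allI impI)
      fix x j
      assume x: "\<forall>k. \<bar>x k\<bar> \<le> gapC \<rho> + 1" "0 \<le> dot (\<lambda>j. int (hgt m j)) x" "dot (\<lambda>j. int (hgt m j)) x \<le> int (hgt m j)"
      have "passes b T x j"
      proof (rule passes_vertex[where g = "\<lambda>k. int (hgt (Suc n) k)" and ls = ls and n = r and C = "gapC \<rho> + 1"])
        show "0 < int (hgt (Suc n) k)" for k using wd_nonempty[of "[k]" a "Suc n"] by (simp del: subst_prod.simps)
        show "ls (2 * r + 2) \<le> T" using T by (simp add: T0_def)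
        show "2 * (gapC \<rho> + 1 + 1) \<le> int r" by (simp add: r_def)
      qed (use ls(1) fl x in \<open>simp_all add: hg del: subst_prod.simps\<close>)
      then show "passes (sh (Suc n) a) (m - Suc n) x j" by (simp add: b_def T_def)
    qed
    then show "\<exists>n m. N \<le> n \<and> n < m \<and> good \<rho> m \<and> contracting \<rho> n m \<and> (\<forall>j. \<delta> * real (hgt m j) \<le> real (hgt n (a n)))"
      using nm gm \<delta>le by blast
  qed
qed

theorem overlap_null:
  assumes l: "l \<in> int_vectors" "l \<noteq> 0 \<or> i \<noteq> i'"
  shows "emeasure lborel (Q 0 i \<inter> (+) l ` Q 0 i') = 0"
proof -
  obtain \<rho> \<delta> where \<delta>: "0 < \<delta>" "\<delta> < 1"
    "\<And>N. \<exists>n m. N \<le> n \<and> n < m \<and> good \<rho> m \<and> contracting \<rho> n m \<and> (\<forall>j. \<delta> * real (hgt m j) \<le> real (hgt n (a n)))"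
    by (rule contracting_blocks) blast
  have seq: "\<exists>m. good \<rho> m \<and> (\<forall>k. real (card (badset m k)) \<le> (1 - \<delta>) ^ t * real (hgt m k))" for t
  proof (induction t)
    case 0
    obtain m where "good \<rho> m" using \<delta>(3) by blast
    moreover have "card (badset m k) \<le> hgt m k" for k
      using card_mono[OF finite_strictP badset_subset] by (simp add: card_strictP)
    ultimately show ?case by auto
  next
    case (Suc t)
    then obtain N where N: "\<And>k. real (card (badset N k)) \<le> (1 - \<delta>) ^ t * real (hgt N k)" by blast
    obtain n m where nm: "N \<le> n" "n < m" "good \<rho> m" "contracting \<rho> n m"
      "\<And>j. \<delta> * real (hgt m j) \<le> real (hgt n (a n))"
      using \<delta>(3) by blast
    have "real (card (badset n k)) \<le> (1 - \<delta>) ^ t * real (hgt n k)" for k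
      by (rule bad_fraction_mono[OF nm(1) N])
    then have "real (card (badset m k)) \<le> ((1 - \<delta>) * (1 - \<delta>) ^ t) * real (hgt m k)" for k
      using \<delta>(2) by (intro bad_fraction_contract[OF nm(2-5)]) auto
    then show ?case using nm(3) by auto
  qed
  have le: "emeasure lborel (Q 0 i \<inter> (+) l ` Q 0 i') \<le> ennreal ((1 - \<delta>) ^ t * real (multD \<rho>))" for t
  proof -
    obtain m where "good \<rho> m" "\<And>k. real (card (badset m k)) \<le> (1 - \<delta>) ^ t * real (hgt m k)"
      using seq[of t] by blast
    then show ?thesis using \<delta>(2) by (intro overlap_area_le[OF _ _ _ l]) auto
  qed
  have "(\<lambda>t. (1 - \<delta>) ^ t * real (multD \<rho>)) \<longlonglongrightarrow> 0 * real (multD \<rho>)"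
    using \<delta> by (intro tendsto_intros LIMSEQ_power_zero) auto
  then have "(\<lambda>t. ennreal ((1 - \<delta>) ^ t * real (multD \<rho>))) \<longlonglongrightarrow> ennreal 0"
    by (intro tendsto_ennrealI) simp
  then have "emeasure lborel (Q 0 i \<inter> (+) l ` Q 0 i') \<le> ennreal 0"
    using le by (intro LIMSEQ_le_const) auto
  then show ?thesis by simp
qed

end

section \<open>Rotations of the torus\<close>

lemma int_vectors_shift_infdist:
  fixes F :: "(real^2) set"
  assumes "\<And>x l. l \<in> int_vectors \<Longrightarrow> x + l \<in> F \<longleftrightarrow> x \<in> F" "l \<in> int_vectors"
  shows "infdist (x + l) F = infdist x F"
proof (cases "F = {}")
  case False
  have le: "infdist (x + l) F \<le> infdist x F" if "l \<in> int_vectors" for x l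
  proof (rule cInf_greatest[of "dist x ` F" "infdist (x + l) F", folded infdist_notempty[OF False]])
    show "dist x ` F \<noteq> {}" using False by simp
    fix d assume "d \<in> dist x ` F"
    then obtain y where y: "y \<in> F" "d = dist x y" by blast
    then have "y + l \<in> F" using assms(1)[OF that] by blast
    then have "infdist (x + l) F \<le> dist (x + l) (y + l)" by (rule infdist_le)
    then show "infdist (x + l) F \<le> d" using y by (simp add: dist_norm)
  qed
  from le[of l x] le[of "- l" "x + l"] assms(2) int_vectors_uminus[OF assms(2)] show ?thesis by simp
qed (simp add: infdist_def)

lemma infdist_lipschitz: "infdist x F \<le> infdist y F + dist x y" for x y :: "'a::metric_space"
  using infdist_triangle[of x F y] by simp

lemma torus_translation_eq: "torus_translation t x = (x + t :: real^2) - floor_vec (x + t)"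
  by (simp add: torus_translation_def floor_vec_def vec_eq_iff frac_def)

lemma diff_floor_vec_cube: "x - floor_vec x \<in> cube"
  using diff_mem_cube_iff[OF floor_vec_int] by blast

lemma torus_eq: "(torus :: (real^2) measure) = restrict_space lborel cube"
  by (simp add: torus_def cube_def)

lemma sets_torus: "sets (torus :: (real^2) measure) = sets (restrict_space borel cube)"
  by (simp add: torus_eq sets_restrict_space)

lemma space_torus: "space (torus :: (real^2) measure) = cube"
  by (simp add: torus_eq space_restrict_space)

lemma nn_integral_torus:
  fixes f :: "real^2 \<Rightarrow> ennreal"
  shows "(\<integral>\<^sup>+x. f x \<partial>torus) = (\<integral>\<^sup>+x. indicator cube x * f x \<partial>lborel)"
  unfolding torus_eq by (subst nn_integral_restrict_space) (auto simp: mult.commute)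

lemma prob_space_torus: "prob_space (torus :: (real^2) measure)"
proof
  have "emeasure (torus :: (real^2) measure) cube = emeasure lborel cube"
    unfolding torus_eq by (rule emeasure_restrict_space) auto
  then show "emeasure (torus :: (real^2) measure) (space torus) = 1"
    by (simp add: space_torus emeasure_cube)
qed

text \<open>A translated unit cube is again a fundamental domain, so a periodic function has the
  same integral over it.\<close>

lemma nn_integral_cube_translate:
  fixes g :: "real^2 \<Rightarrow> ennreal"
  assumes [measurable]: "g \<in> borel_measurable borel" and per: "\<And>x l. l \<in> int_vectors \<Longrightarrow> g (x + l) = g x"
  shows "(\<integral>\<^sup>+s. indicator cube s * g (x + s) \<partial>lborel) = (\<integral>\<^sup>+s. indicator cube s * g s \<partial>lborel)"
proof -
  have one: "(\<integral>\<^sup>+l. indicator cube (y + l) \<partial>count_space int_vectors) = 1" for y :: "real^2"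
  proof -
    have "y + l \<in> cube \<longleftrightarrow> l = - floor_vec y" if "l \<in> int_vectors" for l
      using diff_mem_cube_iff[OF int_vectors_uminus[OF that], of y]
      by (metis diff_minus_eq_add minus_minus)
    then have "(\<integral>\<^sup>+l. indicator cube (y + l) \<partial>count_space int_vectors) =
       (\<integral>\<^sup>+l. indicator {- floor_vec y} l \<partial>count_space int_vectors)"
      by (intro nn_integral_cong) (auto simp: indicator_def)
    also have "\<dots> = emeasure (count_space int_vectors) {- floor_vec y}"
      by (intro nn_integral_indicator) (simp add: int_vectors_uminus floor_vec_int)
    also have "\<dots> = 1" by (simp add: int_vectors_uminus floor_vec_int)
    finally show ?thesis .
  qed
  have "(\<integral>\<^sup>+s. indicator cube s * g (x + s) \<partial>lborel) = (\<integral>\<^sup>+s. indicator cube (- x + (x + s)) * g (x + s) \<partial>lborel)"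
    by simp
  also have "\<dots> = (\<integral>\<^sup>+s. indicator cube (- x + s) * g s \<partial>lborel)"
    by (rule nn_integral_lborel_shift[of "\<lambda>s. indicator cube (- x + s) * g s" x]) measurable
  also have "\<dots> = (\<integral>\<^sup>+s. indicator cube s * (\<integral>\<^sup>+l. indicator cube (- x + (s + l)) * g (s + l) \<partial>count_space int_vectors) \<partial>lborel)"
    by (rule nn_integral_fold) measurable
  also have "\<dots> = (\<integral>\<^sup>+s. indicator cube s * g s \<partial>lborel)"
  proof (intro nn_integral_cong arg_cong2[where f = "(*)"] refl)
    fix s :: "real^2"
    have "(\<integral>\<^sup>+l. indicator cube (- x + (s + l)) * g (s + l) \<partial>count_space int_vectors) =
       (\<integral>\<^sup>+l. indicator cube ((- x + s) + l) * g s \<partial>count_space int_vectors)"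
    proof (rule nn_integral_cong)
      fix l :: "real^2" assume "l \<in> space (count_space int_vectors)"
      then have "g (s + l) = g s" using per by simp
      moreover have "- x + (s + l) = (- x + s) + l" by (simp only: add.assoc)
      ultimately show "indicator cube (- x + (s + l)) * g (s + l) = indicator cube ((- x + s) + l) * g s"
        by (simp only:)
    qed
    also have "\<dots> = g s" by (simp add: nn_integral_multc one)
    finally show "(\<integral>\<^sup>+l. indicator cube (- x + (s + l)) * g (s + l) \<partial>count_space int_vectors) = g s" .
  qed
  finally show ?thesis .
qed

lemma fractional_part_measurable: "(\<lambda>x :: real^2. x - floor_vec x) \<in> borel_measurable borel"
proof -
    have "(\<lambda>x :: real^2. x - floor_vec x) = (\<lambda>x. \<chi> i. x $ i - of_int \<lfloor>x $ i\<rfloor>)"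
      by (simp add: floor_vec_def vec_eq_iff fun_eq_iff)
    also have "\<dots> \<in> borel_measurable borel"
    proof (rule borel_measurable_euclidean_space[THEN iffD2], intro ballI)
      fix b :: "real^2" assume "b \<in> Basis"
      then obtain i where b: "b = axis i 1" by (auto simp: Basis_vec_def)
      show "(\<lambda>x :: real^2. (\<chi> i. x $ i - of_int \<lfloor>x $ i\<rfloor>) \<bullet> b) \<in> borel_measurable borel"
        unfolding b by (simp add: inner_axis)
    qed
    finally show ?thesis .
qed

lemma torus_translation_measurable: "torus_translation t \<in> measurable torus (torus :: (real^2) measure)"
proof -
  have "(\<lambda>x. (x + t :: real^2) - floor_vec (x + t)) \<in> borel_measurable borel"
    by (rule measurable_compose[OF _ fractional_part_measurable]) measurable
  then show ?thesis
    unfolding measurable_cong_sets[OF sets_torus sets_torus]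
    by (intro measurable_restrict_space2 measurable_restrict_space1)
      (auto simp: space_restrict_space torus_translation_eq[abs_def] diff_floor_vec_cube)
qed

lemma restrict_borel_measurable_torus:
  "sets \<nu> = sets (torus :: (real^2) measure) \<Longrightarrow> f \<in> borel_measurable borel \<Longrightarrow> f \<in> borel_measurable \<nu>"
  using measurable_cong_sets[of \<nu> "restrict_space borel cube" borel borel] sets_torus
  by (auto intro: measurable_restrict_space1)

theorem torus_translation_invariant: "distr torus torus (torus_translation t) = (torus :: (real^2) measure)"
proof (rule measure_eqI)
  fix A assume "A \<in> sets (distr torus torus (torus_translation t :: real^2 \<Rightarrow> _))"
  then have At: "A \<in> sets torus" by simp
  then have A: "A \<in> sets borel" "A \<subseteq> cube"
    unfolding sets_torus by (auto simp: sets_restrict_space)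
  define g where "g x = (indicator A (x - floor_vec x) :: ennreal)" for x
  have fv: "floor_vec (x + l) = floor_vec x + l" if l: "l \<in> int_vectors" for x l
  proof -
    have "x + l - (floor_vec x + l) \<in> cube" using diff_floor_vec_cube[of x] by simp
    then show ?thesis using diff_mem_cube_iff[OF int_vectors_add[OF floor_vec_int[of x] l], of "x + l"] by simp
  qed
  have per: "g (x + l) = g x" if "l \<in> int_vectors" for x l
    by (simp add: g_def fv[OF that])
  have gA: "indicator cube x * g x = indicator A x" for x
    using A(2) diff_mem_cube_iff[OF int_vectors_zero, of x] by (auto simp: g_def indicator_def)
  have gm [measurable]: "g \<in> borel_measurable borel"
    unfolding g_def using A(1) fractional_part_measurable by measurable
  have "emeasure (distr torus torus (torus_translation t)) A = (\<integral>\<^sup>+x. indicator A x \<partial>distr torus torus (torus_translation t))"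
    using At by simp
  also have "\<dots> = (\<integral>\<^sup>+x. indicator A (torus_translation t x) \<partial>torus)"
    using At by (intro nn_integral_distr torus_translation_measurable) auto
  also have "\<dots> = (\<integral>\<^sup>+x. indicator cube x * g (t + x) \<partial>lborel)"
    unfolding nn_integral_torus by (simp add: g_def torus_translation_eq add.commute)
  also have "\<dots> = (\<integral>\<^sup>+x. indicator cube x * g x \<partial>lborel)"
    by (rule nn_integral_cube_translate[OF gm per])
  also have "\<dots> = (\<integral>\<^sup>+x. indicator A x \<partial>lborel)" by (simp add: gA)
  also have "\<dots> = emeasure torus A"
    using A unfolding torus_eq by (simp add: emeasure_restrict_space)
  finally show "emeasure (distr torus torus (torus_translation t)) A = emeasure torus A" .
qed simp

context ar_direction
begin

text \<open>Any \<open>tau j\<close> would give the same rotation, since all of them agree modulo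
  the lattice.\<close>

definition "tt = tau 3"

lemma val_tau_tt: "val tau w - real (length w) *\<^sub>R tt \<in> int_vectors"
proof (induction w)
  case (Cons j w)
  have "tau j - tt \<in> int_vectors"
    by (auto simp: tt_def tau_def int_vectors_def forall_2)
  from int_vectors_add[OF this Cons] show ?case by (simp add: algebra_simps)
qed simp

text \<open>
  The integral of the translates of a periodic Lipschitz function is a continuous function of the
  translation vector and invariant under the dense group generated by \<open>tt\<close> and the lattice, hence constant, and averaging it over the torus gives the Lebesgue integral.
\<close>

lemma unique_ergodicity:
  assumes prob: "prob_space \<nu>" and sets: "sets \<nu> = sets (torus :: (real^2) measure)"
    and inv: "distr \<nu> \<nu> (torus_translation tt) = \<nu>"
  shows "\<nu> = torus"
proof -
  interpret prob_space \<nu> by (rule prob)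
  interpret tor: prob_space "torus :: (real^2) measure" by (rule prob_space_torus)
  interpret P: pair_sigma_finite \<nu> "torus :: (real^2) measure" ..
  have spn: "space \<nu> = cube" using sets_eq_imp_space_eq[OF sets] by (simp add: space_torus)
  have Tm: "torus_translation tt \<in> measurable \<nu> \<nu>"
    using torus_translation_measurable measurable_cong_sets[OF sets sets] by blast
  note bm = restrict_borel_measurable_torus[OF sets]
  have key: "(\<integral>\<^sup>+x. ennreal (f x) \<partial>\<nu>) = (\<integral>\<^sup>+x. ennreal (f x) \<partial>torus)"
    if f0: "\<And>x. 0 \<le> f x" and f1: "\<And>x. f x \<le> 1" and per: "\<And>x l. l \<in> int_vectors \<Longrightarrow> f (x + l) = f x"
      and K: "0 \<le> K" and lip: "\<And>x y. f x \<le> f y + K * dist x y"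
    for f :: "real^2 \<Rightarrow> real" and K
  proof -
    have cont: "continuous_on UNIV f"
      unfolding continuous_on_iff
    proof (intro ballI allI impI)
      fix x :: "real^2" and e :: real assume "0 < e"
      show "\<exists>d>0. \<forall>x'\<in>UNIV. dist x' x < d \<longrightarrow> dist (f x') (f x) < e"
      proof (intro exI[of _ "e / (K + 1)"] conjI ballI impI)
        show "0 < e / (K + 1)" using \<open>0 < e\<close> K by simp
        fix x' assume d: "dist x' x < e / (K + 1)"
        have "dist (f x') (f x) \<le> K * dist x' x"
          using lip[of x' x] lip[of x x'] by (simp add: dist_real_def dist_commute abs_le_iff)
        also have "\<dots> \<le> (K + 1) * dist x' x" by (intro mult_right_mono) auto
        also have "\<dots> < e" using d K by (simp add: less_divide_eq mult.commute)
        finally show "dist (f x') (f x) < e" .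
      qed
    qed
    then have fm [measurable]: "f \<in> borel_measurable borel" by (rule borel_measurable_continuous_onI)
    define I where "I s = (\<integral>\<^sup>+x. ennreal (f (x + s)) \<partial>\<nu>)" for s
    have fsm: "(\<lambda>x. ennreal (f (x + s))) \<in> borel_measurable \<nu>" for s by (rule bm) measurable
    have I_l: "I (s + l) = I s" if "l \<in> int_vectors" for s l
      using per[OF that] by (simp add: I_def flip: add.assoc)
    have I_t: "I (s + tt) = I s" for s
    proof -
      have "I s = (\<integral>\<^sup>+x. ennreal (f (x + s)) \<partial>distr \<nu> \<nu> (torus_translation tt))" by (simp add: I_def inv)
      also have "\<dots> = (\<integral>\<^sup>+x. ennreal (f (torus_translation tt x + s)) \<partial>\<nu>)"
        by (rule nn_integral_distr[OF Tm]) (simp add: fsm)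
      also have "\<dots> = I (s + tt)"
        unfolding I_def
      proof (rule nn_integral_cong)
        fix x
        have "x + (s + tt) = (torus_translation tt x + s) + floor_vec (x + tt)"
          by (simp add: torus_translation_eq algebra_simps)
        from arg_cong[OF this, of f] have "f (x + (s + tt)) = f (torus_translation tt x + s)"
          by (simp only: per[OF floor_vec_int])
        then show "ennreal (f (torus_translation tt x + s)) = ennreal (f (x + (s + tt)))" by simp
      qed
      finally show ?thesis by simp
    qed
    have I_nt: "I (real n *\<^sub>R tt) = I 0" for n
    proof (induction n)
      case (Suc n)
      have "real (Suc n) *\<^sub>R tt = real n *\<^sub>R tt + tt" by (simp add: algebra_simps)
      then show ?case using I_t Suc by simp
    qed simp
    have I_w: "I (val tau w) = I 0" for w
      using I_l[OF val_tau_tt[of w], of "real (length w) *\<^sub>R tt"] I_nt by simp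
    have I_lip: "I s \<le> I s' + ennreal (K * dist s s')" for s s'
    proof -
      have "I s \<le> (\<integral>\<^sup>+x. ennreal (f (x + s')) + ennreal (K * dist s s') \<partial>\<nu>)"
        unfolding I_def
      proof (rule nn_integral_mono)
        fix x
        have "f (x + s) \<le> f (x + s') + K * dist s s'" using lip[of "x + s" "x + s'"] by simp
        then show "ennreal (f (x + s)) \<le> ennreal (f (x + s')) + ennreal (K * dist s s')"
          using f0 K by (simp add: ennreal_leI flip: ennreal_plus)
      qed
      also have "\<dots> = I s' + ennreal (K * dist s s')"
        unfolding I_def by (subst nn_integral_add[OF fsm]) (auto simp: emeasure_space_1)
      finally show ?thesis .
    qed
    have I_const: "I s = I 0" for s
    proof (rule antisym)
      have near: "\<exists>w. K * dist (val tau w) s \<le> e" if e0: "0 < e" for e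
      proof -
        have "0 < e / (K + 1)" using e0 K by simp
        then obtain w where "dist (val tau w) s < e / (K + 1)" using val_tau_dense by blast
        then have "(K + 1) * dist (val tau w) s < e" using K by (simp add: less_divide_eq mult.commute)
        moreover have "K * dist (val tau w) s \<le> (K + 1) * dist (val tau w) s" by (intro mult_right_mono) auto
        ultimately show ?thesis by (intro exI[of _ w]) linarith
      qed
      show "I s \<le> I 0"
      proof (rule ennreal_le_epsilon)
        fix e :: real assume "0 < e"
        then obtain w where "K * dist (val tau w) s \<le> e" using near by blast
        then show "I s \<le> I 0 + ennreal e"
          using I_lip[of s "val tau w"] I_w[of w] by (metis add_left_mono dist_commute ennreal_leI order_trans)
      qed
      show "I 0 \<le> I s"
      proof (rule ennreal_le_epsilon)
        fix e :: real assume "0 < e"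
        then obtain w where "K * dist (val tau w) s \<le> e" using near by blast
        then show "I 0 \<le> I s + ennreal e"
          using I_lip[of "val tau w" s] I_w[of w] by (metis add_left_mono ennreal_leI order_trans)
      qed
    qed
    have "(\<integral>\<^sup>+x. ennreal (f x) \<partial>\<nu>) = I 0" by (simp add: I_def)
    also have "\<dots> = (\<integral>\<^sup>+s. I 0 \<partial>(torus :: (real^2) measure))" by (simp add: tor.emeasure_space_1)
    also have "\<dots> = (\<integral>\<^sup>+s. I s \<partial>torus)" by (rule nn_integral_cong) (rule I_const[symmetric])
    also have "\<dots> = (\<integral>\<^sup>+s. (\<integral>\<^sup>+x. ennreal (f (x + s)) \<partial>\<nu>) \<partial>torus)" by (simp add: I_def)
    also have "\<dots> = (\<integral>\<^sup>+x. (\<integral>\<^sup>+s. ennreal (f (x + s)) \<partial>torus) \<partial>\<nu>)"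
    proof (rule P.Fubini')
      have id1: "(\<lambda>x. x) \<in> measurable \<nu> borel" by (rule bm) simp
      have id2: "(\<lambda>x. x) \<in> measurable (torus :: (real^2) measure) borel"
        by (rule restrict_borel_measurable_torus) simp_all
      have "(\<lambda>p. fst p + snd p) \<in> borel_measurable (\<nu> \<Otimes>\<^sub>M (torus :: (real^2) measure))"
        using measurable_compose[OF measurable_fst id1] measurable_compose[OF measurable_snd id2]
        by (intro borel_measurable_add) auto
      then show "(\<lambda>(x, s). ennreal (f (x + s))) \<in> borel_measurable (\<nu> \<Otimes>\<^sub>M torus)"
        unfolding case_prod_beta by measurable
    qed
    also have "\<dots> = (\<integral>\<^sup>+x. (\<integral>\<^sup>+s. ennreal (f s) \<partial>torus) \<partial>\<nu>)"
      unfolding nn_integral_torus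
      by (intro nn_integral_cong nn_integral_cube_translate[of "\<lambda>s. ennreal (f s)"]) (auto simp: per)
    also have "\<dots> = (\<integral>\<^sup>+s. ennreal (f s) \<partial>torus)" by (simp add: emeasure_space_1)
    finally show ?thesis .
  qed
  have open_per: "emeasure \<nu> (W \<inter> cube) = emeasure torus (W \<inter> cube)"
    if W: "open W" and perW: "\<And>x l. l \<in> int_vectors \<Longrightarrow> x + l \<in> W \<longleftrightarrow> x \<in> W" for W :: "(real^2) set"
  proof (cases "W = UNIV")
    case True
    then show ?thesis using emeasure_space_1 tor.emeasure_space_1 by (simp add: spn space_torus)
  next
    case False
    define F where "F = - W"
    have F: "closed F" "F \<noteq> {}" using W False by (auto simp: F_def)
    \<comment> \<open>Periodic Lipschitz functions increasing to the indicator of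
      \<open>W\<close>.\<close>
    define f where "f k x = min 1 (real k * infdist x F)" for k :: nat and x :: "real^2"
    have eq: "(\<integral>\<^sup>+x. ennreal (f k x) \<partial>\<nu>) = (\<integral>\<^sup>+x. ennreal (f k x) \<partial>torus)" for k
    proof (rule key)
      show "f k (x + l) = f k x" if "l \<in> int_vectors" for x l
        unfolding f_def using int_vectors_shift_infdist[of F l x] perW that by (simp add: F_def)
      show "f k x \<le> f k y + real k * dist x y" for x y
      proof -
        have "real k * infdist x F \<le> real k * (infdist y F + dist x y)"
          by (intro mult_left_mono infdist_lipschitz) auto
        then have "real k * infdist x F \<le> real k * infdist y F + real k * dist x y" by (simp only: distrib_left)
        moreover have "min 1 p \<le> min 1 q + r" if "p \<le> q + r" "0 \<le> r" for p q r :: real using that by linarith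
        ultimately show ?thesis unfolding f_def by simp
      qed
      show "0 \<le> f k x" "f k x \<le> 1" for x by (auto simp: f_def infdist_nonneg)
    qed simp
    have "continuous_on UNIV (\<lambda>x. infdist x F)" by (intro continuous_intros)
    then have idm [measurable]: "(\<lambda>x. infdist x F) \<in> borel_measurable borel"
      by (rule borel_measurable_continuous_onI)
    have inc: "incseq (\<lambda>k x. ennreal (f k x))"
    proof (intro incseq_SucI le_funI ennreal_leI)
      fix k x
      have "real k * infdist x F \<le> real (Suc k) * infdist x F"
        by (intro mult_right_mono infdist_nonneg) auto
      then show "f k x \<le> f (Suc k) x" unfolding f_def by (intro min.mono) auto
    qed
    have sup: "(SUP k. ennreal (f k x)) = indicator W x" for x
    proof (cases "x \<in> W")
      case True
      then have "infdist x F \<noteq> 0" using F in_closed_iff_infdist_zero[of F x] by (auto simp: F_def)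
      then have p: "0 < infdist x F" using infdist_nonneg[of x F] by linarith
      obtain k :: nat where "1 / infdist x F < k" using reals_Archimedean2 by blast
      then have "1 \<le> real k * infdist x F" using p by (simp add: divide_less_eq)
      then have "f k x = 1" by (simp add: f_def)
      then have "1 \<le> (SUP k. ennreal (f k x))" by (metis SUP_upper UNIV_I ennreal_1)
      moreover have "(SUP k. ennreal (f k x)) \<le> 1" by (intro SUP_least) (simp add: f_def)
      ultimately have "(SUP k. ennreal (f k x)) = 1" by (intro antisym)
      then show ?thesis using True by (simp only: indicator_simps)
    next
      case False
      then have "infdist x F = 0" by (simp add: F_def)
      then show ?thesis using False by (simp add: f_def)
    qed
    have conv: "emeasure \<mu> (W \<inter> cube) = (SUP k. \<integral>\<^sup>+x. ennreal (f k x) \<partial>\<mu>)"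
      if s: "sets \<mu> = sets (torus :: (real^2) measure)" for \<mu>
    proof -
      have fm: "(\<lambda>x. ennreal (f k x)) \<in> borel_measurable \<mu>" for k
        by (rule restrict_borel_measurable_torus[OF s]) (simp add: f_def)
      have sp: "space \<mu> = cube" using sets_eq_imp_space_eq[OF s] by (simp add: space_torus)
      have "W \<inter> cube \<in> sets \<mu>" using W unfolding s sets_torus by (auto simp: sets_restrict_space)
      then have "emeasure \<mu> (W \<inter> cube) = (\<integral>\<^sup>+x. indicator (W \<inter> cube) x \<partial>\<mu>)" by simp
      also have "\<dots> = (\<integral>\<^sup>+x. (SUP k. ennreal (f k x)) \<partial>\<mu>)"
        by (intro nn_integral_cong) (simp add: sup sp indicator_def)
      also have "\<dots> = (SUP k. \<integral>\<^sup>+x. ennreal (f k x) \<partial>\<mu>)"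
        by (rule nn_integral_monotone_convergence_SUP[OF inc fm])
      finally show ?thesis .
    qed
    show ?thesis by (simp add: conv[OF sets] conv eq)
  qed
  \<comment> \<open>The lattice translates of an open subset of the open unit box form a periodic
    open set that meets the cube only in the given subset. The rest of the cube is null for both
    measures, as the whole box already has measure 1.\<close>
  have inner: "emeasure \<nu> (U \<inter> box 0 1) = emeasure torus (U \<inter> box 0 1)" if U: "open U" for U :: "(real^2) set"
  proof -
    define V where "V = U \<inter> box 0 1"
    define W where "W = (\<Union>l\<in>int_vectors. (+) l ` V)"
    have Vc: "V \<subseteq> cube" by (auto simp: V_def cube_def mem_box_cart less_imp_le)
    have "open W" unfolding W_def V_def using U by (intro open_UN ballI open_translation open_Int open_box)
    moreover have "x + l \<in> W \<longleftrightarrow> x \<in> W" if l: "l \<in> int_vectors" for x l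
    proof
      assume "x + l \<in> W"
      then obtain k v where "k \<in> int_vectors" "v \<in> V" "x + l = k + v" by (auto simp: W_def)
      then have "k - l \<in> int_vectors" "x = (k - l) + v" "v \<in> V"
        using l by (auto intro: int_vectors_diff simp: algebra_simps)
      then show "x \<in> W" unfolding W_def by blast
    next
      assume "x \<in> W"
      then obtain k v where "k \<in> int_vectors" "v \<in> V" "x = k + v" by (auto simp: W_def)
      then have "k + l \<in> int_vectors" "x + l = (k + l) + v" "v \<in> V"
        using l by (auto intro: int_vectors_add simp: algebra_simps)
      then show "x + l \<in> W" unfolding W_def by blast
    qed
    moreover have "W \<inter> cube = V"
    proof
      show "V \<subseteq> W \<inter> cube" using Vc unfolding W_def by force
      show "W \<inter> cube \<subseteq> V"
      proof
        fix x assume "x \<in> W \<inter> cube"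
        then obtain k v where k: "k \<in> int_vectors" "v \<in> V" "x = k + v" "x \<in> cube" by (auto simp: W_def)
        then have "x - k \<in> cube" "x - 0 \<in> cube" using Vc by auto
        then have "k = 0" using diff_mem_cube_iff[OF k(1)] diff_mem_cube_iff[OF int_vectors_zero] by metis
        then show "x \<in> V" using k by simp
      qed
    qed
    ultimately show ?thesis using open_per[of W] by (simp add: V_def)
  qed
  have full: "emeasure \<nu> (box 0 1) = 1" "emeasure torus (box 0 (1 :: real^2)) = 1"
  proof -
    have "(box 0 1 :: (real^2) set) \<subseteq> cube" by (auto simp: cube_def mem_box_cart less_imp_le)
    then have "emeasure torus (box 0 (1 :: real^2)) = emeasure lborel (box 0 (1 :: real^2))"
      unfolding torus_eq by (intro emeasure_restrict_space) auto
    moreover have "(1 :: real^2) \<bullet> b = 1" if "b \<in> Basis" for b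
      using that by (auto simp: Basis_vec_def inner_axis)
    ultimately show "emeasure torus (box 0 (1 :: real^2)) = 1" by (simp add: emeasure_lborel_box_eq)
    then show "emeasure \<nu> (box 0 1) = 1" using inner[of UNIV] by simp
  qed
  have boxc: "box 0 (1 :: real^2) \<subseteq> cube" by (auto simp: cube_def mem_box_cart less_imp_le)
  have all_open: "emeasure \<mu> (U \<inter> cube) = emeasure \<mu> (U \<inter> box 0 1)"
    if U: "open U" and s: "sets \<mu> = sets (torus :: (real^2) measure)" and p: "prob_space \<mu>"
      and b1: "emeasure \<mu> (box 0 1) = 1" for U :: "(real^2) set" and \<mu>
  proof (rule emeasure_eq_AE)
    interpret m: prob_space \<mu> by (rule p)
    have bs: "U' \<inter> cube \<in> sets \<mu>" if "open U'" for U' using that unfolding s sets_torus by (auto simp: sets_restrict_space)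
    have "box 0 1 \<inter> cube = box 0 1" using boxc by auto
    then have b: "box 0 1 \<in> sets \<mu>" using bs[OF open_box[of 0 1]] by simp
    have "AE x in \<mu>. x \<in> box 0 1" using b1 b by (intro m.AE_prob_1) (simp add: m.emeasure_eq_measure)
    then show "AE x in \<mu>. (x \<in> U \<inter> cube) = (x \<in> U \<inter> box 0 1)"
      by eventually_elim (use boxc in auto)
    show "U \<inter> cube \<in> sets \<mu>" using bs U by blast
    have "U \<inter> box 0 1 = (U \<inter> cube) \<inter> box 0 1" using boxc by auto
    then show "U \<inter> box 0 1 \<in> sets \<mu>" using bs[OF U] b by auto
  qed
  show "\<nu> = torus"
  proof (rule measure_eqI_generator_eq[where E = "(\<lambda>U. U \<inter> cube) ` {U. open U}" and \<Omega> = cube and A = "\<lambda>_. cube"])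
    show "Int_stable ((\<lambda>U. U \<inter> cube) ` {U. open U})"
    proof (rule Int_stableI)
      fix A B assume "A \<in> (\<lambda>U. U \<inter> cube) ` {U. open U}" "B \<in> (\<lambda>U. U \<inter> cube) ` {U. open U}"
      then obtain U V where "open U" "open V" "A = U \<inter> cube" "B = V \<inter> cube" by blast
      then have "A \<inter> B = (U \<inter> V) \<inter> cube" "open (U \<inter> V)" by auto
      then show "A \<inter> B \<in> (\<lambda>U. U \<inter> cube) ` {U. open U}" by blast
    qed
    show "(\<lambda>U. U \<inter> cube) ` {U. open U} \<subseteq> Pow cube" by auto
    have sg: "sets (torus :: (real^2) measure) = sigma_sets cube ((\<lambda>U. U \<inter> cube) ` {U. open U})"
    proof -
      have "sets (torus :: (real^2) measure) = (\<inter>) cube ` sigma_sets UNIV {U. open U}"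
        unfolding sets_torus sets_restrict_space borel_def by simp
      also have "\<dots> = sigma_sets cube ((\<inter>) cube ` {U. open U})"
        using sigma_sets_Int[of cube UNIV "{U. open U}"]
        by (metis (no_types, lifting) cube_borel borel_def sets_measure_of Pow_UNIV subset_UNIV)
      finally show ?thesis by (simp add: Int_commute)
    qed
    show "sets \<nu> = sigma_sets cube ((\<lambda>U. U \<inter> cube) ` {U. open U})" using sets sg by simp
    show "sets torus = sigma_sets cube ((\<lambda>U. U \<inter> cube) ` {U. open U})" by (rule sg)
    show "range (\<lambda>_. cube) \<subseteq> (\<lambda>U. U \<inter> cube) ` {U. open U}" by (auto intro!: image_eqI[of _ _ UNIV])
    show "(\<Union>i. cube) = cube" by simp
    show "emeasure \<nu> cube \<noteq> \<infinity>" for i :: nat using emeasure_space_1 spn by simp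
    fix X assume "X \<in> (\<lambda>U. U \<inter> cube) ` {U. open U}"
    then obtain U where "open U" "X = U \<inter> cube" by blast
    then show "emeasure \<nu> X = emeasure torus X"
      using all_open[OF _ sets prob full(1)] all_open[OF _ refl prob_space_torus full(2)] inner by simp
  qed
qed

end

section \<open>Coding\<close>

definition fr :: "real^2 \<Rightarrow> real^2" where
  "fr x = x - floor_vec x"

lemma fr_cube: "fr x \<in> cube"
  by (simp add: fr_def diff_floor_vec_cube)

lemma fr_eqI: "y \<in> cube \<Longrightarrow> x - y \<in> int_vectors \<Longrightarrow> fr x = y"
proof -
  assume y: "y \<in> cube" "x - y \<in> int_vectors"
  then have e: "x - y = floor_vec x" using diff_mem_cube_iff[of "x - y" x] by simp
  show ?thesis unfolding fr_def e[symmetric] by simp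
qed

lemma fr_cong:
  assumes "x - y \<in> int_vectors"
  shows "fr x = fr y"
proof (rule fr_eqI[OF fr_cube])
  have "x - fr y = (x - y) + floor_vec y" by (simp add: fr_def)
  then show "x - fr y \<in> int_vectors" using assms int_vectors_add floor_vec_int by metis
qed

lemma torus_translation_fr: "torus_translation t x = fr (x + t)"
  by (simp add: torus_translation_eq fr_def)

lemma fr_measurable [measurable]: "fr \<in> borel_measurable borel"
  using fractional_part_measurable by (simp add: fr_def[abs_def])

section \<open>Points lying in a single tile\<close>

context ar_recurrent
begin

definition "overlaps = {z. \<exists>l l' i i'. l \<in> int_vectors \<and> l' \<in> int_vectors \<and> (l \<noteq> l' \<or> i \<noteq> i') \<and>
    z - l \<in> Q 0 i \<and> z - l' \<in> Q 0 i'}"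

lemma overlaps_null: "overlaps \<in> null_sets lborel"
proof -
  have "overlaps = (\<Union>l\<in>int_vectors. \<Union>l'\<in>int_vectors. \<Union>i. \<Union>i'.
      if l \<noteq> l' \<or> i \<noteq> i' then (+) l ` (Q 0 i \<inter> (+) (l' - l) ` Q 0 i') else {})" (is "_ = ?U")
  proof
    show "overlaps \<subseteq> ?U"
    proof
      fix z assume "z \<in> overlaps"
      then obtain l l' i i' where z: "l \<in> int_vectors" "l' \<in> int_vectors" "l \<noteq> l' \<or> i \<noteq> i'"
        "z - l \<in> Q 0 i" "z - l' \<in> Q 0 i'" unfolding overlaps_def by blast
      have "z - l \<in> (+) (l' - l) ` Q 0 i'" using z(5) by (intro image_eqI[of _ _ "z - l'"]) auto
      then have "z \<in> (+) l ` (Q 0 i \<inter> (+) (l' - l) ` Q 0 i')" using z(4) by (intro image_eqI[of _ _ "z - l"]) auto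
      then have "z \<in> (if l \<noteq> l' \<or> i \<noteq> i' then (+) l ` (Q 0 i \<inter> (+) (l' - l) ` Q 0 i') else {})"
        using z(3) by simp
      then show "z \<in> ?U" using z(1,2) by blast
    qed
    show "?U \<subseteq> overlaps"
    proof
      fix z assume "z \<in> ?U"
      then obtain l l' i i' where z: "l \<in> int_vectors" "l' \<in> int_vectors"
        "z \<in> (if l \<noteq> l' \<or> i \<noteq> i' then (+) l ` (Q 0 i \<inter> (+) (l' - l) ` Q 0 i') else {})" by blast
      then have ne: "l \<noteq> l' \<or> i \<noteq> i'" by (metis empty_iff)
      then have "z \<in> (+) l ` (Q 0 i \<inter> (+) (l' - l) ` Q 0 i')" using z(3) by (simp only: if_True)
      then obtain q q' where q: "z = l + q" "q \<in> Q 0 i" "q = (l' - l) + q'" "q' \<in> Q 0 i'" by blast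
      have "z - l = q" "z - l' = q'" using q(1) by (simp, simp add: q(1,3))
      then have "z - l \<in> Q 0 i" "z - l' \<in> Q 0 i'" using q(2,4) by simp_all
      then show "z \<in> overlaps" unfolding overlaps_def using z(1,2) ne by blast
    qed
  qed
  moreover have "(if l \<noteq> l' \<or> i \<noteq> i' then (+) l ` (Q 0 i \<inter> (+) (l' - l) ` Q 0 i') else {}) \<in> null_sets lborel"
    if l: "l \<in> int_vectors" "l' \<in> int_vectors" for l l' i i'
  proof (cases "l \<noteq> l' \<or> i \<noteq> i'")
    case True
    have b: "Q 0 i \<inter> (+) (l' - l) ` Q 0 i' \<in> sets borel"
      using compact_Q by (intro sets.Int borel_compact compact_translation)
    have "compact (Q 0 i \<inter> (+) (l' - l) ` Q 0 i')"
      using compact_Q by (intro compact_Int compact_translation)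
    then have "(+) l ` (Q 0 i \<inter> (+) (l' - l) ` Q 0 i') \<in> sets lborel"
      using borel_compact[OF compact_translation] by simp
    moreover have "emeasure lborel ((+) l ` (Q 0 i \<inter> (+) (l' - l) ` Q 0 i')) = 0"
      unfolding emeasure_lborel_shift[OF b]
      by (rule overlap_null) (use l True in \<open>auto intro: int_vectors_diff\<close>)
    ultimately show ?thesis using True by (simp add: null_sets_def)
  qed simp
  ultimately show ?thesis
    by (simp only:) (intro null_sets_UN' countable_int_vectors, auto)
qed

lemma overlaps_borel [measurable]: "overlaps \<in> sets borel"
  using overlaps_null by (auto simp: null_sets_def)

lemma unique_tile:
  assumes "z \<notin> overlaps" "l \<in> int_vectors" "l' \<in> int_vectors" "z - l \<in> Q 0 i" "z - l' \<in> Q 0 i'"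
  shows "l = l' \<and> i = i'"
  using assms unfolding overlaps_def by blast

lemma tile_exists: "\<exists>l\<in>int_vectors. \<exists>i. z - l \<in> Q 0 i"
  using R_covers[of z] by (auto simp: R_def)

lemma overlaps_shift:
  assumes k: "k \<in> int_vectors" and z: "z + k \<in> overlaps"
  shows "z \<in> overlaps"
proof -
  obtain l l' i i' where l: "l \<in> int_vectors" "l' \<in> int_vectors" "l \<noteq> l' \<or> i \<noteq> i'"
    "z + k - l \<in> Q 0 i" "z + k - l' \<in> Q 0 i'" using z unfolding overlaps_def by blast
  have "z - (l - k) \<in> Q 0 i" "z - (l' - k) \<in> Q 0 i'" using l(4,5) by (simp_all add: algebra_simps)
  moreover have "l - k \<in> int_vectors" "l' - k \<in> int_vectors" "l - k \<noteq> l' - k \<or> i \<noteq> i'"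
    using l(1-3) k int_vectors_diff by auto
  ultimately show ?thesis unfolding overlaps_def by blast
qed

text \<open>Null overlap becomes a topological statement: near \<open>x\<close> there are interior
  points of its own tile too, because tiles are closures of their interiors, and a nonempty open set
  is not null.\<close>

lemma interior_disjoint:
  assumes l: "l \<in> int_vectors" "l \<noteq> 0 \<or> i \<noteq> i'" and x: "x \<in> Q 0 i'" "x - l \<in> interior (Q 0 i)"
  shows False
proof -
  define U where "U = (+) l ` interior (Q 0 i)"
  have oU: "open U" unfolding U_def by (intro open_translation open_interior)
  have xU: "x \<in> U" unfolding U_def using x(2) by (intro image_eqI[of _ _ "x - l"]) auto
  have "x \<in> closure (interior (Q 0 i'))" using x(1) Q_0_regular[of i'] by simp
  then have ne: "U \<inter> interior (Q 0 i') \<noteq> {}" using open_Int_closure_eq_empty[OF oU] xU by blast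
  have op: "open (U \<inter> interior (Q 0 i'))" using oU by auto
  have sub: "U \<inter> interior (Q 0 i') \<subseteq> Q 0 i' \<inter> (+) l ` Q 0 i"
    unfolding U_def using interior_subset by blast
  have "Q 0 i' \<inter> (+) l ` Q 0 i \<in> sets borel"
    using compact_Q by (intro sets.Int borel_compact compact_translation)
  then have "emeasure lborel (U \<inter> interior (Q 0 i')) \<le> emeasure lborel (Q 0 i' \<inter> (+) l ` Q 0 i)"
    using sub by (intro emeasure_mono) simp_all
  also have "\<dots> = 0" using l by (intro overlap_null) auto
  finally have "U \<inter> interior (Q 0 i') \<in> null_sets lborel" using op by (simp add: null_sets_def)
  then have "negligible (U \<inter> interior (Q 0 i'))"
    by (simp add: negligible_iff_null_sets null_sets_completionI)
  then show False using open_not_negligible[OF op ne] by blast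
qed

text \<open>The prefix \<open>r\<close> locates a point of a tile, and \<open>v\<close> is the
  beginning of its coding.\<close>

definition occ :: "word \<Rightarrow> word \<Rightarrow> bool" where
  "occ r v \<longleftrightarrow> (\<exists>n i. prefix (r @ v) (wd a n [i]))"

lemma occ_extend:
  assumes "PL a r j"
  shows "\<exists>v. length v = Suc N \<and> occ r v \<and> v ! 0 = j"
proof -
  obtain n i where n: "prefix (r @ [j]) (wd a n [i])" using assms by (auto simp: PL_def)
  obtain M where M: "length r + Suc N < length (wd a M [i])" using length_wd_unbounded by blast
  define w where "w = wd a (n + M) [i]"
  have "prefix (wd a n [i]) w" "prefix (wd a M [i]) w"
    using prefix_wd_add[of a n i M] prefix_wd_add[of a M i n] by (simp_all add: w_def add.commute)
  then have p: "prefix (r @ [j]) w" "length r + Suc N < length w"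
    using n M prefix_length_le[of "wd a M [i]" w] by (auto intro: prefix_order.order_trans)
  then obtain z where z: "w = r @ j # z" by (auto simp: prefix_def)
  define v where "v = take (Suc N) (j # z)"
  have "prefix (r @ v) w" unfolding z v_def using take_is_prefix by simp
  then have "occ r v" unfolding occ_def w_def by blast
  moreover have "length v = Suc N" using p(2) by (simp add: v_def z)
  ultimately show ?thesis by (intro exI[of _ v]) (simp add: v_def)
qed

lemma occ_mem:
  assumes "occ r v" "k < length v"
  shows "val tau r + val tau (take k v) \<in> Q 0 (v ! k)"
proof -
  obtain n i where n: "prefix (r @ v) (wd a n [i])" using assms(1) by (auto simp: occ_def)
  have "prefix (take (Suc k) v) v" by (rule take_is_prefix)
  then have "prefix (r @ take (Suc k) v) (wd a n [i])" using n by (meson prefix_order.order_trans same_prefix_prefix)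
  then have "prefix ((r @ take k v) @ [v ! k]) (wd a n [i])" using assms(2) by (simp add: take_Suc_conv_app_nth)
  then have "PL a (r @ take k v) (v ! k)" unfolding PL_def by blast
  from Q_0_memI[OF this] show ?thesis by simp
qed

text \<open>The domain exchange on \<open>R\<close>: at generating points, adding
  \<open>tau j\<close> reads the letter \<open>j\<close> and leads to the tile of the next letter.
  Closedness of \<open>R\<close> extends this to the tile.\<close>

lemma exchange:
  assumes "x \<in> Q 0 j"
  shows "x + tau j \<in> R"
proof -
  have "closed ((\<lambda>x. x + tau j) -` R)"
    using compact_R compact_imp_closed by (intro closed_vimage continuous_intros) auto
  moreover have "{val (lev 0) r | r. PL (sh 0 a) r j} \<subseteq> (\<lambda>x. x + tau j) -` R"
  proof clarsimp
    fix r assume "PL a r j"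
    then obtain v where v: "length v = Suc 1" "occ r v" "v ! 0 = j" using occ_extend by blast
    have "take 1 v = [j]" using v(1,3) by (cases v) auto
    then have "val tau r + tau j \<in> Q 0 (v ! 1)" using occ_mem[OF v(2), of 1] v(1) by simp
    then show "val (lev 0) r + tau j \<in> R" by (auto simp: R_def lev_def)
  qed
  ultimately have "Q 0 j \<subseteq> (\<lambda>x. x + tau j) -` R" unfolding Q_def by (intro closure_minimal)
  then show ?thesis using assms by blast
qed

abbreviation "X \<equiv> sadic_shift (\<lambda>i. AR (a i))"

text \<open>\<open>X\<close> is defined by factors, the tiles by prefixes. Since \<open>i\<close>
  occurs in a word of higher level, a factor of a word over \<open>i\<close> does occur behind some
  prefix.\<close>

lemma X_occ:
  assumes "w \<in> X"
  shows "\<exists>r. occ r (map w [0..<N])"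
proof -
  obtain i n where "sublist (map w [0..<N]) (wd a n [i])" using assms unfolding sadic_shift_def by blast
  then obtain ps ss where s: "wd a n [i] = ps @ map w [0..<N] @ ss" by (auto simp: sublist_def)
  obtain k where k: "n \<le> k" "a k = i" using rec by blast
  have "i \<in> set (wd (sh n a) (Suc (k - n)) [1])" using k by (intro letter_in_wd[of "k - n"]) (auto simp: sh_def)
  then obtain xs ys where "wd (sh n a) (Suc (k - n)) [1] = xs @ i # ys" by (meson split_list)
  then have "wd a (n + Suc (k - n)) [1] = wd a n xs @ wd a n [i] @ wd a n ys"
    by (metis wd_add wd_append wd_Cons)
  then have "prefix ((wd a n xs @ ps) @ map w [0..<N]) (wd a (n + Suc (k - n)) [1])"
    unfolding s by (simp add: prefix_def)
  then show ?thesis unfolding occ_def by blast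
qed

lemma occ_X:
  assumes "\<And>N. \<exists>r. occ r (map w [0..<N])"
  shows "w \<in> X"
  unfolding sadic_shift_def
proof (intro CollectI allI)
  fix k l
  obtain r n i where "prefix (r @ map w [0..<l]) (wd a n [i])" using assms[of l] by (auto simp: occ_def)
  then have "sublist (map w [0..<l]) (wd a n [i])" by (auto simp: prefix_def sublist_def)
  moreover have "sublist (map w [k..<l]) (map w [0..<l])"
  proof (cases "k \<le> l")
    case True
    then have "map w [0..<l] = map w [0..<k] @ map w [k..<l]" by (metis map_append upt_add_eq_append le_add_diff_inverse le0)
    then show ?thesis by (simp add: sublist_append_rightI)
  qed simp
  ultimately show "\<exists>i n. sublist (map w [k..<l]) (wd a n [i])" by (meson sublist_order.order_trans)
qed

text \<open>The orbit is followed in \<open>R\<close> under the exchange of tiles, without reduction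
  to the unit cube.\<close>

definition coded :: "inf_word \<Rightarrow> real^2 \<Rightarrow> bool" where
  "coded w x \<longleftrightarrow> (\<forall>n. x + val tau (map w [0..<n]) \<in> Q 0 (w n))"

text \<open>Nested compact sets. The closed set \<open>F\<close> is carried along because the same
  argument later expresses preimages of closed sets under \<open>pt\<close> by finite
  prefixes.\<close>

lemma coded_closed_exists:
  assumes F: "closed F" and ne: "\<And>N. \<exists>x\<in>F. \<forall>k<N. x + val tau (map w [0..<k]) \<in> Q 0 (w k)"
  shows "\<exists>x\<in>F. coded w x"
proof -
  define K where "K N = F \<inter> (\<Inter>k\<in>{..N}. (\<lambda>x. x + val tau (map w [0..<k])) -` Q 0 (w k))" for N
  have cl: "closed ((\<lambda>x. x + v) -` Q 0 i)" for v i
    using compact_Q compact_imp_closed by (intro closed_vimage continuous_intros) auto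
  have "compact (K N)" for N
  proof -
    have "closed (K N)" unfolding K_def using F cl by (intro closed_Int closed_INT) auto
    moreover have "K N \<subseteq> Q 0 (w 0)" unfolding K_def by auto
    ultimately show ?thesis using compact_Q[of 0 "w 0"] closed_Int_compact[of "K N" "Q 0 (w 0)"]
      by (simp add: Int_absorb2)
  qed
  moreover have "K N \<noteq> {}" for N using ne[of "Suc N"] unfolding K_def by (auto simp: less_Suc_eq_le)
  moreover have "K N \<subseteq> K M" if "M \<le> N" for M N using that unfolding K_def by auto
  ultimately have "\<Inter>(range K) \<noteq> {}" by (intro compact_nest)
  then obtain x where x: "\<And>N. x \<in> K N" by blast
  then have "x \<in> F" "coded w x" unfolding K_def coded_def by auto
  then show ?thesis by blast
qed

lemma coded_exists: "w \<in> X \<Longrightarrow> \<exists>x. coded w x"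
proof -
  assume w: "w \<in> X"
  have "\<exists>x\<in>UNIV. \<forall>k<N. x + val tau (map w [0..<k]) \<in> Q 0 (w k)" for N
  proof -
    obtain r where r: "occ r (map w [0..<N])" using X_occ[OF w] by blast
    have "val tau r + val tau (map w [0..<k]) \<in> Q 0 (w k)" if "k < N" for k
      using occ_mem[OF r, of k] that by (simp add: take_map)
    then show ?thesis by blast
  qed
  then show ?thesis using coded_closed_exists[of UNIV w] by auto
qed

text \<open>
  Two points with the same coding differ by a vector \<open>d\<close> that maps every tile into itself, because the orbit is
  dense; iterating contradicts compactness unless \<open>d = 0\<close>.
\<close>

lemma coded_unique:
  assumes "coded w x" "coded w x'"
  shows "x = x'"
proof (rule ccontr)
  assume ne: "x \<noteq> x'"
  define d where "d = x' - x"
  have shift_int: "z + d \<in> Q 0 i" if z: "z \<in> interior (Q 0 i)" for z i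
  proof -
    have "z + d \<in> closure (Q 0 i)"
      unfolding closure_approachable
    proof (intro allI impI)
      fix e :: real assume "0 < e"
      obtain e' where e': "0 < e'" "ball z e' \<subseteq> interior (Q 0 i)" using z open_interior open_contains_ball by blast
      obtain v where v: "dist (val tau v) (z - x) < min e e'" using val_tau_dense[of "min e e'" "z - x"] \<open>0 < e\<close> e' by auto
      define n where "n = length v"
      define k where "k = val tau (map w [0..<n]) - val tau v"
      have k: "k \<in> int_vectors" unfolding k_def by (rule val_tau_lattice) (simp add: n_def)
      have eq: "x + val tau (map w [0..<n]) - k = x + val tau v" by (simp add: k_def)
      have "dist (x + val tau v) z = dist (val tau v) (z - x)" by (simp add: dist_norm algebra_simps)
      then have near: "dist (x + val tau v) z < e" "x + val tau v \<in> ball z e'"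
        using v by (auto simp: dist_commute)
      have m: "x + val tau (map w [0..<n]) \<in> Q 0 (w n)" "x' + val tau (map w [0..<n]) \<in> Q 0 (w n)"
        using assms unfolding coded_def by auto
      \<comment> \<open>An interior point of tile \<open>i\<close> lies in no other translated tile,
        so the letter read there is \<open>i\<close> with shift 0; the second orbit then visits the
        same tile, displaced by \<open>d\<close>.\<close>
      have "x + val tau (map w [0..<n]) - k \<in> interior (Q 0 i)" unfolding eq using near e' by blast
      then have "k = 0" "i = w n" using interior_disjoint[OF k _ m(1)] by blast+
      then have "x' + val tau v \<in> Q 0 i" using m(2) by (simp add: k_def)
      moreover have "dist (x' + val tau v) (z + d) = dist (x + val tau v) z"
        by (simp add: d_def dist_norm algebra_simps)
      ultimately show "\<exists>y\<in>Q 0 i. dist y (z + d) < e"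
        using near(1) by (intro bexI[of _ "x' + val tau v"]) simp_all
    qed
    then show ?thesis using compact_imp_closed[OF compact_Q[of 0 i]] by simp
  qed
  have sub: "z + d \<in> Q 0 1" if "z \<in> Q 0 1" for z
  proof -
    have "closed ((\<lambda>z. z + d) -` Q 0 1)"
      using compact_Q compact_imp_closed by (intro closed_vimage continuous_intros) auto
    moreover have "interior (Q 0 1) \<subseteq> (\<lambda>z. z + d) -` Q 0 1" using shift_int by auto
    ultimately have "closure (interior (Q 0 1)) \<subseteq> (\<lambda>z. z + d) -` Q 0 1" by (intro closure_minimal)
    then show ?thesis using that Q_0_regular[of 1] by auto
  qed
  obtain z where z: "z \<in> Q 0 1" using interior_Q[of 0 1] interior_subset by blast
  have it: "z + real n *\<^sub>R d \<in> Q 0 1" for n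
  proof (induction n)
    case (Suc n)
    then show ?case using sub[of "z + real n *\<^sub>R d"] by (simp add: algebra_simps)
  qed (simp add: z)
  obtain B where B: "\<And>y. y \<in> Q 0 1 \<Longrightarrow> norm y \<le> B" using compact_Q[of 0 1] compact_imp_bounded bounded_iff by metis
  have d0: "0 < norm d" using ne by (simp add: d_def)
  obtain n :: nat where n: "(B + norm z + 1) / norm d < real n" using reals_Archimedean2 by blast
  then have "B + norm z + 1 < real n * norm d" using d0 by (simp add: divide_less_eq)
  also have "\<dots> = norm ((z + real n *\<^sub>R d) - z)" by simp
  also have "\<dots> \<le> norm (z + real n *\<^sub>R d) + norm z" by (rule norm_triangle_ineq4)
  also have "\<dots> \<le> B + norm z" using B[OF it[of n]] by simp
  finally show False by simp
qed

definition "pt w = (THE x. coded w x)"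

lemma pt_coded: "w \<in> X \<Longrightarrow> coded w (pt w)"
  unfolding pt_def by (metis coded_exists coded_unique theI)

lemma pt_eq: "coded w x \<Longrightarrow> pt w = x"
  unfolding pt_def using coded_unique by blast

lemma coded_shift:
  assumes "coded w x"
  shows "coded (shift w) (x + tau (w 0))"
  unfolding coded_def
proof
  fix n
  have "map w [0..<Suc n] = w 0 # map (shift w) [0..<n]"
    unfolding shift_def by (rule map_upt_Suc)
  then have "x + tau (w 0) + val tau (map (shift w) [0..<n]) = x + val tau (map w [0..<Suc n])"
    by (simp only: val_Cons add.assoc)
  then show "x + tau (w 0) + val tau (map (shift w) [0..<n]) \<in> Q 0 (shift w n)"
    using assms unfolding coded_def shift_def by metis
qed

lemma shift_X: "w \<in> X \<Longrightarrow> shift w \<in> X"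
proof -
  assume w: "w \<in> X"
  show ?thesis
    unfolding sadic_shift_def
  proof (intro CollectI allI)
    fix k l
    have "map (shift w) [k..<l] = map w [Suc k..<Suc l]"
      unfolding map_Suc_upt[symmetric] by (simp add: shift_def comp_def del: map_Suc_upt)
    moreover obtain i n where "sublist (map w [Suc k..<Suc l]) (wd a n [i])"
      using w unfolding sadic_shift_def by blast
    ultimately show "\<exists>i n. sublist (map (shift w) [k..<l]) (wd a n [i])" by metis
  qed
qed

section \<open>Points with an unambiguous coding\<close>

definition "Y = {y \<in> cube. \<forall>n. y + real n *\<^sub>R tt \<notin> overlaps}"

definition "code y n = (THE i. \<exists>l\<in>int_vectors. y + real n *\<^sub>R tt - l \<in> Q 0 i)"

lemma code_eq:
  assumes "y + real n *\<^sub>R tt \<notin> overlaps" "l \<in> int_vectors" "y + real n *\<^sub>R tt - l \<in> Q 0 i"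
  shows "code y n = i"
  unfolding code_def by (rule the_equality) (use assms unique_tile in blast)+

lemma val_map_int: "val tau (map w [0..<n]) - real n *\<^sub>R tt \<in> int_vectors"
  using val_tau_tt[of "map w [0..<n]"] by simp

text \<open>By \<open>exchange\<close> the orbit stays in \<open>R\<close>, and outside the overlaps
  the tile containing the current point can only be the one that \<open>code\<close> names.\<close>

lemma coded_code:
  assumes y: "\<And>n. y + real n *\<^sub>R tt \<notin> overlaps" and l: "l \<in> int_vectors" "y - l \<in> Q 0 i"
  shows "coded (code y) (y - l)"
  unfolding coded_def
proof
  fix n
  have step: "y - l + val tau (map (code y) [0..<n]) \<in> Q 0 (code y n)"
    if r: "y - l + val tau (map (code y) [0..<n]) \<in> R" for n
  proof -
    obtain j where j: "y - l + val tau (map (code y) [0..<n]) \<in> Q 0 j" using r by (auto simp: R_def)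
    define k where "k = l - (val tau (map (code y) [0..<n]) - real n *\<^sub>R tt)"
    have "k \<in> int_vectors" unfolding k_def by (intro int_vectors_diff l val_map_int)
    moreover have "y + real n *\<^sub>R tt - k = y - l + val tau (map (code y) [0..<n])" by (simp add: k_def)
    ultimately have "code y n = j" using code_eq[OF y, of k] j by metis
    then show ?thesis using j by simp
  qed
  have "y - l + val tau (map (code y) [0..<n]) \<in> R"
  proof (induction n)
    case 0
    then show ?case using l(2) by (auto simp: R_def)
  next
    case (Suc n)
    from exchange[OF step[OF Suc]] show ?case by (simp add: add.assoc)
  qed
  then show "y - l + val tau (map (code y) [0..<n]) \<in> Q 0 (code y n)" by (rule step)
qed

text \<open>A point of a tile need not be a generating point, but the tile is covered by finitely
  many closures, one for each choice of the next \<open>N + 1\<close> letters. The point satisfies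
  the closed tile conditions of such a choice, and outside the overlaps these determine the
  letters.\<close>

lemma code_X:
  assumes y: "\<And>n. y + real n *\<^sub>R tt \<notin> overlaps"
  shows "code y \<in> X"
proof (rule occ_X)
  fix N
  obtain l i where l: "l \<in> int_vectors" "y - l \<in> Q 0 i" using tile_exists by blast
  define A where "A v = {val tau r | r. occ r v}" for v
  define V where "V = {v :: word. length v = Suc N}"
  have fV: "finite V" unfolding V_def using finite_lists_length_eq[of "UNIV :: letter set" "Suc N"] by simp
  have "{val (lev 0) r | r. PL (sh 0 a) r i} \<subseteq> \<Union>(A ` V)"
  proof clarsimp
    fix r assume "PL a r i"
    then obtain v where "length v = Suc N" "occ r v" using occ_extend by blast
    then show "\<exists>v\<in>V. val (lev 0) r \<in> A v" by (auto simp: V_def A_def lev_def)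
  qed
  also have "\<Union>(A ` V) \<subseteq> (\<Union>v\<in>V. closure (A v))" using closure_subset by blast
  finally have "closure {val (lev 0) r | r. PL (sh 0 a) r i} \<subseteq> (\<Union>v\<in>V. closure (A v))"
    by (rule closure_minimal) (intro closed_UN fV, simp)
  then have "y - l \<in> (\<Union>v\<in>V. closure (A v))" using l(2) unfolding Q_def by blast
  then obtain v where v: "length v = Suc N" "y - l \<in> closure (A v)" by (auto simp: V_def)
  have mem: "y - l + val tau (take k v) \<in> Q 0 (v ! k)" if "k < Suc N" for k
  proof -
    have "closed ((\<lambda>x. x + val tau (take k v)) -` Q 0 (v ! k))"
      using compact_Q compact_imp_closed by (intro closed_vimage continuous_intros) auto
    moreover have "A v \<subseteq> (\<lambda>x. x + val tau (take k v)) -` Q 0 (v ! k)"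
      using occ_mem[of _ v k] that v(1) by (auto simp: A_def)
    ultimately have "closure (A v) \<subseteq> (\<lambda>x. x + val tau (take k v)) -` Q 0 (v ! k)" by (intro closure_minimal)
    then show ?thesis using v(2) by blast
  qed
  have "v ! k = code y k" if "k < Suc N" for k
  proof -
    define m where "m = l - (val tau (take k v) - real k *\<^sub>R tt)"
    have "m \<in> int_vectors" unfolding m_def
      using val_tau_tt[of "take k v"] that v(1) l(1) int_vectors_diff by fastforce
    moreover have "y + real k *\<^sub>R tt - m \<in> Q 0 (v ! k)"
      using mem[OF that] by (simp add: m_def algebra_simps)
    ultimately have "code y k = v ! k" by (rule code_eq[OF y])
    then show ?thesis by simp
  qed
  then have vN: "take N v = map (code y) [0..<N]" using v(1) by (intro nth_equalityI) auto
  have "A v \<noteq> {}" using v(2) by auto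
  then obtain r where "occ r v" by (auto simp: A_def)
  then have "occ r (take N v)" unfolding occ_def
    by (metis append_take_drop_id append_assoc append_prefixD)
  then show "\<exists>r. occ r (map (code y) [0..<N])" unfolding vN by blast
qed

definition "\<phi> w = fr (pt w)"

lemma code_in_X: "y \<in> Y \<Longrightarrow> code y \<in> X"
  by (rule code_X) (simp add: Y_def)

lemma pt_code: "y \<in> Y \<Longrightarrow> \<phi> (code y) = y"
proof -
  assume y: "y \<in> Y"
  then have yn: "\<And>n. y + real n *\<^sub>R tt \<notin> overlaps" by (simp add: Y_def)
  obtain l i where l: "l \<in> int_vectors" "y - l \<in> Q 0 i" using tile_exists by blast
  have "pt (code y) = y - l" by (rule pt_eq[OF coded_code[OF yn l]])
  then show ?thesis unfolding \<phi>_def using y l(1)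
    by (intro fr_eqI) (auto simp: Y_def int_vectors_uminus)
qed

lemma code_phi:
  assumes w: "w \<in> X" "\<phi> w \<in> Y"
  shows "code (\<phi> w) = w"
proof
  fix n
  have c: "pt w + val tau (map w [0..<n]) \<in> Q 0 (w n)" using pt_coded[OF w(1)] by (simp add: coded_def)
  define k where "k = - floor_vec (pt w) - (val tau (map w [0..<n]) - real n *\<^sub>R tt)"
  have "k \<in> int_vectors" unfolding k_def by (intro int_vectors_diff int_vectors_uminus floor_vec_int val_map_int)
  moreover have "\<phi> w + real n *\<^sub>R tt - k = pt w + val tau (map w [0..<n])" by (simp add: k_def \<phi>_def fr_def)
  ultimately show "code (\<phi> w) n = w n" using w(2) c by (intro code_eq[of _ _ k]) (auto simp: Y_def)
qed

lemma phi_shift: "w \<in> X \<Longrightarrow> \<phi> (shift w) = torus_translation tt (\<phi> w)"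
proof -
  assume w: "w \<in> X"
  have "pt (shift w) = pt w + tau (w 0)" by (rule pt_eq[OF coded_shift[OF pt_coded[OF w]]])
  moreover have "pt w + tau (w 0) - (\<phi> w + tt) = floor_vec (pt w) + (val tau [w 0] - real (length [w 0]) *\<^sub>R tt)"
    by (simp add: \<phi>_def fr_def)
  then have "pt w + tau (w 0) - (\<phi> w + tt) \<in> int_vectors" using int_vectors_add floor_vec_int val_tau_tt by metis
  ultimately show ?thesis unfolding torus_translation_fr by (metis \<phi>_def fr_cong)
qed

lemma Y_invariant:
  assumes "y \<in> Y"
  shows "torus_translation tt y \<in> Y"
proof -
  have "torus_translation tt y + real n *\<^sub>R tt \<notin> overlaps" for n
  proof
    assume A: "torus_translation tt y + real n *\<^sub>R tt \<in> overlaps"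
    have "(y + real (Suc n) *\<^sub>R tt) + (- floor_vec (y + tt)) = torus_translation tt y + real n *\<^sub>R tt"
      by (simp add: torus_translation_eq algebra_simps)
    then have "y + real (Suc n) *\<^sub>R tt \<in> overlaps"
      using A overlaps_shift[OF int_vectors_uminus[OF floor_vec_int[of "y + tt"]]] by metis
    then show False using assms unfolding Y_def by blast
  qed
  then show ?thesis by (simp add: Y_def torus_translation_fr fr_cube)
qed

lemma code_shift: "y \<in> Y \<Longrightarrow> shift (code y) = code (torus_translation tt y)"
proof -
  assume y: "y \<in> Y"
  have cX: "code y \<in> X" using y by (intro code_X) (simp add: Y_def)
  have "\<phi> (shift (code y)) = torus_translation tt y" using phi_shift[OF cX] pt_code[OF y] by simp
  then show ?thesis using code_phi[OF shift_X[OF cX]] Y_invariant[OF y] by simp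
qed

lemma translate_null: "(\<lambda>y. y + v) -` overlaps \<in> null_sets lborel"
proof -
  have "(\<lambda>y. y + v) -` overlaps = (+) (- v) ` overlaps"
    by (auto intro!: image_eqI[of _ _ "y + v" for y])
  moreover have "(\<lambda>y. y + v) -` overlaps \<inter> space borel \<in> sets borel" by measurable
  ultimately show ?thesis
    using overlaps_null emeasure_lborel_shift[OF overlaps_borel, of "- v"] by (simp add: null_sets_def)
qed

lemma Y_borel: "Y \<in> sets borel"
proof -
  have "Y = cube \<inter> (\<Inter>n. - ((\<lambda>y. y + real n *\<^sub>R tt) -` overlaps))" by (auto simp: Y_def)
  moreover have "- ((\<lambda>y. y + real n *\<^sub>R tt) -` overlaps) \<in> sets borel" for n
    using translate_null[of "real n *\<^sub>R tt"] by (auto simp: null_sets_def intro: borel_comp)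
  ultimately show ?thesis by auto
qed

lemma Y_sets_torus: "Y \<in> sets torus"
  unfolding sets_torus using Y_borel by (auto simp: sets_restrict_space Y_def)

lemma AE_Y: "AE y in torus. y \<in> Y"
proof -
  have "AE y in lborel. \<forall>n. y + real n *\<^sub>R tt \<notin> overlaps"
    unfolding AE_all_countable
  proof
    fix n
    show "AE y in lborel. y + real n *\<^sub>R tt \<notin> overlaps"
      by (rule AE_I'[OF translate_null[of "real n *\<^sub>R tt"]]) auto
  qed
  then show ?thesis unfolding torus_eq by (subst AE_restrict_space_iff) (auto simp: Y_def)
qed

section \<open>Measurability of the coding maps\<close>

abbreviation "words \<equiv> PiM UNIV (\<lambda>_::nat. count_space (UNIV :: letter set))"
abbreviation "MX \<equiv> restrict_space words X"

lemma space_MX: "space MX = X"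
  by (simp add: space_restrict_space space_PiM)

lemma words_prefix_sets: "{w. map w [0..<N] \<in> G} \<in> sets words"
proof -
  have "{w. map w [0..<N] \<in> G} = (\<Union>v\<in>{v\<in>G. length v = N}. \<Inter>k\<in>{..<N}. {w \<in> space words. w k = v ! k})"
  proof
    show "{w. map w [0..<N] \<in> G} \<subseteq> (\<Union>v\<in>{v\<in>G. length v = N}. \<Inter>k\<in>{..<N}. {w \<in> space words. w k = v ! k})"
    proof
      fix w assume "w \<in> {w. map w [0..<N] \<in> G}"
      then show "w \<in> (\<Union>v\<in>{v\<in>G. length v = N}. \<Inter>k\<in>{..<N}. {w \<in> space words. w k = v ! k})"
        by (intro UN_I[of "map w [0..<N]"]) (auto simp: space_PiM)
    qed
    show "(\<Union>v\<in>{v\<in>G. length v = N}. \<Inter>k\<in>{..<N}. {w \<in> space words. w k = v ! k}) \<subseteq> {w. map w [0..<N] \<in> G}"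
    proof
      fix w assume "w \<in> (\<Union>v\<in>{v\<in>G. length v = N}. \<Inter>k\<in>{..<N}. {w \<in> space words. w k = v ! k})"
      then obtain v where v: "v \<in> G" "length v = N" "\<And>k. k < N \<Longrightarrow> w k = v ! k" by auto
      then have "map w [0..<N] = v" by (intro nth_equalityI) auto
      then show "w \<in> {w. map w [0..<N] \<in> G}" using v by simp
    qed
  qed
  moreover have "(\<Inter>k\<in>{..<N}. {w \<in> space words. w k = v ! k}) \<in> sets words" for v
  proof (cases "N = 0")
    case True
    then show ?thesis using sets.top[of words] by (simp add: space_PiM)
  next
    case False
    have "{w \<in> space words. w k = v ! k} \<in> sets words" for k
      by measurable
    then show ?thesis using False by (intro sets.finite_INT) auto
  qed
  moreover have "countable {v\<in>G. length v = N}" by (rule countableI_type[THEN countable_subset[rotated]]) auto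
  ultimately show ?thesis by (simp only:) (intro sets.countable_UN', auto)
qed

text \<open>\<open>pt w\<close> lies in a closed set exactly if, for every finite prefix of
  \<open>w\<close>, some point of the set meets the tile conditions of that prefix. This is a
  countable intersection of conditions on prefixes.\<close>

lemma pt_measurable: "pt \<in> borel_measurable MX"
proof -
  have cl: "pt -` F \<inter> space MX \<in> sets MX" if F: "closed F" for F
  proof -
    define G where "G N = {v. \<exists>x\<in>F. \<forall>k<N. x + val tau (take k v) \<in> Q 0 (v ! k)}" for N :: nat
    have G: "map w [0..<N] \<in> G N \<longleftrightarrow> (\<exists>x\<in>F. \<forall>k<N. x + val tau (map w [0..<k]) \<in> Q 0 (w k))" for w N
      unfolding G_def by (auto simp: take_map)
    have "pt -` F \<inter> space MX = (\<Inter>N. {w. map w [0..<N] \<in> G N}) \<inter> X"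
    proof
      show "pt -` F \<inter> space MX \<subseteq> (\<Inter>N. {w. map w [0..<N] \<in> G N}) \<inter> X"
      proof
        fix w assume w: "w \<in> pt -` F \<inter> space MX"
        then have "coded w (pt w)" using pt_coded by (simp add: space_MX)
        then have "map w [0..<N] \<in> G N" for N unfolding G coded_def using w by blast
        then show "w \<in> (\<Inter>N. {w. map w [0..<N] \<in> G N}) \<inter> X" using w by (simp add: space_MX)
      qed
      show "(\<Inter>N. {w. map w [0..<N] \<in> G N}) \<inter> X \<subseteq> pt -` F \<inter> space MX"
      proof
        fix w assume w: "w \<in> (\<Inter>N. {w. map w [0..<N] \<in> G N}) \<inter> X"
        then have "\<exists>x\<in>F. \<forall>k<N. x + val tau (map w [0..<k]) \<in> Q 0 (w k)" for N unfolding G[symmetric] by blast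
        then obtain x where "x \<in> F" "coded w x" using coded_closed_exists[OF F] by blast
        then show "w \<in> pt -` F \<inter> space MX" using w pt_eq by (auto simp: space_MX)
      qed
    qed
    moreover have "UNIV \<in> sets words" using sets.top[of words] by (simp add: space_PiM)
    then have "(\<Inter>N. {w. map w [0..<N] \<in> G N}) \<in> sets words"
      using words_prefix_sets by (intro sets.countable_INT'') auto
    ultimately show ?thesis by (auto simp: sets_restrict_space)
  qed
  show ?thesis
  proof (rule borel_measurableI)
    fix S :: "(real^2) set" assume "open S"
    then have "pt -` (- S) \<inter> space MX \<in> sets MX" by (intro cl) auto
    then have "space MX - (pt -` (- S) \<inter> space MX) \<in> sets MX" by (rule sets.compl_sets)
    moreover have "space MX - (pt -` (- S) \<inter> space MX) = pt -` S \<inter> space MX" by auto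
    ultimately show "pt -` S \<inter> space MX \<in> sets MX" by simp
  qed
qed

lemma phi_measurable: "\<phi> \<in> measurable MX torus"
proof -
  have "\<phi> \<in> borel_measurable MX"
    unfolding \<phi>_def[abs_def] by (rule measurable_compose[OF pt_measurable fr_measurable])
  then show ?thesis
    unfolding measurable_cong_sets[OF refl sets_torus]
    by (intro measurable_restrict_space2) (auto simp: \<phi>_def fr_cube)
qed

lemma Y_nonempty: "Y \<noteq> {}"
proof
  assume "Y = {}"
  interpret prob_space "torus :: (real^2) measure" by (rule prob_space_torus)
  have "emeasure torus Y = 1" using AE_Y Y_sets_torus by (intro emeasure_eq_1_AE) auto
  then show False using \<open>Y = {}\<close> by simp
qed

text \<open>A default value that makes \<psi> total with values in \<open>X\<close>; it is used only
  off \<open>Y\<close>, on a null set.\<close>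

definition "w0 = (SOME w. w \<in> X)"

lemma w0_X: "w0 \<in> X"
proof -
  obtain y where "y \<in> Y" using Y_nonempty by blast
  then have "code y \<in> X" by (intro code_X) (simp add: Y_def)
  then show ?thesis unfolding w0_def by (rule someI[of "\<lambda>w. w \<in> X"])
qed

definition "\<psi> y = (if y \<in> Y then code y else w0)"

lemma psi_X: "\<psi> y \<in> X"
  using w0_X code_X[of y] by (simp add: \<psi>_def Y_def)

lemma psi_measurable: "\<psi> \<in> measurable torus MX"
proof (rule measurable_restrict_space2)
  show "\<psi> \<in> space torus \<rightarrow> X" using psi_X by blast
  have comp: "(\<lambda>y. \<psi> y n) \<in> measurable torus (count_space UNIV)" for n
  proof -
    have "(\<lambda>y. \<psi> y n) -` {i} \<inter> space torus \<in> sets torus" for i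
    proof -
      define E where "E = (\<Union>l\<in>int_vectors. (\<lambda>y. y + (real n *\<^sub>R tt - l)) -` Q 0 i)"
      have "E \<in> sets borel"
        unfolding E_def
      proof (rule sets.countable_UN''[OF countable_int_vectors])
        show "(\<lambda>y. y + (real n *\<^sub>R tt - l)) -` Q 0 i \<in> sets borel" for l
          using compact_Q compact_imp_closed
          by (intro borel_closed closed_vimage continuous_intros) auto
      qed
      then have EY: "E \<inter> Y \<in> sets torus" using Y_borel unfolding sets_torus
        by (auto simp: sets_restrict_space Y_def intro!: image_eqI[of _ _ "E \<inter> Y"])
      have cE: "code y n = i \<longleftrightarrow> y \<in> E" if y: "y \<in> Y" for y
      proof
        assume "code y n = i"
        obtain l j where l: "l \<in> int_vectors" "y + real n *\<^sub>R tt - l \<in> Q 0 j" using tile_exists by blast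
        then have "code y n = j" using y by (intro code_eq[of _ _ l]) (auto simp: Y_def)
        then have "y + (real n *\<^sub>R tt - l) \<in> Q 0 i" using \<open>code y n = i\<close> l by (simp add: add_diff_eq)
        then show "y \<in> E" unfolding E_def using l by blast
      next
        assume "y \<in> E"
        then obtain l where "l \<in> int_vectors" "y + real n *\<^sub>R tt - l \<in> Q 0 i"
          unfolding E_def by (auto simp: add_diff_eq)
        then show "code y n = i" using y by (intro code_eq[of _ _ l]) (auto simp: Y_def)
      qed
      have "(\<lambda>y. \<psi> y n) -` {i} \<inter> space torus = (E \<inter> Y) \<union> (if w0 n = i then space torus - Y else {})"
      proof -
        have Yc: "Y \<subseteq> cube" by (auto simp: Y_def)
        show ?thesis
        proof (rule set_eqI)
          fix y
          show "y \<in> (\<lambda>y. \<psi> y n) -` {i} \<inter> space torus \<longleftrightarrow>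
              y \<in> (E \<inter> Y) \<union> (if w0 n = i then space torus - Y else {})"
            using cE[of y] Yc by (cases "y \<in> Y") (auto simp: \<psi>_def space_torus)
        qed
      qed
      moreover have "(if w0 n = i then space torus - Y else {}) \<in> sets torus"
        using Y_sets_torus by (auto intro: sets.compl_sets)
      ultimately show ?thesis using EY by auto
    qed
    then show ?thesis by (simp add: measurable_count_space_eq2)
  qed
  show "\<psi> \<in> measurable torus words"
    by (rule measurable_PiM_single') (use comp in \<open>auto\<close>)
qed

section \<open>The invariant measure and the conjugacy\<close>

lemma shift_measurable_words: "shift \<in> measurable words words"
  unfolding shift_def by (rule measurable_PiM_single') auto

lemma shift_measurable: "shift \<in> measurable MX MX"
  by (rule measurable_restrict_space3[OF shift_measurable_words]) (use shift_X in auto)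

text \<open>An invariant probability is pushed by \<phi> to a rotation-invariant one, hence to
  Lebesgue measure. So almost every word has its image in \<open>Y\<close>, where \<psi> recovers
  the word, and the measure is the image of Lebesgue measure under \<psi>.\<close>

lemma invariant_measure_eq: "invariant_measure X = distr torus MX \<psi>" "shift_invariant_prob X (distr torus MX \<psi>)"
proof -
  interpret tor: prob_space "torus :: (real^2) measure" by (rule prob_space_torus)
  let ?\<mu> = "distr torus MX \<psi>"
  have shm: "shift \<in> measurable ?\<mu> ?\<mu>" using shift_measurable by simp
  show inv: "shift_invariant_prob X ?\<mu>"
    unfolding shift_invariant_prob_def
  proof (intro conjI)
    show "prob_space ?\<mu>" by (rule tor.prob_space_distr[OF psi_measurable])
    show "sets ?\<mu> = sets MX" by simp
    show "shift \<in> measurable ?\<mu> ?\<mu>" by (rule shm)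
    have "distr ?\<mu> ?\<mu> shift = distr ?\<mu> MX shift" by (rule distr_cong) auto
    also have "\<dots> = distr torus MX (shift \<circ> \<psi>)"
      by (rule distr_distr[OF shift_measurable psi_measurable])
    also have "\<dots> = distr torus MX (\<psi> \<circ> torus_translation tt)"
    proof (rule distr_cong_AE)
      show "AE y in torus. (shift \<circ> \<psi>) y = (\<psi> \<circ> torus_translation tt) y"
        using AE_Y by eventually_elim (auto simp: \<psi>_def code_shift Y_invariant)
      show "shift \<circ> \<psi> \<in> measurable torus MX" by (rule measurable_comp[OF psi_measurable shift_measurable])
      show "\<psi> \<circ> torus_translation tt \<in> measurable torus MX"
        by (rule measurable_comp[OF torus_translation_measurable psi_measurable])
    qed auto
    also have "\<dots> = distr (distr torus torus (torus_translation tt)) MX \<psi>"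
      by (rule distr_distr[symmetric, OF psi_measurable torus_translation_measurable])
    also have "\<dots> = ?\<mu>" by (simp add: torus_translation_invariant)
    finally show "distr ?\<mu> ?\<mu> shift = ?\<mu>" .
  qed
  have uniq: "\<mu> = ?\<mu>" if "shift_invariant_prob X \<mu>" for \<mu>
  proof -
    have m: "prob_space \<mu>" "sets \<mu> = sets MX" "shift \<in> measurable \<mu> \<mu>" "distr \<mu> \<mu> shift = \<mu>"
      using that by (auto simp: shift_invariant_prob_def)
    interpret mu: prob_space \<mu> by (rule m(1))
    have sp: "space \<mu> = X" using sets_eq_imp_space_eq[OF m(2)] space_MX by simp
    have pm: "\<phi> \<in> measurable \<mu> torus" using phi_measurable measurable_cong_sets[OF m(2) refl] by blast
    let ?\<nu> = "distr \<mu> torus \<phi>"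
    have "?\<nu> = torus"
    proof (rule unique_ergodicity)
      show "prob_space ?\<nu>" by (rule mu.prob_space_distr[OF pm])
      show "sets ?\<nu> = sets torus" by simp
      have "distr ?\<nu> ?\<nu> (torus_translation tt) = distr ?\<nu> torus (torus_translation tt)" by (rule distr_cong) auto
      also have "\<dots> = distr \<mu> torus (torus_translation tt \<circ> \<phi>)"
        by (rule distr_distr[OF torus_translation_measurable pm])
      also have "\<dots> = distr \<mu> torus (\<phi> \<circ> shift)"
        by (rule distr_cong) (auto simp: sp phi_shift)
      also have "\<dots> = distr (distr \<mu> \<mu> shift) torus \<phi>"
        by (rule distr_distr[symmetric, OF pm m(3)])
      also have "\<dots> = ?\<nu>" by (simp add: m(4))
      finally show "distr ?\<nu> ?\<nu> (torus_translation tt) = ?\<nu>" .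
    qed
    then have "?\<mu> = distr ?\<nu> MX \<psi>" by simp
    also have "\<dots> = distr \<mu> MX (\<psi> \<circ> \<phi>)" by (rule distr_distr[OF psi_measurable pm])
    also have "\<dots> = distr \<mu> MX (\<lambda>w. w)"
    proof (rule distr_cong_AE)
      have "AE y in ?\<nu>. y \<in> Y" unfolding \<open>?\<nu> = torus\<close> by (rule AE_Y)
      then have "AE w in \<mu>. \<phi> w \<in> Y" by (rule AE_distrD[OF pm])
      then show "AE w in \<mu>. (\<psi> \<circ> \<phi>) w = w"
        by (rule AE_mp) (auto simp: \<psi>_def code_phi sp intro!: AE_I2)
      show "\<psi> \<circ> \<phi> \<in> measurable \<mu> MX" by (rule measurable_comp[OF pm psi_measurable])
      show "(\<lambda>w. w) \<in> measurable \<mu> MX" using measurable_ident_sets[OF m(2)] by (simp add: id_def)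
    qed auto
    also have "\<dots> = \<mu>" by (rule distr_id2[OF m(2)[symmetric]])
    finally show ?thesis by simp
  qed
  show "invariant_measure X = ?\<mu>"
    unfolding invariant_measure_def by (rule the_equality) (rule inv, rule uniq)
qed

theorem conjugacy: "measurably_conjugate (invariant_measure X) shift torus (torus_translation tt)"
proof -
  define \<mu> where "\<mu> = invariant_measure X"
  have m: "\<mu> = distr torus MX \<psi>" by (simp add: \<mu>_def invariant_measure_eq(1))
  have sm: "sets \<mu> = sets MX" "space \<mu> = X" by (simp_all add: m space_MX)
  have pm: "\<phi> \<in> measurable \<mu> torus" using phi_measurable measurable_cong_sets[OF sm(1) refl] by blast
  define X0 where "X0 = {w \<in> X. \<phi> w \<in> Y}"
  have X0: "X0 \<in> sets \<mu>"
  proof -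
    have "\<phi> -` Y \<inter> space \<mu> \<in> sets \<mu>" by (rule measurable_sets[OF pm Y_sets_torus])
    moreover have "\<phi> -` Y \<inter> space \<mu> = X0" by (auto simp: X0_def sm)
    ultimately show ?thesis by simp
  qed
  have AEX: "AE w in \<mu>. w \<in> X0"
  proof -
    have "AE y in torus. \<psi> y \<in> X0" using AE_Y
      by eventually_elim (use code_in_X pt_code in \<open>auto simp: X0_def \<psi>_def\<close>)
    moreover have "{w \<in> space MX. w \<in> X0} \<in> sets MX"
    proof -
      have "{w \<in> space MX. w \<in> X0} = X0" by (auto simp: space_MX X0_def)
      then show ?thesis using X0 sm by simp
    qed
    ultimately show ?thesis unfolding m by (simp add: AE_distr_iff[OF psi_measurable])
  qed
  have dphi: "distr \<mu> torus \<phi> = torus"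
  proof -
    have "distr \<mu> torus \<phi> = distr torus torus (\<phi> \<circ> \<psi>)"
      unfolding m by (rule distr_distr[OF phi_measurable psi_measurable])
    also have "\<dots> = distr torus torus (\<lambda>y. y)"
    proof (rule distr_cong_AE)
      show "AE y in torus. (\<phi> \<circ> \<psi>) y = y" using AE_Y by eventually_elim (simp add: \<psi>_def pt_code)
      show "\<phi> \<circ> \<psi> \<in> measurable torus torus" by (rule measurable_comp[OF psi_measurable phi_measurable])
    qed auto
    also have "\<dots> = torus" by (rule distr_id2) simp
    finally show ?thesis .
  qed
  have phiR: "\<phi> \<in> measurable (restrict_space \<mu> X0) (restrict_space torus Y)"
    by (rule measurable_restrict_space3[OF pm]) (auto simp: X0_def)
  have psiR: "code \<in> measurable (restrict_space torus Y) (restrict_space \<mu> X0)"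
  proof -
    have "\<psi> \<in> measurable torus \<mu>" using psi_measurable measurable_cong_sets[OF refl sm(1)] by blast
    then have "\<psi> \<in> measurable (restrict_space torus Y) (restrict_space \<mu> X0)"
      by (rule measurable_restrict_space3) (use code_in_X pt_code in \<open>auto simp: X0_def \<psi>_def\<close>)
    then show ?thesis
      by (rule measurable_cong[THEN iffD1, rotated]) (auto simp: \<psi>_def space_restrict_space)
  qed
  have "distr (restrict_space \<mu> X0) (restrict_space torus Y) \<phi> = restrict_space torus Y"
  proof (rule measure_eqI)
    fix A assume "A \<in> sets (distr (restrict_space \<mu> X0) (restrict_space torus Y) \<phi>)"
    then have A: "A \<in> sets (restrict_space torus Y)" by simp
    then have A': "A \<in> sets torus" "A \<subseteq> Y"
      using Y_sets_torus by (auto simp: sets_restrict_space)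
    have "emeasure (distr (restrict_space \<mu> X0) (restrict_space torus Y) \<phi>) A =
        emeasure (restrict_space \<mu> X0) (\<phi> -` A \<inter> space (restrict_space \<mu> X0))"
      by (rule emeasure_distr[OF phiR A])
    also have "\<phi> -` A \<inter> space (restrict_space \<mu> X0) = \<phi> -` A \<inter> space \<mu>"
      using A'(2) by (auto simp: space_restrict_space X0_def sm(2))
    also have "emeasure (restrict_space \<mu> X0) (\<phi> -` A \<inter> space \<mu>) = emeasure \<mu> (\<phi> -` A \<inter> space \<mu>)"
      using A'(2) X0 sets.Int[OF X0 sets.top]
      by (intro emeasure_restrict_space) (auto simp: X0_def sm(2))
    also have "\<dots> = emeasure (distr \<mu> torus \<phi>) A" by (rule emeasure_distr[symmetric, OF pm A'(1)])
    also have "\<dots> = emeasure (restrict_space torus Y) A"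
      using A' Y_sets_torus by (simp add: dphi emeasure_restrict_space)
    finally show "emeasure (distr (restrict_space \<mu> X0) (restrict_space torus Y) \<phi>) A = emeasure (restrict_space torus Y) A" .
  qed simp
  moreover have "shift ` X0 \<subseteq> X0" using shift_X phi_shift Y_invariant by (auto simp: X0_def)
  ultimately show ?thesis
    unfolding measurably_conjugate_def \<mu>_def[symmetric]
    using X0 AEX Y_sets_torus AE_Y Y_invariant phiR psiR
    by (intro exI[of _ X0] exI[of _ Y] exI[of _ \<phi>] exI[of _ code])
      (auto simp: X0_def code_phi pt_code phi_shift)
qed

text \<open>The starting point of a word is \<open>pt w\<close>. Words whose orbits run through
  overlaps are included, since \<open>coded\<close> asks only for membership in closed
  tiles.\<close>

theorem natural_codings_X: "natural_codings int_vectors tt X"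
  unfolding natural_codings_def
proof (intro conjI exI)
  show "full_rank_lattice (int_vectors :: (real^2) set)"
    unfolding full_rank_lattice_def
  proof (intro exI conjI)
    show "independent (Basis :: (real^2) set)" by (rule independent_Basis)
    show "span Basis = (UNIV :: (real^2) set)" by (rule span_Basis)
    show "int_vectors = {(\<Sum>b\<in>Basis. of_int (c b) *\<^sub>R b) | c :: real^2 \<Rightarrow> int. True}"
    proof
      show "int_vectors \<subseteq> {(\<Sum>b\<in>Basis. of_int (c b) *\<^sub>R b) | c :: real^2 \<Rightarrow> int. True}"
      proof
        fix x :: "real^2" assume x: "x \<in> int_vectors"
        have "x \<bullet> b = of_int \<lfloor>x \<bullet> b\<rfloor>" if "b \<in> Basis" for b
          using that x by (auto simp: Basis_vec_def inner_axis int_vectors_def)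
        then have "x = (\<Sum>b\<in>Basis. of_int \<lfloor>x \<bullet> b\<rfloor> *\<^sub>R b)"
          by (metis (mono_tags, lifting) euclidean_representation sum.cong)
        then show "x \<in> {(\<Sum>b\<in>Basis. of_int (c b) *\<^sub>R b) | c :: real^2 \<Rightarrow> int. True}"
          by (intro CollectI exI[of _ "\<lambda>b. \<lfloor>x \<bullet> b\<rfloor>"]) simp
      qed
      show "{(\<Sum>b\<in>Basis. of_int (c b) *\<^sub>R b) | c :: real^2 \<Rightarrow> int. True} \<subseteq> int_vectors"
      proof clarify
        fix c :: "real^2 \<Rightarrow> int"
        have "b $ i \<in> \<int>" if "b \<in> Basis" for b :: "real^2" and i
          using that by (auto simp: Basis_vec_def axis_def)
        then show "(\<Sum>b\<in>Basis. of_int (c b) *\<^sub>R b) \<in> (int_vectors :: (real^2) set)"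
          by (auto simp: int_vectors_def intro!: Ints_sum Ints_mult)
      qed
    qed
  qed
  show "fundamental_domain int_vectors R"
    unfolding fundamental_domain_def
  proof
    show "R \<in> sets lebesgue" using compact_R by (simp add: borel_compact)
    show "AE x in lborel. \<exists>!z. z \<in> int_vectors \<and> x - z \<in> R"
    proof (rule AE_I'[OF overlaps_null])
      show "{x \<in> space lborel. \<not> (\<exists>!z. z \<in> int_vectors \<and> x - z \<in> R)} \<subseteq> overlaps"
      proof clarify
        fix x assume x: "\<not> (\<exists>!z. z \<in> int_vectors \<and> x - z \<in> R)"
        show "x \<in> overlaps"
        proof (rule ccontr)
          assume "x \<notin> overlaps"
          then have "\<exists>!z. z \<in> int_vectors \<and> x - z \<in> R"
            using R_covers[of x] unique_tile[of x] unfolding R_def by blast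
          then show False using x by blast
        qed
      qed
    qed
  qed
  show "partition_ae R (Q 0)"
    unfolding partition_ae_def
  proof (intro conjI allI impI)
    show "R = (\<Union>i. Q 0 i)" by (simp add: R_def)
    show "compact (Q 0 i)" for i by (rule compact_Q)
    show "Q 0 i = closure (interior (Q 0 i))" for i by (rule Q_0_regular)
    show "negligible (Q 0 i \<inter> Q 0 j)" if "i \<noteq> j" for i j
    proof -
      have "emeasure lborel (Q 0 i \<inter> (+) 0 ` Q 0 j) = 0" using that by (intro overlap_null) auto
      then have "Q 0 i \<inter> Q 0 j \<in> null_sets lborel" by (simp add: null_sets_def)
      then show ?thesis by (simp add: negligible_iff_null_sets null_sets_completionI)
    qed
  qed
  show "\<forall>i. \<forall>x\<in>Q 0 i. induced_map int_vectors tt R x (x + tau i)"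
  proof (intro allI ballI)
    fix i x assume x: "x \<in> Q 0 i"
    have "tau i - tt \<in> int_vectors" using val_tau_tt[of "[i]"] by simp
    then show "induced_map int_vectors tt R x (x + tau i)"
      using x exchange[OF x] by (auto simp: induced_map_def R_def)
  qed
  show "\<forall>w\<in>X. \<exists>x\<in>R. \<forall>n. x + (\<Sum>k<n. tau (w k)) \<in> Q 0 (w n)"
  proof
    fix w assume "w \<in> X"
    then have c: "coded w (pt w)" by (rule pt_coded)
    have s: "(\<Sum>k<n. tau (w k)) = val tau (map w [0..<n])" for n
      by (induction n) auto
    have "pt w + val tau (map w [0..<0]) \<in> Q 0 (w 0)" using c unfolding coded_def by blast
    then have "pt w \<in> R" by (auto simp: R_def)
    then show "\<exists>x\<in>R. \<forall>n. x + (\<Sum>k<n. tau (w k)) \<in> Q 0 (w n)"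
      using c unfolding coded_def s by blast
  qed
qed

end

section \<open>Limit words and the tiling of the plane\<close>

lemma prefix_inf_iff: "prefix_inf v w \<longleftrightarrow> (\<forall>k<length v. v ! k = w k)"
  unfolding prefix_inf_def list_eq_iff_nth_eq by auto

lemma length_subst_word_AR: "length v \<le> length (subst_word (AR i) v)"
  by (induction v) (auto simp: subst_word_def AR_def)

text \<open>\<open>subst_inf\<close> reads position \<open>k\<close> off the image of the first
  \<open>k + 1\<close> letters. Whichever of these letters and \<open>v\<close> is the shorter word,
  its image is a prefix of the image of the other.\<close>

lemma prefix_inf_subst:
  assumes "prefix_inf v w"
  shows "prefix_inf (subst_word (AR i) v) (subst_inf (AR i) w)"
  unfolding prefix_inf_iff
proof (intro allI impI)
  fix k assume k: "k < length (subst_word (AR i) v)"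
  let ?s = "subst_word (AR i)"
  have app: "?s (x @ y) = ?s x @ ?s y" for x y by (simp add: subst_word_def)
  have v: "v = map w [0..<length v]" using assms unfolding prefix_inf_def .
  have k': "k < length (?s (map w [0..<Suc k]))"
    using length_subst_word_AR[of "map w [0..<Suc k]" i] by simp
  have split: "map w [0..<m] = map w [0..<l] @ map w [l..<m]" if "l \<le> m" for l m
    unfolding map_append[symmetric] using upt_add_eq_append[OF le0, of l "m - l"]
    unfolding le_add_diff_inverse[OF that] by (rule arg_cong)
  show "?s v ! k = subst_inf (AR i) w k"
  proof (cases "Suc k \<le> length v")
    case True
    have "?s (map w [0..<length v]) = ?s (map w [0..<Suc k]) @ ?s (map w [Suc k..<length v])"
      unfolding split[OF True] by (rule app)
    then have "?s v = ?s (map w [0..<Suc k]) @ ?s (map w [Suc k..<length v])" unfolding v[symmetric] .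
    then show ?thesis unfolding subst_inf_def using k' by (simp only: nth_append if_True)
  next
    case False
    then have le: "length v \<le> Suc k" by simp
    have "?s (map w [0..<Suc k]) = ?s (map w [0..<length v]) @ ?s (map w [length v..<Suc k])"
      unfolding split[OF le] by (rule app)
    then have "?s (map w [0..<Suc k]) = ?s v @ ?s (map w [length v..<Suc k])" unfolding v[symmetric] .
    then show ?thesis unfolding subst_inf_def using k by (simp only: nth_append if_True)
  qed
qed

lemma limit_word_prefix:
  assumes "\<And>n. W n = subst_inf (AR (a n)) (W (Suc n))" "prefix_inf v (W n)"
  shows "prefix_inf (wd a n v) (W 0)"
  using assms(2)
proof (induction n arbitrary: v)
  case (Suc n)
  have "prefix_inf (subst_word (AR (a n)) v) (W n)"
    using prefix_inf_subst[OF Suc.prems] assms(1)[of n] by simp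
  then show ?case using Suc.IH by simp
qed simp

lemma prefix_inf_prefix: "prefix_inf v w \<Longrightarrow> prefix_inf v' w \<Longrightarrow> length v \<le> length v' \<Longrightarrow> prefix v v'"
proof -
  assume a: "prefix_inf v w" "prefix_inf v' w" "length v \<le> length v'"
  then have "take (length v) v' = v" by (intro nth_equalityI) (auto simp: prefix_inf_iff)
  then show "prefix v v'" by (metis take_is_prefix)
qed

lemma prefix_inf_mono: "prefix v v' \<Longrightarrow> prefix_inf v' w \<Longrightarrow> prefix_inf v w"
proof -
  assume a: "prefix v v'" "prefix_inf v' w"
  then obtain z where z: "v' = v @ z" by (auto simp: prefix_def)
  show "prefix_inf v w" unfolding prefix_inf_iff
  proof (intro allI impI)
    fix k assume k: "k < length v"
    then have "v' ! k = w k" using a(2) z by (simp add: prefix_inf_iff)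
    then show "v ! k = w k" using k z by (simp add: nth_append)
  qed
qed

lemma wd_sh_Suc: "subst_word (AR (a n)) (wd (sh (Suc n) a) M v) = wd (sh n a) (Suc M) v"
proof -
  have "wd (sh n a) (1 + M) v = wd (sh n a) 1 (wd (sh 1 (sh n a)) M v)" by (rule wd_add)
  moreover have "sh 1 (sh n a) = sh (Suc n) a" by (auto simp: sh_def)
  moreover have "wd (sh n a) 1 x = subst_word (AR (a n)) x" for x by (simp add: sh_def)
  ultimately show ?thesis by simp
qed

context ar_sequence
begin

text \<open>The words over \<open>j\<close> are nested prefixes of unbounded length. Their common
  extension, formed from each starting level \<open>n\<close>, gives the whole sequence of
  desubstitutions.\<close>

lemma limit_word_exists:
  obtains W where "\<And>n. W n = subst_inf (AR (a n)) (W (Suc n))" "\<And>n. prefix_inf (wd a n [j]) (W 0)"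
proof -
  have unb: "\<exists>M. k < length (wd (sh n a) M [j])" for n k
    using ar_sequence.length_wd_unbounded[OF ar_sequence_sh] .
  define W where "W n k = wd (sh n a) (SOME M. k < length (wd (sh n a) M [j])) [j] ! k" for n k
  have pre: "prefix_inf (wd (sh n a) M [j]) (W n)" for n M
    unfolding prefix_inf_iff
  proof (intro allI impI)
    fix k assume k: "k < length (wd (sh n a) M [j])"
    define M' where "M' = (SOME M. k < length (wd (sh n a) M [j]))"
    have k': "k < length (wd (sh n a) M' [j])" unfolding M'_def by (rule someI_ex[OF unb])
    have "prefix (wd (sh n a) M [j]) (wd (sh n a) M' [j]) \<or> prefix (wd (sh n a) M' [j]) (wd (sh n a) M [j])"
      using prefix_wd_add[of "sh n a" M j "M' - M"] prefix_wd_add[of "sh n a" M' j "M - M'"]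
      by (cases "M \<le> M'") simp_all
    then have "wd (sh n a) M [j] ! k = wd (sh n a) M' [j] ! k"
      using k k' by (auto simp: prefix_def nth_append)
    then show "wd (sh n a) M [j] ! k = W n k" by (simp add: W_def M'_def)
  qed
  have "W n = subst_inf (AR (a n)) (W (Suc n))" for n
  proof
    fix k
    obtain M where M: "k < length (wd (sh n a) M [j])" using unb by blast
    then have M': "k < length (wd (sh n a) (Suc M) [j])"
      using prefix_length_le[OF prefix_wd_add[of "sh n a" M j 1]] by simp
    have "prefix_inf (wd (sh n a) (Suc M) [j]) (subst_inf (AR (a n)) (W (Suc n)))"
      using prefix_inf_subst[OF pre[of "Suc n" M], of "a n"] by (simp only: wd_sh_Suc)
    then show "W n k = subst_inf (AR (a n)) (W (Suc n)) k"
      using pre[of n "Suc M"] M' unfolding prefix_inf_iff by simp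
  qed
  moreover have "prefix_inf (wd a n [j]) (W 0)" for n
    using pre[of 0 n] by (simp add: sh_def)
  ultimately show ?thesis using that by blast
qed

text \<open>Each word over a letter begins with that letter, so all desubstitutions of a limit word
  share the first letter \<open>W 0 0\<close>, and the limit word extends the words of all levels
  over it.\<close>

lemma limit_word_iff_PL:
  "(\<exists>\<omega>. limit_word (\<lambda>n. AR (a n)) \<omega> \<and> prefix_inf (p @ [i]) \<omega>) \<longleftrightarrow> PL a p i"
proof
  assume "\<exists>\<omega>. limit_word (\<lambda>n. AR (a n)) \<omega> \<and> prefix_inf (p @ [i]) \<omega>"
  then obtain \<omega> where \<omega>: "limit_word (\<lambda>n. AR (a n)) \<omega>" "prefix_inf (p @ [i]) \<omega>" by (elim exE conjE)
  obtain W where W0: "W 0 = \<omega>" and W': "\<forall>n. W n = subst_inf (AR (a n)) (W (Suc n))"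
    using \<omega>(1) unfolding limit_word_def by (elim exE conjE)
  note W = spec[OF W'] and pW = \<omega>(2)[folded W0]
  have "prefix_inf (wd a n [W 0 0]) (W 0)" for n
  proof -
    have p: "prefix_inf (wd a n [W n 0]) (W 0)"
      by (rule limit_word_prefix[where W = W and a = a, OF W]) (simp add: prefix_inf_def)
    then have "wd a n [W n 0] ! 0 = W 0 0"
      using wd_nonempty[of "[W n 0]" a n] unfolding prefix_inf_iff by (simp add: length_greater_0_conv)
    then have "W n 0 = W 0 0" using wd_letter_hd[of a n "W n 0"] by auto
    then show ?thesis using p by simp
  qed
  moreover obtain n where "length p < length (wd a n [W 0 0])" using length_wd_unbounded by blast
  ultimately have "prefix (p @ [i]) (wd a n [W 0 0])" using pW by (intro prefix_inf_prefix) auto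
  then show "PL a p i" unfolding PL_def by blast
next
  assume "PL a p i"
  then obtain n j where n: "prefix (p @ [i]) (wd a n [j])" unfolding PL_def by blast
  obtain W where W: "\<And>n. W n = subst_inf (AR (a n)) (W (Suc n))" "\<And>n. prefix_inf (wd a n [j]) (W 0)"
    using limit_word_exists[of j] by blast
  have "limit_word (\<lambda>n. AR (a n)) (W 0)"
    unfolding limit_word_def by (intro exI[of _ W] conjI allI refl W(1))
  moreover have "prefix_inf (p @ [i]) (W 0)" using prefix_inf_mono[OF n W(2)] .
  ultimately show "\<exists>\<omega>. limit_word (\<lambda>n. AR (a n)) \<omega> \<and> prefix_inf (p @ [i]) \<omega>" by blast
qed

end

section \<open>The plane orthogonal to the all-ones vector\<close>

definition plane_map :: "real^2 \<Rightarrow> real^3" where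
  "plane_map y = y $ 1 *\<^sub>R (axis 1 1 - axis 3 1) + y $ 2 *\<^sub>R (axis 2 1 - axis 3 1)"

definition plane_coords :: "real^3 \<Rightarrow> real^2" where
  "plane_coords x = vector [x $ 1, x $ 2]"

lemma plane_map_nth [simp]:
  "plane_map y $ 1 = y $ 1" "plane_map y $ 2 = y $ 2" "plane_map y $ 3 = - y $ 1 - y $ 2"
  by (simp_all add: plane_map_def axis_def)

lemma plane_coords_nth [simp]: "plane_coords x $ 1 = x $ 1" "plane_coords x $ 2 = x $ 2"
  by (simp_all add: plane_coords_def)

lemma perp_one_iff: "x \<in> perp_one \<longleftrightarrow> x $ 1 + x $ 2 + x $ 3 = 0"
  by (simp add: perp_one_def inner_vec_def sum_3)

lemma plane_map_perp: "plane_map y \<in> perp_one"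
  by (simp add: perp_one_iff)

lemma plane_coords_map [simp]: "plane_coords (plane_map y) = y"
  by (simp add: vec_eq_iff forall_2)

lemma plane_map_coords: "x \<in> perp_one \<Longrightarrow> plane_map (plane_coords x) = x"
  by (simp add: vec_eq_iff forall_3 perp_one_iff)

lemma linear_plane_map: "linear plane_map"
  by (rule linearI) (simp_all add: vec_eq_iff forall_3 algebra_simps)

lemma linear_plane_coords: "linear plane_coords"
  by (rule linearI) (simp_all add: vec_eq_iff forall_2)

lemma inj_plane_map: "inj plane_map"
  by (metis injI plane_coords_map)

lemma continuous_on_plane_map [continuous_intros]: "continuous_on S plane_map"
  by (rule linear_continuous_on) (use linear_plane_map in \<open>simp add: linear_conv_bounded_linear\<close>)

lemma continuous_on_plane_coords: "continuous_on S plane_coords"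
  by (rule linear_continuous_on) (use linear_plane_coords in \<open>simp add: linear_conv_bounded_linear\<close>)

lemma plane_map_int_vectors: "plane_map l \<in> int_vectors \<longleftrightarrow> l \<in> int_vectors"
  by (auto simp: int_vectors_def forall_3 forall_2)

lemma homeomorphic_map_plane_map: "homeomorphic_map euclidean (top_of_set perp_one) plane_map"
  unfolding homeomorphic_map_maps homeomorphic_maps_def
  by (intro exI[of _ plane_coords])
    (auto simp: continuous_map_in_subtopology continuous_on_plane_map plane_map_perp
      plane_map_coords intro!: continuous_map_from_subtopology continuous_on_plane_coords)

text \<open>\<open>plane_map\<close> is a homeomorphism onto the plane with its subspace topology,
  in which the tiling takes interiors.\<close>

lemma plane_map_regular:
  assumes "S = closure (interior S)"
  shows "plane_map ` S = closure ((top_of_set perp_one) interior_of (plane_map ` S))"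
proof -
  have "(top_of_set perp_one) interior_of (plane_map ` S) = plane_map ` interior S"
    using homeomorphic_map_interior_of[OF homeomorphic_map_plane_map, of S] by simp
  then show ?thesis
    using closure_injective_linear_image[OF linear_plane_map inj_plane_map, of "interior S"] assms by simp
qed

text \<open>The exceptional set is enlarged by the complement of the plane, whose preimage under
  \<open>plane_map\<close> is empty.\<close>

lemma plane_measure_AE:
  assumes "N \<in> null_sets lborel" "\<And>y. y \<notin> N \<Longrightarrow> P (plane_map y)"
  shows "AE x in plane_measure. P x"
proof -
  have pm: "plane_map \<in> measurable lborel borel"
    using borel_measurable_continuous_onI[OF continuous_on_plane_map] by simp
  have pc: "plane_coords \<in> measurable borel borel"
    using borel_measurable_continuous_onI[OF continuous_on_plane_coords] by simp
  define Z where "Z = plane_coords -` N \<union> - perp_one"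
  have nb: "N \<in> sets borel" using assms(1) by (auto simp: null_sets_def)
  have cl: "perp_one \<in> sets borel"
  proof -
    have "closed perp_one" unfolding perp_one_def by (intro closed_Collect_eq continuous_intros)
    then show ?thesis by simp
  qed
  have Zb: "Z \<in> sets borel" unfolding Z_def
    using measurable_sets[OF pc nb] cl by (auto intro: sets.compl_sets[of _ borel, simplified])
  have "plane_map -` Z = N" by (auto simp: Z_def plane_map_perp)
  then have "emeasure plane_measure Z = 0"
    using emeasure_distr[OF pm Zb] assms(1) by (simp add: plane_measure_def plane_map_def[abs_def] null_sets_def)
  then have "Z \<in> null_sets plane_measure" using Zb by (simp add: null_sets_def plane_measure_def)
  moreover have "{x \<in> space plane_measure. \<not> P x} \<subseteq> Z"
    using assms(2) plane_map_coords unfolding Z_def by force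
  ultimately show ?thesis by (rule AE_I')
qed

context ar_recurrent
begin

lemma rauzy_fractal_eq: "rauzy_fractal (\<lambda>n. AR (a n)) i = plane_map ` Q 0 i"
proof -
  have pr: "proj_along (limit_direction (\<lambda>n. AR (a n))) (abelianization p) = plane_map (val tau p)" for p
  proof -
    have u3: "u 3 = 1 - u 1 - u 2" using norm_u by simp
    show ?thesis
      unfolding proj_along_limit_direction[OF dir norm_u] val_vdot vdot_tau
      by (simp add: vec_eq_iff forall_3 abelianization_def cnt_def u3) (simp add: algebra_simps)
  qed
  have "rauzy_fractal (\<lambda>n. AR (a n)) i = closure (plane_map ` {val tau p | p. PL a p i})"
    unfolding rauzy_fractal_def limit_word_iff_PL pr by (rule arg_cong[where f = closure]) blast
  also have "\<dots> = plane_map ` closure {val tau p | p. PL a p i}"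
    by (rule closure_injective_linear_image[OF linear_plane_map inj_plane_map, symmetric])
  finally show ?thesis by (simp add: Q_def lev_def sh_def)
qed

lemma rauzy_collection_eq:
  "rauzy_collection (\<lambda>n. AR (a n)) = {plane_map ` (+) l ` Q 0 i | l i. l \<in> int_vectors}"
proof -
  have tr: "(\<lambda>y. plane_map l + y) ` plane_map ` S = plane_map ` (+) l ` S" for l S
    using linear_add[OF linear_plane_map] by (simp add: image_image)
  have "rauzy_collection (\<lambda>n. AR (a n)) =
      {(\<lambda>y. plane_map l + y) ` plane_map ` Q 0 i | l i. l \<in> int_vectors}"
    unfolding rauzy_collection_def rauzy_fractal_eq
  proof (intro set_eqI iffI)
    fix S assume "S \<in> {(\<lambda>y. x + y) ` plane_map ` Q 0 i |x i. x \<in> int_vectors \<inter> perp_one}"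
    then obtain x i where x: "S = (\<lambda>y. x + y) ` plane_map ` Q 0 i" "x \<in> int_vectors" "x \<in> perp_one"
      by blast
    have "x = plane_map (plane_coords x)" using plane_map_coords[OF x(3)] by simp
    moreover have "plane_coords x \<in> int_vectors" using plane_map_int_vectors x(2) calculation by metis
    ultimately show "S \<in> {(\<lambda>y. plane_map l + y) ` plane_map ` Q 0 i | l i. l \<in> int_vectors}"
      using x(1) by (intro CollectI exI[of _ "plane_coords x"] exI[of _ i]) simp
  next
    fix S assume "S \<in> {(\<lambda>y. plane_map l + y) ` plane_map ` Q 0 i | l i. l \<in> int_vectors}"
    then obtain l i where l: "S = (\<lambda>y. plane_map l + y) ` plane_map ` Q 0 i" "l \<in> int_vectors" by blast
    then have "plane_map l \<in> int_vectors \<inter> perp_one" using plane_map_int_vectors plane_map_perp by blast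
    then show "S \<in> {(\<lambda>y. x + y) ` plane_map ` Q 0 i |x i. x \<in> int_vectors \<inter> perp_one}"
      using l(1) by blast
  qed
  then show ?thesis by (simp only: tr)
qed

text \<open>Uniqueness concerns tiles as sets; a point off \<open>overlaps\<close> determines even
  the translation and the letter.\<close>

theorem tiling: "tiling_of_plane (rauzy_collection (\<lambda>n. AR (a n)))"
  unfolding tiling_of_plane_def
proof (intro conjI ballI)
  fix S assume "S \<in> rauzy_collection (\<lambda>n. AR (a n))"
  then obtain l i where S: "S = plane_map ` (+) l ` Q 0 i" unfolding rauzy_collection_eq by blast
  show "S \<subseteq> perp_one" unfolding S using plane_map_perp by blast
  show "compact S" unfolding S
    using compact_Q by (intro compact_continuous_image continuous_on_plane_map compact_translation)
  show "S = closure ((top_of_set perp_one) interior_of S)"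
    unfolding S by (rule plane_map_regular) (simp only: interior_translation closure_translation flip: Q_0_regular)
next
  show "AE x in plane_measure. \<exists>!S. S \<in> rauzy_collection (\<lambda>n. AR (a n)) \<and> x \<in> S"
  proof (rule plane_measure_AE[OF overlaps_null])
    fix y assume y: "y \<notin> overlaps"
    have mem: "plane_map y \<in> plane_map ` (+) l ` Q 0 i \<longleftrightarrow> y - l \<in> Q 0 i" for l i
      unfolding inj_image_mem_iff[OF inj_plane_map]
      by (auto intro: image_eqI[of _ _ "y - l"])
    obtain l i where l: "l \<in> int_vectors" "y - l \<in> Q 0 i" using tile_exists by blast
    show "\<exists>!S. S \<in> rauzy_collection (\<lambda>n. AR (a n)) \<and> plane_map y \<in> S"
    proof (rule ex1I[of _ "plane_map ` (+) l ` Q 0 i"])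
      show "plane_map ` (+) l ` Q 0 i \<in> rauzy_collection (\<lambda>n. AR (a n)) \<and>
          plane_map y \<in> plane_map ` (+) l ` Q 0 i"
        using l mem unfolding rauzy_collection_eq by blast
    next
      fix S assume S: "S \<in> rauzy_collection (\<lambda>n. AR (a n)) \<and> plane_map y \<in> S"
      then obtain l' i' where l': "S = plane_map ` (+) l' ` Q 0 i'" "l' \<in> int_vectors"
        unfolding rauzy_collection_eq by blast
      then have "y - l' \<in> Q 0 i'" using S mem by blast
      then show "S = plane_map ` (+) l ` Q 0 i" using unique_tile[OF y l(1) l'(2) l(2)] l'(1) by blast
    qed
  qed
qed

end

lemma AR_inject: "AR i = AR j \<Longrightarrow> i = j"
  by (drule fun_cong[of _ _ i]) (simp add: AR_def split: if_splits)

theorem theorem3p8: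
  fixes \<sigma> :: "nat \<Rightarrow> substitution"
  assumes "\<And>n. \<sigma> n \<in> range AR"
    and "\<And>i. \<exists>n. \<sigma> n = AR i"
    and "recurrent \<sigma>"
    and "bounded_weak_partial_quotients \<sigma>"
  shows "tiling_of_plane (rauzy_collection \<sigma>) \<and>
    (\<exists>t :: real^2.
       measurably_conjugate (invariant_measure (sadic_shift \<sigma>)) shift
         torus (torus_translation t) \<and>
       natural_codings int_vectors t (sadic_shift \<sigma>))"
proof -
  have "\<forall>n. \<exists>i. \<sigma> n = AR i" using assms(1) by (simp add: image_iff)
  from choice[OF this] obtain a where a: "\<forall>n. \<sigma> n = AR (a n)" by (elim exE)
  have \<sigma>: "\<sigma> = (\<lambda>n. AR (a n))" by (rule ext) (rule spec[OF a])
  have eq: "\<sigma> m = \<sigma> n \<longleftrightarrow> a m = a n" for m n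
    unfolding \<sigma> by (intro iffI, erule AR_inject, simp only:)
  have rcr: "infinite {m. \<forall>j<l. a (m + j) = a (k + j)}" for k l
    using assms(3) unfolding recurrent_def eq by (elim allE)
  obtain h where h: "\<And>n. \<exists>j\<le>h. a (n + j) \<noteq> a n"
    using assms(4) unfolding bounded_weak_partial_quotients_def eq by blast
  \<comment> \<open>Recurrence of blocks of length 1 turns one occurrence of each substitution into
    infinitely many.\<close>
  have rec: "\<exists>m\<ge>n. a m = i" for n i
  proof -
    obtain k where "\<sigma> k = AR i" using assms(2) by blast
    then have k: "a k = i" unfolding \<sigma> by (rule AR_inject)
    obtain m where "m \<ge> n" "m \<in> {m. \<forall>j<1. a (m + j) = a (k + j)}"
      using rcr[where l = 1 and k = k] unfolding infinite_nat_iff_unbounded_le by blast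
    then show ?thesis using k by auto
  qed
  interpret ar_sequence a h by unfold_locales (fact rec, fact h)
  obtain u where u: "direction a u" "u 1 + u 2 + u 3 = 1" using direction_exists by blast
  interpret ar_recurrent a h u by unfold_locales (fact u, fact u, fact rcr)
  show ?thesis unfolding \<sigma> by (intro conjI exI[of _ tt] tiling conjugacy natural_codings_X)
qed

end
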